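(* Let $N\ge1$ and $0\le\theta_L\le\theta_R$. The invariant measure of the hidden parameter model on $[0,\infty)^{\{1,\dots,N\}}$ with generator $$\mathcal{L}f(\theta)=\mathcal{L}_1^{\theta_L}f(\theta)+\mathcal{L}_N^{\theta_R}f(\theta)+\sum_{i=1}^{N-1}\mathcal{L}_{i,i+1}f(\theta)$$ is the joint distribution of $(U_{1:N},\dots,U_{N:N})$, the order statistics (in increasing order) of $N$ independent uniform random variables on $[\theta_L,\theta_R]$. As a consequence, the invariant measure of the boundary driven continuous harmonic model on the chain $\{1,\dots,N\}$ with left and right reservoir parameters $\theta_L,\theta_R$ is a mixture of products of exponential distributions with means $(U_{1:N},\dots,U_{N:N})$, i.e. it is the law obtained by first sampling $(U_{1:N},\dots,U_{N:N})$ and then, conditionally on it, independent exponential random variables with these means at the sites $1,\dots,N$.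
   Context: $\delta_i$ is the configuration with value $1$ at $i$ and $0$ elsewhere. The uniform distribution on $[a,a]$ is the point mass at $a$, and the exponential distribution with mean $0$ is the point mass at $0$. Hidden parameter model generators: $$\mathcal{L}_1^{\theta_L}f(\theta)=\int_0^1\frac{du}{u}\big(f(\theta-u\theta_1\delta_1+u\theta_L\delta_1)-f(\theta)\big),\quad \mathcal{L}_N^{\theta_R}f(\theta)=\int_0^1\frac{du}{u}\big(f(\theta-u\theta_N\delta_N+u\theta_R\delta_N)-f(\theta)\big),$$ $$\mathcal{L}_{i,i+1}f(\theta)=\int_0^1\frac{du}{u}\big(f(\theta-u\theta_i\delta_i+u\theta_{i+1}\delta_i)+f(\theta-u\theta_{i+1}\delta_{i+1}+u\theta_i\delta_{i+1})-2f(\theta)\big).$$ Boundary driven continuous harmonic model on the chain: the Markov process on $[0,\infty)^{\{1,\dots,N\}}$ with generator $$Lf(\zeta)=L_1^{\theta_L}f(\zeta)+L_N^{\theta_R}f(\zeta)+\sum_{i=1}^{N-1}\int_0^1\frac{du}{u}\big(f(\zeta-u\zeta_i\delta_i+u\zeta_i\delta_{i+1})+f(\zeta-u\zeta_{i+1}\delta_{i+1}+u\zeta_{i+1}\delta_i)-2f(\zeta)\big),$$ where $L_i^{\theta^*}f(\zeta)=\int_0^1\frac{du}{u}\big(f(\zeta-u\zeta_i\delta_i)-f(\zeta)\big)+\int_0^\infty\frac{du}{u}e^{-u}\big(f(\zeta+u\theta^*\delta_i)-f(\zeta)\big)$. *)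

theory Defs
  imports "HOL-Probability.Probability"
begin

definition C0 :: "'a::topological_space set \<Rightarrow> ('a \<Rightarrow> real) set" where
  "C0 X = {f. continuous_on X f \<and>
     (\<forall>e>0. \<exists>K. compact K \<and> K \<subseteq> X \<and> (\<forall>x\<in>X - K. \<bar>f x\<bar> < e))}"

definition semigroup_op :: "(real \<Rightarrow> 'a \<Rightarrow> 'a measure) \<Rightarrow> real \<Rightarrow> ('a \<Rightarrow> real) \<Rightarrow> 'a \<Rightarrow> real" where
  "semigroup_op P t f x = (\<integral>y. f y \<partial>P t x)"

text \<open>Transition probabilities of a (conservative, time-homogeneous) Feller process with state
  space \<open>space M\<close>. Only times \<open>t \<ge> 0\<close> and starting points in \<open>space M\<close> matter.\<close>

definition feller_semigroup ::
    "'a::topological_space measure \<Rightarrow> (real \<Rightarrow> 'a \<Rightarrow> 'a measure) \<Rightarrow> bool" where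
  "feller_semigroup M P \<longleftrightarrow>
     (\<forall>t\<ge>0. P t \<in> M \<rightarrow>\<^sub>M prob_algebra M) \<and>
     (\<forall>x\<in>space M. P 0 x = return M x) \<and>
     (\<forall>s\<ge>0. \<forall>t\<ge>0. \<forall>x\<in>space M. P (s + t) x = Giry_Monad.bind (P s x) (P t)) \<and>
     (\<forall>t\<ge>0. \<forall>f\<in>C0 (space M). semigroup_op P t f \<in> C0 (space M)) \<and>
     (\<forall>f\<in>C0 (space M). uniform_limit (space M) (\<lambda>t. semigroup_op P t f) f (at_right 0))"

definition generator_graph ::
    "'a::topological_space measure \<Rightarrow> (real \<Rightarrow> 'a \<Rightarrow> 'a measure) \<Rightarrow> ('a \<Rightarrow> real) \<Rightarrow> ('a \<Rightarrow> real) \<Rightarrow> bool"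
  where
  "generator_graph M P f g \<longleftrightarrow> f \<in> C0 (space M) \<and> g \<in> C0 (space M) \<and>
     uniform_limit (space M) (\<lambda>t x. (semigroup_op P t f x - f x) / t) g (at_right 0)"

text \<open>\<open>P\<close> is the semigroup of the Markov process with generator \<open>L\<close>: its infinitesimal generator is
  the closure in the supremum norm of the operator \<open>L\<close> defined on the set \<open>D\<close> of test functions,
  that is, it extends \<open>L\<close> and \<open>D\<close> is a core. This determines \<open>P\<close>.\<close>

definition markov_semigroup_with_generator ::
    "'a::topological_space measure \<Rightarrow> ('a \<Rightarrow> real) set \<Rightarrow> (('a \<Rightarrow> real) \<Rightarrow> 'a \<Rightarrow> real) \<Rightarrow>
     (real \<Rightarrow> 'a \<Rightarrow> 'a measure) \<Rightarrow> bool" where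
  "markov_semigroup_with_generator M D L P \<longleftrightarrow> feller_semigroup M P \<and>
     (\<forall>f g. generator_graph M P f g \<longleftrightarrow>
        f \<in> C0 (space M) \<and> g \<in> C0 (space M) \<and>
        (\<exists>h :: nat \<Rightarrow> 'a \<Rightarrow> real. (\<forall>n. h n \<in> D) \<and>
           uniform_limit (space M) h f sequentially \<and>
           uniform_limit (space M) (\<lambda>n. L (h n)) g sequentially))"

definition invariant_measure ::
    "'a measure \<Rightarrow> (real \<Rightarrow> 'a \<Rightarrow> 'a measure) \<Rightarrow> 'a measure \<Rightarrow> bool" where
  "invariant_measure M P \<nu> \<longleftrightarrow>
     \<nu> \<in> space (prob_algebra M) \<and> (\<forall>t\<ge>0. Giry_Monad.bind \<nu> (P t) = \<nu>)"

definition nonneg_borel :: "real measure" where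
  "nonneg_borel = restrict_space borel {0..}"

text \<open>A configuration is a function on the sites, extended by the constant \<open>undefined\<close> outside of
  \<open>{1..N}\<close>, so that \<open>space (config_space N)\<close> with the product topology is a copy of
  the orthant of nonnegative vectors in \<open>N\<close> dimensions.\<close>

definition config_space :: "nat \<Rightarrow> (nat \<Rightarrow> real) measure" where
  "config_space N = (\<Pi>\<^sub>M i\<in>{1..N}. nonneg_borel)"

text \<open>Lipschitz functions with compact support. The jump rates \<open>du / u\<close> have infinite
  mass near \<open>u = 0\<close>, and the Lipschitz property makes all the integrals in the generators below
  absolutely convergent. Taking smooth functions with compact support instead gives
  the same closures of these generators.\<close>

definition test_functions :: "nat \<Rightarrow> ((nat \<Rightarrow> real) \<Rightarrow> real) set" where
  "test_functions N = {f.
     (\<exists>C. \<forall>x\<in>space (config_space N). \<forall>y\<in>space (config_space N).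
        \<bar>f x - f y\<bar> \<le> C * (\<Sum>i\<in>{1..N}. \<bar>x i - y i\<bar>)) \<and>
     (\<exists>R. \<forall>x\<in>space (config_space N). (\<exists>i\<in>{1..N}. x i > R) \<longrightarrow> f x = 0)}"

definition hidden_boundary ::
    "nat \<Rightarrow> real \<Rightarrow> ((nat \<Rightarrow> real) \<Rightarrow> real) \<Rightarrow> (nat \<Rightarrow> real) \<Rightarrow> real" where
  "hidden_boundary i a f \<theta> =
     (LBINT u:{0<..<1}. (f (\<theta>(i := \<theta> i - u * \<theta> i + u * a)) - f \<theta>) / u)"

definition hidden_bond ::
    "nat \<Rightarrow> ((nat \<Rightarrow> real) \<Rightarrow> real) \<Rightarrow> (nat \<Rightarrow> real) \<Rightarrow> real" where
  "hidden_bond i f \<theta> =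
     (LBINT u:{0<..<1}.
        (f (\<theta>(i := \<theta> i - u * \<theta> i + u * \<theta> (i + 1)))
         + f (\<theta>(i + 1 := \<theta> (i + 1) - u * \<theta> (i + 1) + u * \<theta> i)) - 2 * f \<theta>) / u)"

definition hidden_generator ::
    "nat \<Rightarrow> real \<Rightarrow> real \<Rightarrow> ((nat \<Rightarrow> real) \<Rightarrow> real) \<Rightarrow> (nat \<Rightarrow> real) \<Rightarrow> real" where
  "hidden_generator N \<theta>L \<theta>R f \<theta> =
     hidden_boundary 1 \<theta>L f \<theta> + hidden_boundary N \<theta>R f \<theta> + (\<Sum>i\<in>{1..<N}. hidden_bond i f \<theta>)"

definition harmonic_boundary ::
    "nat \<Rightarrow> real \<Rightarrow> ((nat \<Rightarrow> real) \<Rightarrow> real) \<Rightarrow> (nat \<Rightarrow> real) \<Rightarrow> real" where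
  "harmonic_boundary i a f \<zeta> =
     (LBINT u:{0<..<1}. (f (\<zeta>(i := \<zeta> i - u * \<zeta> i)) - f \<zeta>) / u)
     + (LBINT u:{0<..}. exp (- u) / u * (f (\<zeta>(i := \<zeta> i + u * a)) - f \<zeta>))"

definition harmonic_bond ::
    "nat \<Rightarrow> ((nat \<Rightarrow> real) \<Rightarrow> real) \<Rightarrow> (nat \<Rightarrow> real) \<Rightarrow> real" where
  "harmonic_bond i f \<zeta> =
     (LBINT u:{0<..<1}.
        (f (\<zeta>(i := \<zeta> i - u * \<zeta> i, i + 1 := \<zeta> (i + 1) + u * \<zeta> i))
         + f (\<zeta>(i + 1 := \<zeta> (i + 1) - u * \<zeta> (i + 1), i := \<zeta> i + u * \<zeta> (i + 1))) - 2 * f \<zeta>) / u)"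

definition harmonic_generator ::
    "nat \<Rightarrow> real \<Rightarrow> real \<Rightarrow> ((nat \<Rightarrow> real) \<Rightarrow> real) \<Rightarrow> (nat \<Rightarrow> real) \<Rightarrow> real" where
  "harmonic_generator N \<theta>L \<theta>R f \<zeta> =
     harmonic_boundary 1 \<theta>L f \<zeta> + harmonic_boundary N \<theta>R f \<zeta> + (\<Sum>i\<in>{1..<N}. harmonic_bond i f \<zeta>)"

definition uniform_law :: "real \<Rightarrow> real \<Rightarrow> real measure" where
  "uniform_law a b =
     (if a = b then return nonneg_borel a
      else uniform_measure (restrict_space lborel {0..}) {a..b})"

definition exponential_law :: "real \<Rightarrow> real measure" where
  "exponential_law m =
     (if m = 0 then return nonneg_borel 0
      else density (restrict_space lborel {0..}) (\<lambda>x. ennreal (exponential_density (1 / m) x)))"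

definition order_statistics :: "nat \<Rightarrow> (nat \<Rightarrow> real) \<Rightarrow> nat \<Rightarrow> real" where
  "order_statistics N x = (\<lambda>i\<in>{1..N}. sort (map x [1..<N + 1]) ! (i - 1))"

definition uniform_order_statistics_law :: "nat \<Rightarrow> real \<Rightarrow> real \<Rightarrow> (nat \<Rightarrow> real) measure" where
  "uniform_order_statistics_law N a b =
     distr (\<Pi>\<^sub>M i\<in>{1..N}. uniform_law a b) (config_space N) (order_statistics N)"

definition exponential_mixture_law :: "nat \<Rightarrow> real \<Rightarrow> real \<Rightarrow> (nat \<Rightarrow> real) measure" where
  "exponential_mixture_law N a b =
     Giry_Monad.bind (uniform_order_statistics_law N a b)
       (\<lambda>\<theta>. \<Pi>\<^sub>M i\<in>{1..N}. exponential_law (\<theta> i))"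

end

theory Submission
  imports Defs
begin

text \<open>
  For a profile \<open>q\<close> let \<open>E s x\<close> be the product of the \<open>q (s i * x i)\<close>, with \<open>q y = 1 / (1 + y)\<close> for the hidden
  parameter model and \<open>q y = exp (- y)\<close> for the harmonic model. In both models the generator applied to
  \<open>E s\<close> is the same operator acting on the parameter \<open>s\<close>: the hidden parameter dynamics with reservoir
  values \<open>0\<close>, minus the potential \<open>ln (1 + \<theta>L * s 1) + ln (1 + \<theta>R * s N)\<close>. A law \<open>\<nu>\<close> is determined by its
  averages \<open>\<integral> E s d\<nu>\<close>. If \<open>\<nu>\<close> is invariant, these solve the stationary dual equation, and by a
  maximum principle this equation has only one solution with value \<open>1\<close> at \<open>s = 0\<close>. Conversely, if the
  averages of a law solve it, then the maximum principle for the evolution equation shows that they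
  do not change in time, so the law is invariant.

  An exponential variable with mean \<open>m\<close> has Laplace transform \<open>1 / (1 + s * m)\<close>, so the order statistics and
  the exponential mixture have the same averages in their respective models. They solve the
  stationary equation because, given its neighbours \<open>l\<close> and \<open>r\<close>, an order statistic is uniform on
  \<open>[l, r]\<close>, and the contribution of each site integrates to zero over this interval.
\<close>

section \<open>The dual jump operator and its maximum principle\<close>

text \<open>Parameters have to be strictly positive on the chain: if some \<open>s i\<close> were 0
  there, \<open>E s\<close> would not vanish at infinity and the Feller generator would not apply to
  it. The maximum principles thus live on a set without its boundary, where a maximum need not be
  attained. The upper side is harmless: every dual jump replaces \<open>s i\<close> by a convex
  combination with a neighbour and so preserves \<open>s i \<le> S\<close>. On the lower side a
  small multiple \<eta> of the sum of the \<open>ln (s i)\<close> forces a maximum to exist, and in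
  the dual generator it costs at most \<open>4 * \<eta>\<close>. In the stationary equation the
  potential gives no strictness, as it vanishes when both reservoirs are at 0. Strictness comes from
  the weights \<open>i * (N + 1 - i)\<close>, which vanish at the reservoirs and have second
  difference -2; in the evolution equation a term linear in time supplies it. A second obstacle is
  that \<open>E s\<close> is not a compactly supported test function. It is approximated by cutting
  off its small values, and the singular rate \<open>du / u\<close> is controlled by estimates that
  are linear in \<open>u\<close>.\<close>

lemma sum_neighbours:
  fixes a :: "nat \<Rightarrow> nat \<Rightarrow> 'a::comm_monoid_add"
  assumes "N \<ge> 1"
  shows "(\<Sum>i\<in>{1..N}. a i (i - 1) + a i (i + 1))
       = a 1 0 + a N (N + 1) + (\<Sum>i\<in>{1..<N}. a i (i + 1) + a (i + 1) i)"
  using assms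
proof (induction N rule: dec_induct)
  case base
  then show ?case by simp
next
  case (step N)
  have "{1..Suc N} = insert (Suc N) {1..N}" "{1..<Suc N} = insert N {1..<N}" using step by auto
  then show ?case using step by (simp add: ac_simps)
qed

lemma set_integral_sum:
  fixes f :: "'i \<Rightarrow> 'a \<Rightarrow> 'b::{banach, second_countable_topology}"
  assumes "\<And>i. i \<in> I \<Longrightarrow> set_integrable M A (f i)"
  shows "set_integrable M A (\<lambda>x. \<Sum>i\<in>I. f i x)"
    and "(LINT x:A|M. (\<Sum>i\<in>I. f i x)) = (\<Sum>i\<in>I. LINT x:A|M. f i x)"
  using assms unfolding set_integrable_def set_lebesgue_integral_def
  by (auto simp: scaleR_sum_right intro!: Bochner_Integration.integrable_sum Bochner_Integration.integral_sum)

section \<open>Moves of the parameters and the dual operator\<close>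

definition move :: "(nat \<Rightarrow> real) \<Rightarrow> nat \<Rightarrow> nat \<Rightarrow> real \<Rightarrow> nat \<Rightarrow> real" where
  "move s i j u = s(i := s i + u * (s j - s i))"

definition dual_term :: "((nat \<Rightarrow> real) \<Rightarrow> real) \<Rightarrow> (nat \<Rightarrow> real) \<Rightarrow> nat \<Rightarrow> nat \<Rightarrow> real" where
  "dual_term \<psi> s i j = (LBINT u:{0<..<1}. (\<psi> (move s i j u) - \<psi> s) / u)"

definition dual_op :: "nat \<Rightarrow> ((nat \<Rightarrow> real) \<Rightarrow> real) \<Rightarrow> (nat \<Rightarrow> real) \<Rightarrow> real" where
  "dual_op N \<psi> s = (\<Sum>i\<in>{1..N}. dual_term \<psi> s i (i - 1) + dual_term \<psi> s i (i + 1))"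

text \<open>The value 0 outside of the chain makes \<open>s 0\<close> and \<open>s (N + 1)\<close>
  the reservoir values of the dual dynamics, so that end sites need no case of their own.\<close>

definition params :: "nat \<Rightarrow> (nat \<Rightarrow> real) set" where
  "params N = {s. (\<forall>i\<in>{1..N}. 0 < s i) \<and> (\<forall>i. i \<notin> {1..N} \<longrightarrow> s i = 0)}"

lemma params_nonneg: "s \<in> params N \<Longrightarrow> 0 \<le> s i"
  by (cases "i \<in> {1..N}") (auto simp: params_def less_imp_le)

lemma params_pos: "s \<in> params N \<Longrightarrow> i \<in> {1..N} \<Longrightarrow> 0 < s i"
  by (auto simp: params_def)

lemma move_params:
  assumes "s \<in> params N" "i \<in> {1..N}" "0 \<le> u" "u < 1"
  shows "move s i j u \<in> params N"
proof -
  have "s i + u * (s j - s i) = (1 - u) * s i + u * s j" by (simp add: algebra_simps)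
  moreover have "(1 - u) * s i > 0" "u * s j \<ge> 0"
    using assms params_pos[of s N i] params_nonneg[of s N j] by auto
  ultimately have "s i + u * (s j - s i) > 0" by linarith
  then show ?thesis using assms by (auto simp: params_def move_def)
qed

lemma move_le:
  assumes "s i \<le> c" "s j \<le> c" "0 \<le> u" "u \<le> 1"
  shows "move s i j u i \<le> c"
proof -
  have "(1 - u) * s i + u * s j \<le> (1 - u) * c + u * c"
    by (intro add_mono mult_left_mono) (use assms in auto)
  then show ?thesis by (simp add: move_def algebra_simps)
qed

section \<open>Barrier functions\<close>

text \<open>Designed for \<open>v = 1 - u\<close>: dividing by \<open>u\<close> leaves the bound
  \<open>1 / sqrt (1 - u)\<close>, whose integral over the unit interval is 2. With
  \<open>r = sqrt v\<close> the difference of the two sides has derivative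
  \<open>- (1 - r)^2 / (2 * r^3)\<close>, and it vanishes at \<open>v = 1\<close>.\<close>

lemma neg_ln_le:
  fixes v :: real
  assumes "0 < v" "v \<le> 1"
  shows "- ln v \<le> (1 - v) / sqrt v"
proof -
  let ?f = "\<lambda>v::real. (1 - v) / sqrt v + ln v"
  have "?f 1 \<le> ?f v"
  proof (rule DERIV_nonpos_imp_nonincreasing[OF assms(2)])
    fix x assume x: "v \<le> x" "x \<le> 1"
    then have x0: "0 < x" using assms by simp
    define r where "r = sqrt x"
    have r: "r > 0" "x = r * r" using x0 by (auto simp: r_def)
    have "(?f has_real_derivative ((0 - 1) * sqrt x - (1 - x) * (inverse (sqrt x) / 2)) / (sqrt x * sqrt x) + 1 / x) (at x)"
      using x0 by (auto intro!: derivative_eq_intros simp: field_simps)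
    moreover have "((0 - 1) * sqrt x - (1 - x) * (inverse (sqrt x) / 2)) / (sqrt x * sqrt x) + 1 / x
       = - ((1 - r)^2) / (2 * r * r * r)"
      unfolding r_def[symmetric] using r by (simp add: field_simps power2_eq_square)
    moreover have "\<dots> \<le> 0" using r by (simp add: divide_le_0_iff)
    ultimately show "\<exists>y. DERIV ?f x :> y \<and> y \<le> 0" by metis
  qed
  then show ?thesis by simp
qed

lemma integral_inverse_sqrt:
  "set_integrable lborel {0<..<1} (\<lambda>u::real. 1 / sqrt (1 - u))"
  "(LBINT u:{0<..<1}. 1 / sqrt (1 - u)) = 2"
proof -
  have d: "\<And>x. 0 < x \<Longrightarrow> x < 1 \<Longrightarrow> DERIV (\<lambda>u. - 2 * sqrt (1 - u)) x :> 1 / sqrt (1 - x)"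
    by (auto intro!: derivative_eq_intros simp: field_simps)
  have c: "\<And>x. 0 < x \<Longrightarrow> x < 1 \<Longrightarrow> isCont (\<lambda>u::real. 1 / sqrt (1 - u)) x"
    by (auto intro!: continuous_intros)
  have l0: "((\<lambda>u::real. - 2 * sqrt (1 - u)) \<longlongrightarrow> - 2 * sqrt (1 - 0)) (at_right 0)"
    by (rule tendsto_intros | simp)+
  have l1: "((\<lambda>u::real. - 2 * sqrt (1 - u)) \<longlongrightarrow> - 2 * sqrt (1 - 1)) (at_left 1)"
    by (rule tendsto_intros | simp)+
  note F = interval_integral_FTC_nonneg[where a=0 and b=1 and F="\<lambda>u. - 2 * sqrt (1 - u)"
     and f="\<lambda>u. 1 / sqrt (1 - u)" and A="-2" and B=0]
  show "set_integrable lborel {0<..<1} (\<lambda>u::real. 1 / sqrt (1 - u))"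
    using F(1) d c l0 l1
    by (auto simp: zero_ereal_def one_ereal_def ereal_tendsto_simps)
  show "(LBINT u:{0<..<1}. 1 / sqrt (1 - u)) = 2"
    using F(2) d c l0 l1
    by (auto simp: zero_ereal_def one_ereal_def ereal_tendsto_simps interval_lebesgue_integral_def)
qed

text \<open>The two jumps across a bond are paired. They replace values \<open>x\<close> and
  \<open>y\<close> by \<open>X\<close> and \<open>Y\<close> with
  \<open>X * Y - x * y = u * (1 - u) * (x - y)^2\<close>, so the sum of their logarithms does not
  decrease. Only the moves towards the two reservoirs lose something; each multiplies its coordinate
  by \<open>1 - u\<close>.\<close>

lemma ln_barrier:
  fixes s :: "nat \<Rightarrow> real"
  assumes N: "N \<ge> 1" and s: "s \<in> params N" and u: "0 < u" "u < 1"
  shows "2 * ln (1 - u) \<le> (\<Sum>i\<in>{1..N}. (ln (move s i (i - 1) u i) - ln (s i)) + (ln (move s i (i + 1) u i) - ln (s i)))"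
proof -
  let ?a = "\<lambda>i j. ln (move s i j u i) - ln (s i)"
  have b: "?a i j = ln (1 - u)" if "i \<in> {1..N}" "s j = 0" for i j
  proof -
    have "move s i j u i = (1 - u) * s i" using that by (simp add: move_def algebra_simps)
    then show ?thesis using params_pos[OF s that(1)] u by (simp add: ln_mult)
  qed
  have p: "0 \<le> ?a i j + ?a j i" if ij: "i \<in> {1..N}" "j \<in> {1..N}" for i j
  proof -
    define x y where "x = s i" and "y = s j"
    have xy: "x > 0" "y > 0" using params_pos[OF s] ij by (auto simp: x_def y_def)
    define X Y where "X = (1 - u) * x + u * y" and "Y = (1 - u) * y + u * x"
    have XY: "X > 0" "Y > 0" unfolding X_def Y_def using xy u by (auto intro!: add_pos_pos)
    have "X * Y - x * y = u * (1 - u) * (x - y)^2"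
      unfolding X_def Y_def by algebra
    then have "x * y \<le> X * Y" using u by (smt (verit) mult_nonneg_nonneg zero_le_power2)
    then have "ln (x * y) \<le> ln (X * Y)" using xy XY by simp
    moreover have "move s i j u i = X" "move s j i u j = Y"
      by (auto simp: move_def X_def Y_def x_def y_def algebra_simps)
    ultimately show ?thesis using xy XY by (simp add: ln_mult x_def y_def)
  qed
  have z: "s 0 = 0" "s (N + 1) = 0" using s by (auto simp: params_def)
  have "(\<Sum>i\<in>{1..N}. ?a i (i - 1) + ?a i (i + 1))
      = ?a 1 0 + ?a N (N + 1) + (\<Sum>i\<in>{1..<N}. ?a i (i + 1) + ?a (i + 1) i)"
    by (rule sum_neighbours[OF N])
  also have "?a 1 0 = ln (1 - u)" by (rule b) (use z N in auto)
  also have "?a N (N+1) = ln (1 - u)" by (rule b) (use z N in auto)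
  finally have "(\<Sum>i\<in>{1..N}. ?a i (i - 1) + ?a i (i + 1))
     = ln (1-u) + ln (1-u) + (\<Sum>i\<in>{1..<N}. ?a i (i + 1) + ?a (i + 1) i)" .
  moreover have "0 \<le> (\<Sum>i\<in>{1..<N}. ?a i (i + 1) + ?a (i + 1) i)"
    by (intro sum_nonneg p) auto
  ultimately show ?thesis by linarith
qed

text \<open>Summation by parts: the discrete Laplacian is transferred to the weights
  \<open>c i = i * (N + 1 - i)\<close>, whose second difference is -2. No boundary terms remain,
  because \<open>c\<close> vanishes at 0 and \<open>N + 1\<close>, as does \<open>s\<close>.\<close>

lemma concave_barrier:
  fixes s :: "nat \<Rightarrow> real"
  assumes s: "s 0 = 0" "s (N + 1) = 0"
  shows "(\<Sum>i\<in>{1..N}. real (i * (N + 1 - i)) * ((s (i - 1) - s i) + (s (i + 1) - s i)))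
     = - 2 * (\<Sum>i\<in>{1..N}. s i)"
proof -
  define c where "c i = real i * (real N + 1 - real i)" for i :: nat
  have "(\<Sum>i\<in>{1..N}. c i * s (i - 1)) = (\<Sum>i\<in>{0..<N}. c (i+1) * s i)"
    by (rule sum.reindex_bij_witness[of _ Suc "\<lambda>i. i - 1"]) auto
  also have "\<dots> = (\<Sum>i\<in>{1..N}. c (i+1) * s i)"
    by (rule sum.mono_neutral_cong) (use s in \<open>auto simp: c_def\<close>, metis Suc_lessI le_simps(2) less_one not_less nle_le order_neq_le_trans)
  finally have 1: "(\<Sum>i\<in>{1..N}. c i * s (i - 1)) = (\<Sum>i\<in>{1..N}. c (i+1) * s i)" .
  have "(\<Sum>i\<in>{1..N}. c i * s (i + 1)) = (\<Sum>i\<in>{2..N+1}. c (i-1) * s i)"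
    by (rule sum.reindex_bij_witness[of _ "\<lambda>i. i - 1" Suc]) auto
  also have "\<dots> = (\<Sum>i\<in>{1..N}. c (i-1) * s i)"
    by (rule sum.mono_neutral_cong) (use s in \<open>auto simp: c_def\<close>, metis Suc_eq_plus1 le_SucE)
  finally have 2: "(\<Sum>i\<in>{1..N}. c i * s (i + 1)) = (\<Sum>i\<in>{1..N}. c (i-1) * s i)" .
  have "(\<Sum>i\<in>{1..N}. real (i * (N + 1 - i)) * ((s (i - 1) - s i) + (s (i + 1) - s i)))
     = (\<Sum>i\<in>{1..N}. c i * s (i - 1) + c i * s (i + 1) - 2 * c i * s i)"
  proof (intro sum.cong refl)
    fix i assume "i \<in> {1..N}"
    then have "real (i * (N + 1 - i)) = c i" by (simp add: c_def of_nat_diff)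
    then show "real (i * (N + 1 - i)) * ((s (i - 1) - s i) + (s (i + 1) - s i))
      = c i * s (i - 1) + c i * s (i + 1) - 2 * c i * s i" by (simp only: algebra_simps)
  qed
  also have "\<dots> = (\<Sum>i\<in>{1..N}. (c (i+1) + c (i-1) - 2 * c i) * s i)"
    using 1 2 by (simp add: sum.distrib sum_subtractf algebra_simps)
  also have "\<dots> = (\<Sum>i\<in>{1..N}. - 2 * s i)"
    by (intro sum.cong) (auto simp: c_def of_nat_diff algebra_simps)
  finally show ?thesis by (simp add: sum_distrib_left)
qed

text \<open>The logarithms tend to minus infinity at the missing lower boundary and make maxima
  exist. The concave weights give a strictly negative drift; they are switched off by
  \<open>\<kappa> = 0\<close> in the evolution problem.\<close>

definition barrier :: "nat \<Rightarrow> real \<Rightarrow> real \<Rightarrow> (nat \<Rightarrow> real) \<Rightarrow> real" where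
  "barrier N \<kappa> \<eta> s = (\<Sum>i\<in>{1..N}. \<eta> * ln (s i) - \<kappa> * (real (i * (N + 1 - i)) * s i))"

text \<open>The jump rates of \<^const>\<open>dual_op\<close> are the same for all neighbours, so the logarithmic part of the
  barrier is subharmonic up to the two killing terms, which contribute
  \<open>\<integral> - ln (1 - u) / u du \<le> 2\<close> each.\<close>

lemma dual_op_le_at_max:
  assumes N: "N \<ge> 1" and s: "s \<in> params N" and \<eta>: "0 \<le> \<eta>"
    and int: "\<And>i j. i \<in> {1..N} \<Longrightarrow> set_integrable lborel {0<..<1} (\<lambda>u. (\<psi> (move s i j u) - \<psi> s) / u)"
    and max: "\<And>i j u. i \<in> {1..N} \<Longrightarrow> j = i - 1 \<or> j = i + 1 \<Longrightarrow> 0 < u \<Longrightarrow> u < 1 \<Longrightarrow>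
      \<psi> (move s i j u) + barrier N \<kappa> \<eta> (move s i j u) \<le> \<psi> s + barrier N \<kappa> \<eta> s"
  shows "dual_op N \<psi> s \<le> 4 * \<eta> - 2 * \<kappa> * (\<Sum>i\<in>{1..N}. s i)"
proof -
  let ?D = "\<lambda>u i j. (\<psi> (move s i j u) - \<psi> s) / u"
  let ?S = "\<Sum>i\<in>{1..N}. s i"
  have "dual_op N \<psi> s = (LBINT u:{0<..<1}. (\<Sum>i\<in>{1..N}. ?D u i (i - 1) + ?D u i (i + 1)))"
    unfolding dual_op_def dual_term_def
    by (subst set_integral_sum(2)) (auto intro!: int set_integral_add sum.cong simp: set_integral_add int simp del: set_integrable_mult_divide_iff)
  also have "\<dots> \<le> (LBINT u:{0<..<1}. 2 * \<eta> * (1 / sqrt (1 - u)) - 2 * \<kappa> * ?S)"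
  proof (rule set_integral_mono)
    show "set_integrable lborel {0<..<1} (\<lambda>u. \<Sum>i\<in>{1..N}. ?D u i (i - 1) + ?D u i (i + 1))"
      by (intro set_integral_sum(1) set_integral_add int) auto
    show "set_integrable lborel {0<..<1} (\<lambda>u. 2 * \<eta> * (1 / sqrt (1 - u)) - 2 * \<kappa> * ?S)"
      by (intro set_integral_diff set_integrable_mult_right integral_inverse_sqrt)
        (simp add: set_integrable_def)
  next
    fix u :: real assume u': "u \<in> {0<..<1}"
    then have u: "0 < u" "u < 1" by auto
    have b: "barrier N \<kappa> \<eta> (move s i j u) - barrier N \<kappa> \<eta> s
       = \<eta> * (ln (move s i j u i) - ln (s i)) - \<kappa> * u * (real (i * (N + 1 - i)) * (s j - s i))"
      if i: "i \<in> {1..N}" for i j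
    proof -
      have "barrier N \<kappa> \<eta> (move s i j u) - barrier N \<kappa> \<eta> s
        = (\<Sum>k\<in>{1..N}. if k = i then \<eta> * (ln (move s i j u i) - ln (s i)) - \<kappa> * u * (real (i * (N + 1 - i)) * (s j - s i)) else 0)"
        unfolding barrier_def sum_subtractf[symmetric]
        by (intro sum.cong) (auto simp: move_def algebra_simps)
      then show ?thesis using i by simp
    qed
    have "(\<Sum>i\<in>{1..N}. ?D u i (i - 1) + ?D u i (i + 1)) * u
       = (\<Sum>i\<in>{1..N}. (\<psi> (move s i (i-1) u) - \<psi> s) + (\<psi> (move s i (i+1) u) - \<psi> s))"
      unfolding sum_distrib_right distrib_right using u by simp
    \<comment> \<open>At a maximum of \<psi> plus barrier, each increment of \<psi> is at most the
      negative of the barrier's increment. The rest is a computation with the explicit barrier at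
      fixed \<open>u\<close>.\<close>
    also have "\<dots> \<le> (\<Sum>i\<in>{1..N}. - (barrier N \<kappa> \<eta> (move s i (i-1) u) - barrier N \<kappa> \<eta> s)
         - (barrier N \<kappa> \<eta> (move s i (i+1) u) - barrier N \<kappa> \<eta> s))"
    proof (rule sum_mono)
      fix i assume i: "i \<in> {1..N}"
      show "(\<psi> (move s i (i-1) u) - \<psi> s) + (\<psi> (move s i (i+1) u) - \<psi> s)
        \<le> - (barrier N \<kappa> \<eta> (move s i (i-1) u) - barrier N \<kappa> \<eta> s)
         - (barrier N \<kappa> \<eta> (move s i (i+1) u) - barrier N \<kappa> \<eta> s)"
        using max[OF i _ u, of "i-1"] max[OF i _ u, of "i+1"] by simp
    qed
    also have "\<dots> = - \<eta> * (\<Sum>i\<in>{1..N}. (ln (move s i (i - 1) u i) - ln (s i)) + (ln (move s i (i + 1) u i) - ln (s i)))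
       + \<kappa> * u * (\<Sum>i\<in>{1..N}. real (i * (N + 1 - i)) * ((s (i - 1) - s i) + (s (i + 1) - s i)))"
      unfolding sum_distrib_left sum.distrib[symmetric]
      by (intro sum.cong refl) (simp only: b, simp add: algebra_simps)
    also have "(\<Sum>i\<in>{1..N}. real (i * (N + 1 - i)) * ((s (i - 1) - s i) + (s (i + 1) - s i))) = - 2 * ?S"
      by (rule concave_barrier) (use s in \<open>auto simp: params_def\<close>)
    finally have "(\<Sum>i\<in>{1..N}. ?D u i (i - 1) + ?D u i (i + 1)) * u \<le>
       \<eta> * (- (\<Sum>i\<in>{1..N}. (ln (move s i (i - 1) u i) - ln (s i)) + (ln (move s i (i + 1) u i) - ln (s i))))
       - 2 * \<kappa> * ?S * u" by (simp add: algebra_simps)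
    also have "\<dots> \<le> \<eta> * (2 * ((1 - (1 - u)) / sqrt (1 - u))) - 2 * \<kappa> * ?S * u"
      using ln_barrier[OF N s u] neg_ln_le[of "1 - u"] u \<eta>
      by (intro diff_right_mono mult_left_mono) linarith+
    also have "\<dots> = (2 * \<eta> * (1 / sqrt (1 - u)) - 2 * \<kappa> * ?S) * u"
      by (simp add: algebra_simps)
    finally show "(\<Sum>i\<in>{1..N}. ?D u i (i - 1) + ?D u i (i + 1)) \<le> 2 * \<eta> * (1 / sqrt (1 - u)) - 2 * \<kappa> * ?S"
      using u by simp
  qed
  also have "\<dots> = (LBINT u:{0<..<1}. 2 * \<eta> * (1 / sqrt (1 - u))) - (LBINT u:{0<..<(1::real)}. 2 * \<kappa> * ?S)"
    by (intro set_integral_diff set_integrable_mult_right integral_inverse_sqrt)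
      (simp add: set_integrable_def)
  also have "(LBINT u:{0<..<1}. 2 * \<eta> * (1 / sqrt (1 - u))) = 2 * \<eta> * 2"
    by (simp only: set_integral_mult_right integral_inverse_sqrt)
  also have "(LBINT u:{0<..<(1::real)}. 2 * \<kappa> * ?S) = 2 * \<kappa> * ?S"
    by (simp add: set_lebesgue_integral_def)
  finally show ?thesis by simp
qed

text \<open>Tychonoff's theorem. Coordinates outside of the chain are frozen later by taking
  \<open>c i = d i\<close>.\<close>

lemma compact_box:
  fixes c d :: "nat \<Rightarrow> real"
  shows "compact {s. \<forall>i. s i \<in> {c i..d i}}"
proof -
  have "compactin (product_topology (\<lambda>i. euclidean) UNIV) (PiE UNIV (\<lambda>i. {c i..d i}))"
    by (subst compactin_PiE) auto
  moreover have "PiE UNIV (\<lambda>i. {c i..d i}) = {s. \<forall>i. s i \<in> {c i..d i}}" by auto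
  ultimately show ?thesis by (simp add: euclidean_product_topology)
qed

text \<open>If one coordinate drops below \<open>e\<close>, its logarithm outweighs the upper bound
  \<open>B\<close> and the bounded gain of the other coordinates, so the value falls below the one
  at the corner \<open>s0\<close>. The search is thereby confined to a compact box. With
  \<open>T = 0\<close> the statement also serves the stationary problem.\<close>

lemma barrier_max_exists:
  fixes f :: "real \<Rightarrow> (nat \<Rightarrow> real) \<Rightarrow> real"
  assumes N: "N \<ge> 1" and T: "0 \<le> T" and S: "0 < S" and \<eta>: "0 < \<eta>" and \<kappa>: "0 \<le> \<kappa>"
    and cont: "continuous_on ({0..T} \<times> params N) (\<lambda>(t, s). f t s)"
    and bd: "\<And>t s. t \<in> {0..T} \<Longrightarrow> s \<in> params N \<Longrightarrow> f t s \<le> B"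
  obtains t s where "t \<in> {0..T}" "s \<in> params N" "\<And>i. s i \<le> S"
    "\<And>t' s'. t' \<in> {0..T} \<Longrightarrow> s' \<in> params N \<Longrightarrow> (\<And>i. s' i \<le> S) \<Longrightarrow>
       f t' s' + barrier N \<kappa> \<eta> s' \<le> f t s + barrier N \<kappa> \<eta> s"
proof -
  define F where "F = (\<lambda>(t, s). f t s + barrier N \<kappa> \<eta> s)"
  define s0 where "s0 i = (if i \<in> {1..N} then S else 0)" for i
  have s0: "s0 \<in> params N" using S by (auto simp: params_def s0_def)
  \<comment> \<open>Solves
    \<open>\<eta> * (ln e + N * \<bar>ln S\<bar>) \<le> F (0, s0) - B\<close>; the minimum with
    \<open>S\<close> keeps the corner \<open>s0\<close> inside the box.\<close>
  define e where "e = min S (exp ((F (0, s0) - B) / \<eta> - N * \<bar>ln S\<bar>))"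
  have e: "0 < e" "e \<le> S" "ln e \<le> (F (0, s0) - B) / \<eta> - N * \<bar>ln S\<bar>"
  proof -
    let ?x = "(F (0, s0) - B) / \<eta> - N * \<bar>ln S\<bar>"
    show e0: "0 < e" using S by (simp add: e_def)
    show "e \<le> S" by (simp add: e_def)
    have "ln e \<le> ln (exp ?x)" using e0 by (intro ln_mono) (auto simp: e_def)
    then show "ln e \<le> ?x" by simp
  qed
  define Q where "Q = {s. \<forall>i. s i \<in> {(if i \<in> {1..N} then e else 0)..(if i \<in> {1..N} then S else 0)}}"
  have Q: "Q = {s \<in> params N. \<forall>i\<in>{1..N}. e \<le> s i \<and> s i \<le> S}"
  proof (intro set_eqI iffI)
    fix s assume "s \<in> Q"
    then have s: "s i \<in> {(if i \<in> {1..N} then e else 0)..(if i \<in> {1..N} then S else 0)}" for i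
      by (simp add: Q_def)
    have "s i = 0" if "i \<notin> {1..N}" for i using s[of i] unfolding if_not_P[OF that] by simp
    moreover have "e \<le> s i \<and> s i \<le> S" if "i \<in> {1..N}" for i using s[of i] that by simp
    ultimately show "s \<in> {s \<in> params N. \<forall>i\<in>{1..N}. e \<le> s i \<and> s i \<le> S}"
      using e(1) by (force simp: params_def)
  next
    fix s assume "s \<in> {s \<in> params N. \<forall>i\<in>{1..N}. e \<le> s i \<and> s i \<le> S}"
    then have s: "s \<in> params N" "\<And>i. i \<in> {1..N} \<Longrightarrow> e \<le> s i \<and> s i \<le> S" by auto
    have "s i \<in> {(if i \<in> {1..N} then e else 0)..(if i \<in> {1..N} then S else 0)}" for i
      using s by (cases "i \<in> {1..N}") (auto simp: params_def)
    then show "s \<in> Q" by (simp add: Q_def)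
  qed
  have "compact ({0..T} \<times> Q)" unfolding Q_def by (intro compact_Times compact_box) auto
  moreover have "(0, s0) \<in> {0..T} \<times> Q" using T e s0 by (auto simp: Q s0_def)
  moreover have "continuous_on ({0..T} \<times> Q) F"
  proof -
    have "continuous_on ({0..T} \<times> Q) (\<lambda>(t, s). f t s)"
      by (rule continuous_on_subset[OF cont]) (auto simp: Q)
    moreover have "continuous_on ({0..T} \<times> Q) (\<lambda>p. snd p i)" for i
      by (rule continuous_on_product_then_coordinatewise) (rule continuous_on_snd, rule continuous_on_id)
    ultimately show ?thesis
      unfolding F_def barrier_def case_prod_unfold
      by (intro continuous_intros) (auto simp: Q dest: params_pos)
  qed
  ultimately obtain p where p: "p \<in> {0..T} \<times> Q" "\<And>p'. p' \<in> {0..T} \<times> Q \<Longrightarrow> F p' \<le> F p"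
    using continuous_attains_sup[of "{0..T} \<times> Q" F] by blast
  obtain t s where ts: "p = (t, s)" by (cases p)
  show thesis
  proof (rule that[of t s])
    show "t \<in> {0..T}" "s \<in> params N" using p(1) ts by (auto simp: Q)
    show "s i \<le> S" for i using p(1) ts S by (cases "i \<in> {1..N}") (auto simp: Q params_def)
  next
    fix t' s' assume t': "t' \<in> {0..T}" and s': "s' \<in> params N" "\<And>i. s' i \<le> S"
    have "F (t', s') \<le> F p"
    proof (cases "s' \<in> Q")
      case True
      then show ?thesis using p(2) t' by auto
    next
      case False
      then obtain k where k: "k \<in> {1..N}" "s' k < e" using s' by (force simp: Q)
      have pos: "\<And>i. i \<in> {1..N} \<Longrightarrow> 0 < s' i" using params_pos[OF s'(1)] .
      have "barrier N \<kappa> \<eta> s' \<le> (\<Sum>i\<in>{1..N}. \<eta> * ln (s' i))"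
        unfolding barrier_def by (intro sum_mono) (use pos \<kappa> in \<open>auto intro!: mult_nonneg_nonneg simp: less_imp_le\<close>)
      also have "\<dots> = \<eta> * ln (s' k) + (\<Sum>i\<in>{1..N} - {k}. \<eta> * ln (s' i))"
        using k by (subst sum.remove[of _ k]) auto
      also have "\<dots> \<le> \<eta> * ln e + (\<Sum>i\<in>{1..N} - {k}. \<eta> * \<bar>ln S\<bar>)"
      proof (intro add_mono sum_mono mult_left_mono)
        show "ln (s' k) \<le> ln e" using k pos e by (simp add: less_imp_le)
        fix i assume "i \<in> {1..N} - {k}"
        then have "ln (s' i) \<le> ln S" using pos s'(2)[of i] S by auto
        then show "ln (s' i) \<le> \<bar>ln S\<bar>" by linarith
      qed (use \<eta> in auto)
      also have "(\<Sum>i\<in>{1..N} - {k}. \<eta> * \<bar>ln S\<bar>) \<le> \<eta> * (N * \<bar>ln S\<bar>)"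
        using k \<eta> by (auto intro!: mult_right_mono)
      also have "\<eta> * ln e + \<eta> * (N * \<bar>ln S\<bar>) = \<eta> * (ln e + N * \<bar>ln S\<bar>)" by (simp add: algebra_simps)
      also have "\<dots> \<le> \<eta> * ((F (0, s0) - B) / \<eta>)" using e(3) \<eta> by (intro mult_left_mono) auto
      also have "\<dots> = F (0, s0) - B" using \<eta> by simp
      finally have "F (t', s') \<le> F (0, s0)" using bd[OF t' s'(1)] by (simp add: F_def)
      also have "\<dots> \<le> F p" using p(2) \<open>(0, s0) \<in> {0..T} \<times> Q\<close> by auto
      finally show ?thesis .
    qed
    then show "f t' s' + barrier N \<kappa> \<eta> s' \<le> f t s + barrier N \<kappa> \<eta> s" by (simp add: F_def ts)
  qed
qed

text \<open>Limits what the perturbation can gain over a fixed point \<open>s0\<close>: the gain is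
  at most a constant times \<eta> plus a constant times \<kappa>. For small \<eta> and \<kappa> the
  perturbed maximum is therefore attained where the unperturbed function is still clearly
  positive.\<close>

lemma barrier_diff_le:
  assumes s0: "s0 \<in> params N" and s: "s \<in> params N" "\<And>i. s i \<le> S" and \<eta>: "0 \<le> \<eta>" and \<kappa>: "0 \<le> \<kappa>"
  shows "barrier N \<kappa> \<eta> s - barrier N \<kappa> \<eta> s0
    \<le> \<eta> * (\<Sum>i\<in>{1..N}. ln S - ln (s0 i)) + \<kappa> * (\<Sum>i\<in>{1..N}. real (i * (N + 1 - i)) * s0 i)"
  unfolding barrier_def sum_subtractf[symmetric] sum_distrib_left sum.distrib[symmetric]
proof (rule sum_mono)
  fix i assume i: "i \<in> {1..N}"
  have "ln (s i) \<le> ln S" using s(2)[of i] params_pos[OF s(1) i] by simp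
  then have "\<eta> * ln (s i) \<le> \<eta> * ln S" using \<eta> by (intro mult_left_mono)
  moreover have "0 \<le> \<kappa> * (real (i * (N + 1 - i)) * s i)"
    using \<kappa> params_pos[OF s(1) i] by (intro mult_nonneg_nonneg) auto
  ultimately show "\<eta> * ln (s i) - \<kappa> * (real (i * (N + 1 - i)) * s i) -
    (\<eta> * ln (s0 i) - \<kappa> * (real (i * (N + 1 - i)) * s0 i))
    \<le> \<eta> * (ln S - ln (s0 i)) + \<kappa> * (real (i * (N + 1 - i)) * s0 i)"
    by (simp add: right_diff_distrib)
qed

section \<open>Maximum principles for the stationary and for the evolution equation\<close>

lemma params_le_sum:
  assumes "s \<in> params N" shows "s i \<le> (\<Sum>i\<in>{1..N}. s i)"
proof (cases "i \<in> {1..N}")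
  case True
  then show ?thesis using params_nonneg[OF assms] by (intro member_le_sum) auto
next
  case False
  then show ?thesis using assms params_nonneg[OF assms] by (auto simp: params_def intro!: sum_nonneg)
qed

lemma params_sum_pos:
  assumes "s \<in> params N" "N \<ge> 1" shows "0 < (\<Sum>i\<in>{1..N}. s i)"
  using params_le_sum[OF assms(1), of 1] params_pos[OF assms(1), of 1] assms(2) by force

lemma move_le_bound:
  assumes "s \<in> params N" "i \<in> {1..N}" "0 < u" "u < 1" "\<And>k. s k \<le> S"
  shows "move s i j u k \<le> S"
  using move_le[of s i S j u] assms by (cases "k = i") (auto simp: move_def)

text \<open>At the perturbed maximum \<psi> is at least \<open>m > 0\<close>, so by the condition
  near 0 the coordinates have sum at least \<rho>. There the drift of the concave weights beats the
  cost of the logarithms and \<open>dual_op N \<psi> s\<close> is negative, whereas the equation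
  makes it equal to \<open>V s * \<psi> s\<close>, which is nonnegative.\<close>

lemma elliptic_max_principle:
  fixes \<psi> :: "(nat \<Rightarrow> real) \<Rightarrow> real"
  assumes N: "N \<ge> 1"
    and cont: "continuous_on (params N) \<psi>"
    and bd: "\<And>s. s \<in> params N \<Longrightarrow> \<psi> s \<le> B"
    and V: "\<And>s. s \<in> params N \<Longrightarrow> 0 \<le> V s"
    and int: "\<And>s i j. s \<in> params N \<Longrightarrow> i \<in> {1..N} \<Longrightarrow>
      set_integrable lborel {0<..<1} (\<lambda>u. (\<psi> (move s i j u) - \<psi> s) / u)"
    and eq: "\<And>s. s \<in> params N \<Longrightarrow> dual_op N \<psi> s = V s * \<psi> s"
    and zero: "\<And>e. 0 < e \<Longrightarrow> \<exists>\<rho>>0. \<forall>s\<in>params N. (\<Sum>i\<in>{1..N}. s i) < \<rho> \<longrightarrow> \<psi> s < e"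
    and s0: "s0 \<in> params N"
  shows "\<psi> s0 \<le> 0"
proof (rule ccontr)
  assume "\<not> \<psi> s0 \<le> 0"
  define m where "m = \<psi> s0 / 2"
  have m: "0 < m" using \<open>\<not> \<psi> s0 \<le> 0\<close> by (simp add: m_def)
  obtain \<rho> where \<rho>: "\<rho> > 0" "\<And>s. s \<in> params N \<Longrightarrow> (\<Sum>i\<in>{1..N}. s i) < \<rho> \<Longrightarrow> \<psi> s < m"
    using zero[OF m] by auto
  define S where "S = (\<Sum>i\<in>{1..N}. s0 i)"
  have S: "S > 0" "\<And>i. s0 i \<le> S" using params_sum_pos[OF s0 N] params_le_sum[OF s0] by (auto simp: S_def)
  define K0 where "K0 = (\<Sum>i\<in>{1..N}. real (i * (N + 1 - i)) * s0 i)"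
  have K0: "K0 \<ge> 0" unfolding K0_def by (intro sum_nonneg mult_nonneg_nonneg params_nonneg[OF s0]) auto
  define G0 where "G0 = (\<Sum>i\<in>{1..N}. ln S - ln (s0 i))"
  have G0: "G0 \<ge> 0" unfolding G0_def
    by (intro sum_nonneg) (use S params_pos[OF s0] in \<open>auto simp: ln_le_cancel_iff\<close>)
  \<comment> \<open>Of the height \<open>\<psi> s0 = 2 * m\<close>, the two parts of the barrier may
    use \<open>m / 2\<close> each, since \<open>\<kappa> * K0 \<le> m / 2\<close> and
    \<open>\<eta> * G0 \<le> m / 2\<close>. The second entry of the minimum in \<eta> gives
    \<open>4 * \<eta> \<le> \<kappa> * \<rho>\<close>, half of the available drift.\<close>
  define \<kappa> where "\<kappa> = m / (2 * (K0 + 1))"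
  have \<kappa>: "\<kappa> > 0" "\<kappa> * K0 \<le> m / 2" using K0 m by (auto simp: \<kappa>_def field_simps)
  define \<eta> where "\<eta> = min (m / (2 * (G0 + 1))) (\<kappa> * \<rho> / 4)"
  have \<eta>: "\<eta> > 0" using G0 m \<kappa> \<rho> by (auto simp: \<eta>_def)
  have \<eta>G: "\<eta> * G0 \<le> m / 2"
  proof -
    have "\<eta> * G0 \<le> m / (2 * (G0 + 1)) * G0" using G0 by (intro mult_right_mono) (auto simp: \<eta>_def)
    also have "\<dots> \<le> m / 2" using G0 m by (simp add: field_simps)
    finally show ?thesis .
  qed
  have cont': "continuous_on ({0..0::real} \<times> params N) (\<lambda>(t, s). \<psi> s)"
    unfolding case_prod_unfold by (rule continuous_on_compose2[OF cont]) (auto intro: continuous_intros)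
  obtain t s where s: "s \<in> params N" "\<And>i. s i \<le> S" and max:
    "\<And>t' s'. t' \<in> {0..0::real} \<Longrightarrow> s' \<in> params N \<Longrightarrow> (\<And>i. s' i \<le> S) \<Longrightarrow>
       \<psi> s' + barrier N \<kappa> \<eta> s' \<le> \<psi> s + barrier N \<kappa> \<eta> s"
    by (rule barrier_max_exists[OF N order_refl S(1) \<eta> less_imp_le[OF \<kappa>(1)] cont' bd]) auto
  have "2 * m \<le> \<psi> s + (barrier N \<kappa> \<eta> s - barrier N \<kappa> \<eta> s0)"
    using max[of 0 s0] s0 S by (simp add: m_def)
  also have "\<dots> \<le> \<psi> s + (\<eta> * G0 + \<kappa> * K0)"
    using barrier_diff_le[OF s0 s, of \<eta> \<kappa>] \<eta> \<kappa> by (simp add: G0_def K0_def)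
  finally have ge: "m \<le> \<psi> s" using \<eta>G \<kappa> by simp
  then have \<rho>s: "\<rho> \<le> (\<Sum>i\<in>{1..N}. s i)" using \<rho>(2)[OF s(1)] by force
  have "dual_op N \<psi> s \<le> 4 * \<eta> - 2 * \<kappa> * (\<Sum>i\<in>{1..N}. s i)"
  proof (rule dual_op_le_at_max[OF N s(1)])
    fix i j u assume "i \<in> {1..N}" and u: "0 < (u::real)" "u < 1"
    then show "\<psi> (move s i j u) + barrier N \<kappa> \<eta> (move s i j u) \<le> \<psi> s + barrier N \<kappa> \<eta> s"
      using s by (intro max[of 0] move_params move_le_bound) auto
  qed (use \<eta> int s in auto)
  also have "\<dots> \<le> \<kappa> * \<rho> - 2 * \<kappa> * \<rho>"
  proof -
    have "4 * \<eta> \<le> \<kappa> * \<rho>" by (simp add: \<eta>_def)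
    moreover have "2 * \<kappa> * \<rho> \<le> 2 * \<kappa> * (\<Sum>i\<in>{1..N}. s i)"
      using \<kappa> \<rho>s by (intro mult_left_mono) auto
    ultimately show ?thesis by linarith
  qed
  also have "\<dots> < 0" using \<kappa> \<rho> by simp
  finally show False using eq[OF s(1)] V[OF s(1)] ge m by (smt (verit) mult_nonneg_nonneg)
qed

text \<open>The time derivative enters only through increments from the past: a slope
  \<open>c\<close> that bounds all of them from below is bounded by the right-hand side. A maximum
  over space and time of \<open>D t s - c * t\<close> plus barrier supplies exactly such a slope.
  The linear term in time gives the strictness, so no condition near \<open>s = 0\<close> is
  required of the solution.\<close>

lemma parabolic_max_principle:
  fixes D :: "real \<Rightarrow> (nat \<Rightarrow> real) \<Rightarrow> real"
  assumes N: "N \<ge> 1"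
    and cont: "continuous_on ({0..} \<times> params N) (\<lambda>(t, s). D t s)"
    and bd: "\<And>t s. 0 \<le> t \<Longrightarrow> s \<in> params N \<Longrightarrow> D t s \<le> B"
    and V: "\<And>s. s \<in> params N \<Longrightarrow> 0 \<le> V s"
    and int: "\<And>t s i j. 0 \<le> t \<Longrightarrow> s \<in> params N \<Longrightarrow> i \<in> {1..N} \<Longrightarrow>
      set_integrable lborel {0<..<1} (\<lambda>u. (D t (move s i j u) - D t s) / u)"
    and init: "\<And>s. s \<in> params N \<Longrightarrow> D 0 s \<le> 0"
    and deriv: "\<And>t s c. 0 < t \<Longrightarrow> s \<in> params N \<Longrightarrow>
      (\<And>h. 0 < h \<Longrightarrow> h \<le> t \<Longrightarrow> c * h \<le> D t s - D (t - h) s) \<Longrightarrow> c \<le> dual_op N (D t) s - V s * D t s"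
    and s0: "s0 \<in> params N" and t0: "0 \<le> t0"
  shows "D t0 s0 \<le> 0"
proof (rule ccontr)
  assume neg: "\<not> D t0 s0 \<le> 0"
  define m where "m = D t0 s0 / 4"
  have m: "0 < m" using neg by (simp add: m_def)
  have t0': "0 < t0" using neg init[OF s0] t0 by (cases "t0 = 0") auto
  \<comment> \<open>With \<open>D t0 s0 = 4 * m\<close>, the time penalty uses
    \<open>c * t0 = m\<close> and the barrier at most \<open>m\<close>, so the value at the maximum
    stays above \<open>m\<close>. Below, the choice \<open>\<eta> \<le> c / 8\<close> makes the
    barrier cost \<open>4 * \<eta>\<close> at most \<open>c / 2\<close>.\<close>
  define c where "c = m / t0"
  have c: "c > 0" "c * t0 = m" using m t0' by (auto simp: c_def)
  define S where "S = (\<Sum>i\<in>{1..N}. s0 i)"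
  have S: "S > 0" "\<And>i. s0 i \<le> S" using params_sum_pos[OF s0 N] params_le_sum[OF s0] by (auto simp: S_def)
  define G0 where "G0 = (\<Sum>i\<in>{1..N}. ln S - ln (s0 i))"
  have G0: "G0 \<ge> 0" unfolding G0_def
    by (intro sum_nonneg) (use S params_pos[OF s0] in \<open>auto simp: ln_le_cancel_iff\<close>)
  define \<eta> where "\<eta> = min (m / (G0 + 1)) (c / 8)"
  have \<eta>: "\<eta> > 0" using G0 m c by (auto simp: \<eta>_def)
  have \<eta>G: "\<eta> * G0 \<le> m"
  proof -
    have "\<eta> * G0 \<le> m / (G0 + 1) * G0" using G0 by (intro mult_right_mono) (auto simp: \<eta>_def)
    also have "\<dots> \<le> m" using G0 m by (simp add: field_simps)
    finally show ?thesis .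
  qed
  have cont': "continuous_on ({0..t0} \<times> params N) (\<lambda>(t, s). D t s - c * t)"
  proof -
    have "continuous_on ({0..t0} \<times> params N) (\<lambda>(t, s). D t s)"
      by (rule continuous_on_subset[OF cont]) auto
    then show ?thesis unfolding case_prod_unfold by (intro continuous_intros)
  qed
  have bd': "D t s - c * t \<le> B" if "t \<in> {0..t0}" "s \<in> params N" for t s
    using bd[of t s] that c by (smt (verit) atLeastAtMost_iff mult_nonneg_nonneg)
  obtain t s where t: "t \<in> {0..t0}" and s: "s \<in> params N" "\<And>i. s i \<le> S" and max:
    "\<And>t' s'. t' \<in> {0..t0} \<Longrightarrow> s' \<in> params N \<Longrightarrow> (\<And>i. s' i \<le> S) \<Longrightarrow>
       D t' s' - c * t' + barrier N 0 \<eta> s' \<le> D t s - c * t + barrier N 0 \<eta> s"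
    using barrier_max_exists[OF N t0 S(1) \<eta> order_refl cont' bd'] by blast
  have "4 * m - m \<le> D t s - c * t + (barrier N 0 \<eta> s - barrier N 0 \<eta> s0)"
    using max[of t0 s0] s0 S c t0 by (simp add: m_def)
  also have "\<dots> \<le> D t s + \<eta> * G0"
  proof -
    have "0 \<le> c * t" using c t by auto
    then show ?thesis using barrier_diff_le[OF s0 s, of \<eta> 0] \<eta> by (auto simp: G0_def)
  qed
  finally have ge: "m \<le> D t s" using \<eta>G m by simp
  have tp: "0 < t" using ge init[OF s(1)] m t by (cases "t = 0") auto
  have "c \<le> dual_op N (D t) s - V s * D t s"
  proof (rule deriv[OF tp s(1)])
    fix h assume "0 < h" "h \<le> t"
    then show "c * h \<le> D t s - D (t - h) s"
      using max[of "t - h" s] s t by (auto simp: algebra_simps)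
  qed
  moreover have "dual_op N (D t) s \<le> 4 * \<eta> - 2 * 0 * (\<Sum>i\<in>{1..N}. s i)"
  proof (rule dual_op_le_at_max[OF N s(1)])
    fix i j u assume "i \<in> {1..N}" and u: "0 < (u::real)" "u < 1"
    then show "D t (move s i j u) + barrier N 0 \<eta> (move s i j u) \<le> D t s + barrier N 0 \<eta> s"
      using max[of t "move s i j u"] s t move_params[of s N i u j] move_le_bound[of s N i u S j] by auto
  qed (use \<eta> int s t in auto)
  moreover have "4 * \<eta> \<le> c / 2" by (auto simp: \<eta>_def)
  moreover have "0 \<le> V s * D t s" using V[OF s(1)] ge m by (intro mult_nonneg_nonneg) auto
  ultimately show False using c by simp
qed

section \<open>Product test functions\<close>

abbreviation orthant :: "nat \<Rightarrow> (nat \<Rightarrow> real) set" where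
  "orthant N \<equiv> space (config_space N)"

abbreviation laws :: "nat \<Rightarrow> (nat \<Rightarrow> real) measure set" where
  "laws N \<equiv> space (prob_algebra (config_space N))"

lemma space_config_space: "orthant N = PiE {1..N} (\<lambda>_. {0..})"
  by (simp add: config_space_def space_PiM nonneg_borel_def space_restrict_space)

lemma config_nonneg: "x \<in> orthant N \<Longrightarrow> i \<in> {1..N} \<Longrightarrow> 0 \<le> x i"
  by (auto simp: space_config_space PiE_def Pi_def)

lemma measurable_coordinate [measurable (raw)]:
  assumes "i \<in> {1..N}" shows "(\<lambda>x. x i) \<in> borel_measurable (config_space N)"
proof -
  have "(\<lambda>x. x i) \<in> config_space N \<rightarrow>\<^sub>M nonneg_borel"
    unfolding config_space_def using assms by (rule measurable_component_singleton)
  then show ?thesis by (simp add: nonneg_borel_def measurable_restrict_space2_iff)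
qed

text \<open>Adding the bound \<open>B\<close> makes the integrand nonnegative and reduces the claim
  to \<open>nn_integral_bind\<close>; the added constant cancels because all measures involved are
  probabilities.\<close>

lemma integral_bind_bounded:
  fixes f :: "'b \<Rightarrow> real"
  assumes M: "prob_space M" and K: "K \<in> M \<rightarrow>\<^sub>M prob_algebra L"
    and f[measurable]: "f \<in> borel_measurable L" and B: "\<And>y. y \<in> space L \<Longrightarrow> \<bar>f y\<bar> \<le> B"
  shows "(\<lambda>x. \<integral>y. f y \<partial>K x) \<in> borel_measurable M"
    and "(\<integral>y. f y \<partial>(Giry_Monad.bind M K)) = (\<integral>x. (\<integral>y. f y \<partial>K x) \<partial>M)"
proof -
  note K'[measurable] = measurable_prob_algebraD[OF K]
  have Kx: "prob_space (K x)" "sets (K x) = sets L" "space (K x) = space L" if "x \<in> space M" for x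
    using measurable_space[OF K that] by (auto simp: space_prob_algebra dest: sets_eq_imp_space_eq)
  have int: "integrable (K x) f" if x: "x \<in> space M" for x
  proof -
    interpret prob_space "K x" by (rule Kx[OF x])
    show ?thesis
      by (rule integrable_const_bound[of _ B])
        (use B Kx[OF x] in \<open>auto cong: measurable_cong_sets\<close>)
  qed
  show m[measurable]: "(\<lambda>x. \<integral>y. f y \<partial>K x) \<in> borel_measurable M"
    by measurable
  have neM: "space M \<noteq> {}" using M by (rule prob_space.not_empty)
  define g where "g y = f y + B" for y
  have g: "\<And>y. y \<in> space L \<Longrightarrow> 0 \<le> g y" using B by (auto simp: g_def abs_le_iff) (smt (verit))
  have gm[measurable]: "g \<in> borel_measurable L" unfolding g_def by measurable
  interpret M: prob_space M by fact
  have bp: "prob_space (Giry_Monad.bind M K)" 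
    by (rule M.prob_space_bind[OF _ K']) (use Kx in auto)
  then interpret bd: prob_space "Giry_Monad.bind M K" .
  have sb: "sets (Giry_Monad.bind M K) = sets L" "space (Giry_Monad.bind M K) = space L"
    using sets_bind[OF _ neM] Kx(2) by (auto dest: sets_eq_imp_space_eq)
  have fb: "integrable (Giry_Monad.bind M K) f"
    by (rule bd.integrable_const_bound[of _ B]) (use B sb in \<open>auto cong: measurable_cong_sets\<close>)
  have ib: "\<bar>\<integral>y. f y \<partial>K x\<bar> \<le> B" if x: "x \<in> space M" for x
  proof -
    interpret prob_space "K x" by (rule Kx[OF x])
    show ?thesis
      using int[OF x] B Kx(3)[OF x]
      by (intro abs_leI) (auto intro!: integral_le_const integral_ge_const simp: minus_le_iff abs_le_iff)
  qed
  have fK: "integrable M (\<lambda>x. \<integral>y. f y \<partial>K x)"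
    by (rule M.integrable_const_bound[of _ B]) (use ib in auto)
  have gi: "(\<integral>y. g y \<partial>K x) = (\<integral>y. f y \<partial>K x) + B" if x: "x \<in> space M" for x
  proof -
    interpret prob_space "K x" by (rule Kx[OF x])
    show ?thesis unfolding g_def using int[OF x] by (simp add: prob_space)
  qed
  have "ennreal (\<integral>y. g y \<partial>(Giry_Monad.bind M K)) = (\<integral>\<^sup>+y. g y \<partial>(Giry_Monad.bind M K))"
    by (rule nn_integral_eq_integral[symmetric]) (use g fb sb in \<open>auto simp: g_def\<close>)
  also have "\<dots> = (\<integral>\<^sup>+x. \<integral>\<^sup>+y. g y \<partial>K x \<partial>M)"
    by (rule nn_integral_bind[OF _ K']) measurable
  also have "\<dots> = (\<integral>\<^sup>+x. ennreal (\<integral>y. g y \<partial>K x) \<partial>M)"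
  proof (rule nn_integral_cong)
    fix x assume x: "x \<in> space M"
    interpret prob_space "K x" by (rule Kx[OF x])
    show "(\<integral>\<^sup>+y. g y \<partial>K x) = ennreal (\<integral>y. g y \<partial>K x)"
      by (rule nn_integral_eq_integral) (use g int[OF x] Kx[OF x] in \<open>auto simp: g_def\<close>)
  qed
  also have "\<dots> = ennreal (\<integral>x. (\<integral>y. g y \<partial>K x) \<partial>M)"
  proof (rule nn_integral_eq_integral)
    show "integrable M (\<lambda>x. \<integral>y. g y \<partial>K x)"
      using fK by (subst Bochner_Integration.integrable_cong[OF refl gi]) auto
    show "AE x in M. 0 \<le> (\<integral>y. g y \<partial>K x)"
      by (rule AE_I2, rule integral_nonneg_AE, rule AE_I2) (use g Kx in auto)
  qed
  finally have "ennreal (\<integral>y. g y \<partial>(Giry_Monad.bind M K)) = ennreal (\<integral>x. (\<integral>y. g y \<partial>K x) \<partial>M)" .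
  then have "(\<integral>y. g y \<partial>(Giry_Monad.bind M K)) = (\<integral>x. (\<integral>y. g y \<partial>K x) \<partial>M)"
    by (subst (asm) ennreal_inj)
      (auto intro!: integral_nonneg_AE AE_I2 g simp: sb Kx)
  also have "(\<integral>x. (\<integral>y. g y \<partial>K x) \<partial>M) = (\<integral>x. (\<integral>y. f y \<partial>K x) + B \<partial>M)"
    by (rule Bochner_Integration.integral_cong[OF refl gi])
  also have "\<dots> = (\<integral>x. (\<integral>y. f y \<partial>K x) \<partial>M) + B" using fK by (simp add: M.prob_space)
  finally show "(\<integral>y. f y \<partial>(Giry_Monad.bind M K)) = (\<integral>x. (\<integral>y. f y \<partial>K x) \<partial>M)"
    using fb by (simp add: g_def bd.prob_space)
qed

text \<open>The common properties of \<open>1 / (1 + y)\<close> and \<open>exp (- y)\<close>.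
  \<open>q_relative\<close> makes the product functions continuous in the parameter uniformly over
  unbounded configurations, \<open>q_lipschitz\<close> makes them Lipschitz in the configuration,
  and \<open>q_decay\<close> makes them vanish at infinity.\<close>

locale profile =
  fixes q :: "real \<Rightarrow> real"
  assumes q_zero: "q 0 = 1"
    and q_pos: "0 \<le> y \<Longrightarrow> 0 < q y"
    and q_antimono: "0 \<le> y \<Longrightarrow> y \<le> z \<Longrightarrow> q z \<le> q y"
    and q_lipschitz: "0 \<le> y \<Longrightarrow> y \<le> z \<Longrightarrow> q y - q z \<le> z - y"
    and q_relative: "0 < y \<Longrightarrow> y \<le> z \<Longrightarrow> q y - q z \<le> (z - y) / y"
    and q_decay: "0 < y \<Longrightarrow> q y \<le> 1 / y"
    and q_measurable [measurable]: "q \<in> borel_measurable borel"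
begin

definition E :: "nat \<Rightarrow> (nat \<Rightarrow> real) \<Rightarrow> (nat \<Rightarrow> real) \<Rightarrow> real" where
  "E N s x = (\<Prod>i\<in>{1..N}. q (s i * x i))"

lemma q_le_1: "0 \<le> y \<Longrightarrow> q y \<le> 1"
  using q_antimono[of 0 y] q_zero by simp

lemma q_abs_diff: "0 \<le> y \<Longrightarrow> 0 \<le> z \<Longrightarrow> \<bar>q y - q z\<bar> \<le> \<bar>y - z\<bar>"
  using q_lipschitz[of y z] q_lipschitz[of z y] q_antimono[of y z] q_antimono[of z y]
  by (cases "y \<le> z") auto

text \<open>The bound is free of \<open>x\<close>: \<open>q_relative\<close> divides by the smaller
  argument, which is proportional to \<open>x\<close>.\<close>

lemma q_scale_diff:
  assumes "0 < s" "0 < t" "0 \<le> x"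
  shows "\<bar>q (s * x) - q (t * x)\<bar> \<le> \<bar>s - t\<bar> / min s t"
proof -
  have *: "\<bar>q (s * x) - q (t * x)\<bar> \<le> (t - s) / s" if "0 < s" "s \<le> t" for s t
  proof (cases "x = 0")
    case False
    then have x: "0 < x" using assms by simp
    have le: "s * x \<le> t * x" using that x by simp
    have "\<bar>q (s * x) - q (t * x)\<bar> = q (s * x) - q (t * x)"
      using q_antimono[OF _ le] that x by simp
    also have "\<dots> \<le> (t * x - s * x) / (s * x)" using that x le by (intro q_relative) auto
    also have "\<dots> = (t - s) / s" using x that by (simp add: field_simps)
    finally show ?thesis .
  qed (use that in auto)
  show ?thesis using *[of s t] *[of t s] assms by (cases "s \<le> t") (auto simp: abs_minus_commute min_def)
qed

lemma E_nonneg: "x \<in> orthant N \<Longrightarrow> (\<And>i. i \<in> {1..N} \<Longrightarrow> 0 \<le> s i) \<Longrightarrow> 0 \<le> E N s x"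
  unfolding E_def by (intro prod_nonneg less_imp_le[OF q_pos] mult_nonneg_nonneg) (auto intro: config_nonneg)

lemma E_le_q:
  assumes "x \<in> orthant N" "\<And>i. i \<in> {1..N} \<Longrightarrow> 0 \<le> s i" "k \<in> {1..N}"
  shows "E N s x \<le> q (s k * x k)"
proof -
  have "E N s x = q (s k * x k) * (\<Prod>i\<in>{1..N} - {k}. q (s i * x i))"
    unfolding E_def using assms by (subst prod.remove[of _ k]) auto
  also have "\<dots> \<le> q (s k * x k) * 1"
    using assms by (intro mult_left_mono prod_le_1 conjI less_imp_le[OF q_pos] q_le_1 mult_nonneg_nonneg)
      (auto intro: config_nonneg)
  finally show ?thesis by simp
qed

lemma E_le_1: 
  assumes "x \<in> orthant N" "\<And>i. i \<in> {1..N} \<Longrightarrow> 0 \<le> s i"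
  shows "E N s x \<le> 1"
  unfolding E_def using assms
  by (intro prod_le_1 conjI less_imp_le[OF q_pos] q_le_1 mult_nonneg_nonneg) (auto intro: config_nonneg)

lemma E_params:
  assumes "x \<in> orthant N" "s \<in> params N"
  shows "0 \<le> E N s x" "E N s x \<le> 1"
  using E_nonneg[OF assms(1)] E_le_1[OF assms(1)] params_nonneg[OF assms(2)] by auto

lemma E_measurable [measurable]: "E N s \<in> borel_measurable (config_space N)"
  unfolding E_def by measurable

lemma E_abs_diff:
  assumes "\<And>i. i \<in> {1..N} \<Longrightarrow> 0 \<le> s i * x i" "\<And>i. i \<in> {1..N} \<Longrightarrow> 0 \<le> t i * y i"
  shows "\<bar>E N s x - E N t y\<bar> \<le> (\<Sum>i\<in>{1..N}. \<bar>q (s i * x i) - q (t i * y i)\<bar>)"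
  unfolding E_def real_norm_def[symmetric]
  by (rule norm_prod_diff) (use assms q_le_1 q_pos in \<open>auto simp: less_imp_le abs_of_pos\<close>)

lemma E_param_diff:
  assumes "s \<in> params N" "t \<in> params N" "x \<in> orthant N"
  shows "\<bar>E N s x - E N t x\<bar> \<le> (\<Sum>i\<in>{1..N}. \<bar>s i - t i\<bar> / min (s i) (t i))"
proof -
  have "\<bar>E N s x - E N t x\<bar> \<le> (\<Sum>i\<in>{1..N}. \<bar>q (s i * x i) - q (t i * x i)\<bar>)"
    by (rule E_abs_diff) (use assms params_nonneg config_nonneg in \<open>blast intro!: mult_nonneg_nonneg\<close>)+
  also have "\<dots> \<le> (\<Sum>i\<in>{1..N}. \<bar>s i - t i\<bar> / min (s i) (t i))"
    by (intro sum_mono q_scale_diff) (use assms in \<open>auto intro: params_pos config_nonneg\<close>)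
  finally show ?thesis .
qed

text \<open>For \<open>u < 1/2\<close> the moved coordinate is still at least
  \<open>s i / 2\<close>, so the relative estimate applies; for larger \<open>u\<close> the trivial
  bound 1 is at most \<open>2 * u\<close>. The linear factor \<open>u\<close> is what compensates
  the rate \<open>1 / u\<close>.\<close>

lemma E_move_diff:
  assumes s: "s \<in> params N" and i: "i \<in> {1..N}" and x: "x \<in> orthant N" and u: "0 \<le> u" "u < 1"
  shows "\<bar>E N (move s i j u) x - E N s x\<bar> \<le> (2 + 2 * \<bar>s j - s i\<bar> / s i) * u"
proof (cases "u < 1/2")
  case True
  let ?m = "move s i j u"
  have m: "?m \<in> params N" by (rule move_params[OF s i u])
  have si: "0 < s i" by (rule params_pos[OF s i])
  have "\<bar>E N ?m x - E N s x\<bar> \<le> (\<Sum>k\<in>{1..N}. \<bar>?m k - s k\<bar> / min (?m k) (s k))"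
    by (rule E_param_diff[OF m s x])
  also have "\<dots> = (\<Sum>k\<in>{1..N}. if k = i then \<bar>?m i - s i\<bar> / min (?m i) (s i) else 0)"
    by (rule sum.cong) (auto simp: move_def)
  also have "\<dots> = \<bar>?m i - s i\<bar> / min (?m i) (s i)" using i by simp
  also have "\<dots> \<le> \<bar>?m i - s i\<bar> / (s i / 2)"
  proof (intro divide_left_mono)
    have "?m i = (1 - u) * s i + u * s j" by (simp add: move_def algebra_simps)
    also have "\<dots> \<ge> (1/2) * s i + 0"
      using True u si params_nonneg[OF s, of j] by (intro add_mono mult_right_mono) auto
    finally show "s i / 2 \<le> min (?m i) (s i)" using si by simp
    then show "0 < min (?m i) (s i) * (s i / 2)" using si by (smt (verit) mult_pos_pos half_gt_zero)
  qed simp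
  also have "\<dots> = 2 * \<bar>s j - s i\<bar> / s i * u" using u by (simp add: move_def abs_mult)
  also have "\<dots> \<le> (2 + 2 * \<bar>s j - s i\<bar> / s i) * u" using u by (intro mult_right_mono) auto
  finally show ?thesis .
next
  case False
  have "\<bar>E N (move s i j u) x - E N s x\<bar> \<le> 1"
    using E_params[OF x s] E_params[OF x move_params[OF s i u]] by (simp add: abs_le_iff) (smt (verit))
  also have "\<dots> \<le> 2 * u" using False by simp
  also have "\<dots> \<le> (2 + 2 * \<bar>s j - s i\<bar> / s i) * u"
    using u params_pos[OF s i] by (intro mult_right_mono) auto
  finally show ?thesis .
qed

end

section \<open>Averages of the test functions\<close>

text \<open>This sum is the modulus of continuity given by \<open>E_param_diff\<close>. It is the
  same for all laws, hence for all times of an evolution.\<close>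

lemma continuous_on_relative_distance:
  assumes s: "s \<in> params N"
  shows "continuous_on (params N) (\<lambda>t. \<Sum>i\<in>{1..N}. \<bar>t i - s i\<bar> / min (t i) (s i))"
proof -
  have c: "continuous_on (params N) (\<lambda>t. t i)" for i :: nat
    by (rule continuous_on_subset[OF continuous_on_product_coordinates]) simp
  have "min (t i) (s i) \<noteq> 0" if "i \<in> {1..N}" "t \<in> params N" for t i
    using params_pos[OF that(2,1)] params_pos[OF s that(1)] by (simp add: min_def)
  then show ?thesis by (intro continuous_intros c) auto
qed

context profile begin

definition avg :: "nat \<Rightarrow> (nat \<Rightarrow> real) measure \<Rightarrow> (nat \<Rightarrow> real) \<Rightarrow> real" where
  "avg N \<nu> s = (\<integral>x. E N s x \<partial>\<nu>)"

context
  fixes N :: nat and \<nu> :: "(nat \<Rightarrow> real) measure"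
  assumes \<nu>: "\<nu> \<in> laws N"
begin

lemma prob_space_config_law: "prob_space \<nu>" and sets_config_law: "sets \<nu> = sets (config_space N)"
  and space_config_law: "space \<nu> = orthant N"
  using \<nu> by (auto simp: space_prob_algebra dest: sets_eq_imp_space_eq)

lemma integrable_bounded_config:
  fixes f :: "(nat \<Rightarrow> real) \<Rightarrow> real"
  assumes "f \<in> borel_measurable (config_space N)" "\<And>x. x \<in> orthant N \<Longrightarrow> \<bar>f x\<bar> \<le> B"
  shows "integrable \<nu> f"
proof -
  interpret prob_space \<nu> by (rule prob_space_config_law)
  show ?thesis
    by (rule integrable_const_bound[of _ B])
      (use assms sets_config_law space_config_law in \<open>auto cong: measurable_cong_sets\<close>)
qed

lemma integral_abs_le_config:
  fixes f :: "(nat \<Rightarrow> real) \<Rightarrow> real"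
  assumes "f \<in> borel_measurable (config_space N)" "\<And>x. x \<in> orthant N \<Longrightarrow> \<bar>f x\<bar> \<le> B"
  shows "\<bar>\<integral>x. f x \<partial>\<nu>\<bar> \<le> B"
proof -
  interpret prob_space \<nu> by (rule prob_space_config_law)
  have i: "integrable \<nu> f" by (rule integrable_bounded_config[OF assms])
  show ?thesis
    by (rule abs_leI)
      (use i assms(2) space_config_law in \<open>auto intro!: integral_le_const integral_ge_const simp: minus_le_iff abs_le_iff\<close>)
qed

lemma E_integrable: "s \<in> params N \<Longrightarrow> integrable \<nu> (E N s)"
  by (rule integrable_bounded_config[of _ 1]) (use E_params in auto)

lemma avg_bounds:
  assumes "s \<in> params N" shows "0 \<le> avg N \<nu> s" "avg N \<nu> s \<le> 1"
proof -
  interpret prob_space \<nu> by (rule prob_space_config_law)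
  show "0 \<le> avg N \<nu> s" unfolding avg_def
    by (intro integral_nonneg_AE AE_I2) (use E_params assms space_config_law in auto)
  show "avg N \<nu> s \<le> 1" unfolding avg_def
    by (intro integral_le_const E_integrable assms AE_I2) (use E_params assms space_config_law in auto)
qed

lemma avg_diff_bound:
  assumes "s \<in> params N" "t \<in> params N" "\<And>x. x \<in> orthant N \<Longrightarrow> \<bar>E N s x - E N t x\<bar> \<le> B"
  shows "\<bar>avg N \<nu> s - avg N \<nu> t\<bar> \<le> B"
proof -
  have "avg N \<nu> s - avg N \<nu> t = (\<integral>x. E N s x - E N t x \<partial>\<nu>)"
    unfolding avg_def using E_integrable assms by simp
  also have "\<bar>\<dots>\<bar> \<le> B" by (rule integral_abs_le_config) (use assms in auto)
  finally show ?thesis .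
qed

text \<open>By \<open>E_move_diff\<close> the factor \<open>1 / u\<close> cancels, so the integrand
  is bounded on a set of finite measure. This permits exchanging the dual operator with the
  average.\<close>

lemma E_dual_integrable_pair:
  assumes s: "s \<in> params N" and i: "i \<in> {1..N}"
  shows "integrable (lborel \<Otimes>\<^sub>M \<nu>) (\<lambda>(u, x). indicator {0<..<1} u *\<^sub>R ((E N (move s i j u) x - E N s x) / u))"
proof (rule integrableI_bounded_set)
  interpret prob_space \<nu> by (rule prob_space_config_law)
  have c: "(\<lambda>p. snd p k) \<in> borel_measurable (lborel \<Otimes>\<^sub>M \<nu>)" if "k \<in> {1..N}" for k
  proof (rule measurable_compose[OF measurable_snd])
    show "(\<lambda>x. x k) \<in> borel_measurable \<nu>"
      using measurable_coordinate[OF that] by (simp cong: measurable_cong_sets add: sets_config_law)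
  qed
  have m[measurable]: "(\<lambda>p. E N (move s i j (fst p)) (snd p)) \<in> borel_measurable (lborel \<Otimes>\<^sub>M \<nu>)"
    unfolding E_def move_def fun_upd_apply
  proof (intro borel_measurable_prod measurable_compose[OF _ q_measurable] borel_measurable_times c)
    show "(\<lambda>p. if k = i then s i + fst p * (s j - s i) else s k) \<in> borel_measurable (lborel \<Otimes>\<^sub>M \<nu>)" for k
      by (cases "k = i") simp_all
  qed
  have m'[measurable]: "(\<lambda>p. E N s (snd p)) \<in> borel_measurable (lborel \<Otimes>\<^sub>M \<nu>)"
    unfolding E_def
    by (intro borel_measurable_prod measurable_compose[OF _ q_measurable] borel_measurable_times c) simp
  show "(\<lambda>(u, x). indicator {0<..<1} u *\<^sub>R ((E N (move s i j u) x - E N s x) / u))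
    \<in> borel_measurable (lborel \<Otimes>\<^sub>M \<nu>)"
    unfolding case_prod_unfold
    by (intro borel_measurable_scaleR borel_measurable_divide borel_measurable_diff m m') simp_all
  show "{0<..<1::real} \<times> space \<nu> \<in> sets (lborel \<Otimes>\<^sub>M \<nu>)"
    by (rule pair_measureI) auto
  show "emeasure (lborel \<Otimes>\<^sub>M \<nu>) ({0<..<1::real} \<times> space \<nu>) < \<infinity>"
    by (subst emeasure_pair_measure_Times) (auto simp: emeasure_space_1)
  show "AE p in lborel \<Otimes>\<^sub>M \<nu>. p \<in> {0<..<1} \<times> space \<nu> \<longrightarrow>
     norm (case p of (u, x) \<Rightarrow> indicator {0<..<1} u *\<^sub>R ((E N (move s i j u) x - E N s x) / u))
       \<le> 2 + 2 * \<bar>s j - s i\<bar> / s i"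
  proof (intro AE_I2 impI)
    fix p assume "p \<in> {0<..<1::real} \<times> space \<nu>"
    then obtain u x where p: "p = (u, x)" and u: "0 < u" "u < 1" and x: "x \<in> orthant N"
      by (auto simp: space_config_law)
    have "\<bar>E N (move s i j u) x - E N s x\<bar> / u \<le> 2 + 2 * \<bar>s j - s i\<bar> / s i"
      using E_move_diff[OF s i x, of u j] u by (subst pos_divide_le_eq) auto
    then show "norm (case p of (u, x) \<Rightarrow> indicator {0<..<1} u *\<^sub>R ((E N (move s i j u) x - E N s x) / u))
       \<le> 2 + 2 * \<bar>s j - s i\<bar> / s i"
      unfolding p using u by simp
  qed
  show "AE p in lborel \<Otimes>\<^sub>M \<nu>. p \<notin> {0<..<1} \<times> space \<nu> \<longrightarrow>
    (case p of (u, x) \<Rightarrow> indicator {0<..<1} u *\<^sub>R ((E N (move s i j u) x - E N s x) / u)) = 0"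
    by (rule AE_I2) (auto simp: space_pair_measure split: split_indicator_asm)
qed

lemma dual_integrable:
  assumes s: "s \<in> params N" and i: "i \<in> {1..N}"
  shows "set_integrable lborel {0<..<1} (\<lambda>u. (avg N \<nu> (move s i j u) - avg N \<nu> s) / u)"
    and "integrable \<nu> (\<lambda>x. dual_term (\<lambda>s. E N s x) s i j)"
    and "(\<integral>x. dual_term (\<lambda>s. E N s x) s i j \<partial>\<nu>) = dual_term (avg N \<nu>) s i j"
proof -
  interpret prob_space \<nu> by (rule prob_space_config_law)
  interpret pair_sigma_finite lborel \<nu> ..
  let ?h = "\<lambda>u x. indicator {0<..<1} u *\<^sub>R ((E N (move s i j u) x - E N s x) / u)"
  have int: "integrable (lborel \<Otimes>\<^sub>M \<nu>) (case_prod ?h)" by (rule E_dual_integrable_pair[OF s i])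
  have eq: "(\<integral>x. ?h u x \<partial>\<nu>) = indicator {0<..<1} u *\<^sub>R ((avg N \<nu> (move s i j u) - avg N \<nu> s) / u)" for u
  proof (cases "u \<in> {0<..<1}")
    case True
    then have "integrable \<nu> (E N (move s i j u))" by (intro E_integrable move_params s i) auto
    then show ?thesis using E_integrable[OF s] True by (simp add: avg_def)
  qed simp
  show "set_integrable lborel {0<..<1} (\<lambda>u. (avg N \<nu> (move s i j u) - avg N \<nu> s) / u)"
    unfolding set_integrable_def eq[symmetric] using integrable_fst'[OF int] by simp
  show "integrable \<nu> (\<lambda>x. dual_term (\<lambda>s. E N s x) s i j)"
    unfolding dual_term_def set_lebesgue_integral_def using integrable_snd[OF int] by simp
  have "(\<integral>x. dual_term (\<lambda>s. E N s x) s i j \<partial>\<nu>) = (\<integral>x. (\<integral>u. ?h u x \<partial>lborel) \<partial>\<nu>)"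
    by (simp only: dual_term_def set_lebesgue_integral_def)
  also have "\<dots> = (\<integral>u. (\<integral>x. ?h u x \<partial>\<nu>) \<partial>lborel)" by (rule Fubini_integral[OF int])
  also have "\<dots> = dual_term (avg N \<nu>) s i j"
    by (simp only: dual_term_def set_lebesgue_integral_def eq)
  finally show "(\<integral>x. dual_term (\<lambda>s. E N s x) s i j \<partial>\<nu>) = dual_term (avg N \<nu>) s i j" .
qed

lemma integral_dual_op:
  assumes s: "s \<in> params N"
  shows "(\<integral>x. dual_op N (\<lambda>s. E N s x) s \<partial>\<nu>) = dual_op N (avg N \<nu>) s"
    and "integrable \<nu> (\<lambda>x. dual_op N (\<lambda>s. E N s x) s)"
proof -
  let ?d = "\<lambda>i x. dual_term (\<lambda>s. E N s x) s i (i - 1) + dual_term (\<lambda>s. E N s x) s i (i + 1)"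
  have int: "integrable \<nu> (?d i)" if "i \<in> {1..N}" for i
    by (intro Bochner_Integration.integrable_add dual_integrable(2)[OF s that])
  have "(\<integral>x. ?d i x \<partial>\<nu>) = dual_term (avg N \<nu>) s i (i - 1) + dual_term (avg N \<nu>) s i (i + 1)"
    if "i \<in> {1..N}" for i
    using Bochner_Integration.integral_add[OF dual_integrable(2)[OF s that] dual_integrable(2)[OF s that]]
    by (simp only: dual_integrable(3)[OF s that])
  then show "(\<integral>x. dual_op N (\<lambda>s. E N s x) s \<partial>\<nu>) = dual_op N (avg N \<nu>) s"
    unfolding dual_op_def by (subst Bochner_Integration.integral_sum[OF int]) (auto intro: sum.cong)
  show "integrable \<nu> (\<lambda>x. dual_op N (\<lambda>s. E N s x) s)"
    unfolding dual_op_def by (rule Bochner_Integration.integrable_sum[OF int])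
qed

text \<open>Replaces the value at \<open>s = 0\<close>, which is not an element of
  \<open>params N\<close>. Averages decrease in every parameter, and along the constant parameters
  \<open>1 / (n + 1)\<close> they tend to 1 by dominated convergence; a parameter with small sum
  lies below such a constant one.\<close>

lemma avg_near_zero:
  assumes e: "0 < e"
  shows "\<exists>\<rho>>0. \<forall>s\<in>params N. (\<Sum>i\<in>{1..N}. s i) < \<rho> \<longrightarrow> 1 - avg N \<nu> s < e"
proof -
  interpret prob_space \<nu> by (rule prob_space_config_law)
  define r where "r n i = (if i \<in> {1..N} then inverse (real (Suc n)) else 0)" for n i
  have r: "r n \<in> params N" for n by (auto simp: params_def r_def)
  have [measurable_cong]: "sets \<nu> = sets (config_space N)" by (rule sets_config_law)
  have "(\<lambda>n. avg N \<nu> (r n)) \<longlonglongrightarrow> (\<integral>x. 1 \<partial>\<nu>)"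
    unfolding avg_def
  proof (rule integral_dominated_convergence[where w="\<lambda>_. 1"])
    show "AE x in \<nu>. (\<lambda>n. E N (r n) x) \<longlonglongrightarrow> 1"
    proof (rule AE_I2)
      fix x assume x: "x \<in> space \<nu>"
      have q: "(\<lambda>n. q (r n i * x i)) \<longlonglongrightarrow> 1" if i: "i \<in> {1..N}" for i
      proof -
        have xi: "0 \<le> x i" using config_nonneg x i space_config_law by auto
        have l: "(\<lambda>n. r n i * x i) \<longlonglongrightarrow> 0"
          using tendsto_mult_right[OF LIMSEQ_inverse_real_of_nat, of "x i"] i by (simp add: r_def)
        have "(\<lambda>n. q (r n i * x i) - 1) \<longlonglongrightarrow> 0"
        proof (rule tendsto_rabs_zero_cancel, rule tendsto_sandwich[OF _ _ tendsto_const l])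
          show "\<forall>\<^sub>F n in sequentially. \<bar>q (r n i * x i) - 1\<bar> \<le> r n i * x i"
            using q_abs_diff[of _ 0] xi by (auto simp: q_zero r_def intro!: always_eventually)
        qed simp
        then show ?thesis by (simp add: LIM_zero_iff)
      qed
      show "(\<lambda>n. E N (r n) x) \<longlonglongrightarrow> 1"
        using tendsto_prod[of "{1..N}", OF q] by (simp add: E_def)
    qed
    show "AE x in \<nu>. norm (E N (r n) x) \<le> 1" for n
      using E_params[OF _ r] by (intro AE_I2) (auto simp: space_config_law)
  qed auto
  then have "(\<lambda>n. 1 - avg N \<nu> (r n)) \<longlonglongrightarrow> 0"
    using tendsto_diff[OF tendsto_const, of "\<lambda>n. avg N \<nu> (r n)" 1 sequentially 1] by (simp add: prob_space)
  then have "\<forall>\<^sub>F n in sequentially. 1 - avg N \<nu> (r n) < e" using e by (rule order_tendstoD)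
  then obtain n where n: "1 - avg N \<nu> (r n) < e" by (auto simp: eventually_sequentially)
  show ?thesis
  proof (intro exI[of _ "inverse (real (Suc n))"] conjI ballI impI)
    fix s assume s: "s \<in> params N" and lt: "(\<Sum>i\<in>{1..N}. s i) < inverse (real (Suc n))"
    have "avg N \<nu> (r n) \<le> avg N \<nu> s"
      unfolding avg_def
    proof (rule integral_mono[OF E_integrable[OF r] E_integrable[OF s]])
      fix x assume "x \<in> space \<nu>"
      then have x: "0 \<le> x i" if "i \<in> {1..N}" for i using config_nonneg that space_config_law by auto
      have "s i \<le> r n i" if "i \<in> {1..N}" for i
        using params_le_sum[OF s, of i] lt that by (simp add: r_def)
      then show "E N (r n) x \<le> E N s x"
        unfolding E_def using x params_nonneg[OF s] params_nonneg[OF r]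
        by (intro prod_mono conjI q_antimono less_imp_le[OF q_pos] mult_right_mono mult_nonneg_nonneg) auto
    qed
    then show "1 - avg N \<nu> s < e" using n by simp
  qed simp
qed

lemma avg_continuous: "continuous_on (params N) (avg N \<nu>)"
  unfolding continuous_on_def
proof
  fix s assume s: "s \<in> params N"
  let ?w = "\<lambda>t. \<Sum>i\<in>{1..N}. \<bar>t i - s i\<bar> / min (t i) (s i)"
  have "continuous_on (params N) ?w" by (rule continuous_on_relative_distance[OF s])
  then have "(?w \<longlongrightarrow> ?w s) (at s within params N)"
    by (rule continuous_on_def[THEN iffD1, THEN bspec, OF _ s])
  moreover have "?w s = 0" by simp
  ultimately have w: "(?w \<longlongrightarrow> 0) (at s within params N)" by (simp only:)
  have le: "\<bar>avg N \<nu> t - avg N \<nu> s\<bar> \<le> ?w t" if t: "t \<in> params N" for t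
    by (rule avg_diff_bound[OF t s]) (rule E_param_diff[OF t s])
  have "((\<lambda>t. avg N \<nu> t - avg N \<nu> s) \<longlongrightarrow> 0) (at s within params N)"
  proof (rule Lim_null_comparison[OF _ w])
    show "\<forall>\<^sub>F t in at s within params N. norm (avg N \<nu> t - avg N \<nu> s) \<le> ?w t"
      unfolding eventually_at_filter real_norm_def using le by (intro always_eventually) blast
  qed
  then show "(avg N \<nu> \<longlongrightarrow> avg N \<nu> s) (at s within params N)" by (simp add: LIM_zero_iff)
qed

end

lemma avg_unique:
  assumes N: "N \<ge> 1"
    and \<nu>: "\<nu> \<in> laws N" "\<mu> \<in> laws N"
    and V: "\<And>s. s \<in> params N \<Longrightarrow> 0 \<le> V s"
    and eq: "\<And>s. s \<in> params N \<Longrightarrow> dual_op N (avg N \<nu>) s = V s * avg N \<nu> s"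
      "\<And>s. s \<in> params N \<Longrightarrow> dual_op N (avg N \<mu>) s = V s * avg N \<mu> s"
    and s: "s \<in> params N"
  shows "avg N \<nu> s \<le> avg N \<mu> s"
proof -
  let ?\<psi> = "\<lambda>s. avg N \<nu> s - avg N \<mu> s"
  have d: "(\<lambda>u. (?\<psi> (move s i j u) - ?\<psi> s) / u)
    = (\<lambda>u. (avg N \<nu> (move s i j u) - avg N \<nu> s) / u - (avg N \<mu> (move s i j u) - avg N \<mu> s) / u)" for s i j
    by (auto simp: diff_divide_distrib)
  note int = dual_integrable(1)[OF \<nu>(1)] dual_integrable(1)[OF \<nu>(2)]
  have "?\<psi> s \<le> 0"
  proof (rule elliptic_max_principle[OF N _ _ V _ _ _ s])
    show "continuous_on (params N) ?\<psi>" by (intro continuous_intros avg_continuous \<nu>)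
    show "?\<psi> s \<le> 1" if "s \<in> params N" for s
      using avg_bounds[OF \<nu>(1) that] avg_bounds[OF \<nu>(2) that] by simp
    show "set_integrable lborel {0<..<1} (\<lambda>u. (?\<psi> (move s i j u) - ?\<psi> s) / u)"
      if "s \<in> params N" "i \<in> {1..N}" for s i j
      unfolding d by (intro set_integral_diff int that)
    show "dual_op N ?\<psi> s = V s * ?\<psi> s" if s: "s \<in> params N" for s
    proof -
      have "dual_op N ?\<psi> s = dual_op N (avg N \<nu>) s - dual_op N (avg N \<mu>) s"
        unfolding dual_op_def dual_term_def d sum_subtractf[symmetric]
        by (intro sum.cong refl) (simp add: set_integral_diff(2)[OF int(1)[OF s] int(2)[OF s]])
      then show ?thesis using eq s by (simp add: algebra_simps)
    qed
    \<comment> \<open>The first average is at most 1 and the second one is close to 1, so their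
      difference is small from above.\<close>
    show "\<exists>\<rho>>0. \<forall>s\<in>params N. (\<Sum>i\<in>{1..N}. s i) < \<rho> \<longrightarrow> ?\<psi> s < e" if "0 < e" for e
      using avg_near_zero[OF \<nu>(2) that] avg_bounds(2)[OF \<nu>(1)] by (smt (verit, best))
  qed
  then show ?thesis by simp
qed

end

section \<open>Invariant measures and the dual equation\<close>

context
  fixes M :: "'a::topological_space measure" and P :: "real \<Rightarrow> 'a \<Rightarrow> 'a measure"
  assumes feller: "feller_semigroup M P"
begin

lemma feller_kernel: "0 \<le> t \<Longrightarrow> P t \<in> M \<rightarrow>\<^sub>M prob_algebra M"
  using feller by (auto simp: feller_semigroup_def)

lemma bind_prob_algebra:
  assumes "\<nu> \<in> space (prob_algebra M)" "0 \<le> t"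
  shows "Giry_Monad.bind \<nu> (P t) \<in> space (prob_algebra M)"
  using prob_space_bind'[OF assms(1) feller_kernel[OF assms(2)]]
    sets_bind'[OF assms(1) feller_kernel[OF assms(2)]]
  by (simp add: space_prob_algebra)

lemma bind_semigroup:
  assumes \<nu>: "\<nu> \<in> space (prob_algebra M)" and st: "0 \<le> s" "0 \<le> t"
  shows "Giry_Monad.bind \<nu> (P (s + t)) = Giry_Monad.bind (Giry_Monad.bind \<nu> (P s)) (P t)"
proof -
  have sets: "sets \<nu> = sets M" using \<nu> by (simp add: space_prob_algebra)
  have "Giry_Monad.bind \<nu> (P (s + t)) = Giry_Monad.bind \<nu> (\<lambda>x. Giry_Monad.bind (P s x) (P t))"
    by (rule bind_cong[OF refl])
      (use feller st sets_eq_imp_space_eq[OF sets] in \<open>auto simp: feller_semigroup_def\<close>)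
  also have "\<dots> = Giry_Monad.bind (Giry_Monad.bind \<nu> (P s)) (P t)"
    by (rule bind_assoc[symmetric, where N=M and R=M])
      (use measurable_prob_algebraD[OF feller_kernel] st sets in \<open>auto cong: measurable_cong_sets\<close>)
  finally show ?thesis .
qed

lemma bind_0:
  assumes \<nu>: "\<nu> \<in> space (prob_algebra M)"
  shows "Giry_Monad.bind \<nu> (P 0) = \<nu>"
proof -
  have sets: "sets \<nu> = sets M" using \<nu> by (simp add: space_prob_algebra)
  have "Giry_Monad.bind \<nu> (P 0) = Giry_Monad.bind \<nu> (return M)"
    by (rule bind_cong[OF refl])
      (use feller sets_eq_imp_space_eq[OF sets] in \<open>auto simp: feller_semigroup_def\<close>)
  also have "\<dots> = \<nu>" by (rule bind_return''[OF sets])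
  finally show ?thesis .
qed

lemma semigroup_op_props:
  assumes f: "f \<in> borel_measurable M" "\<And>x. x \<in> space M \<Longrightarrow> \<bar>f x\<bar> \<le> B" and t: "0 \<le> t"
  shows "semigroup_op P t f \<in> borel_measurable M"
    and "x \<in> space M \<Longrightarrow> \<bar>semigroup_op P t f x\<bar> \<le> B"
    and "\<nu> \<in> space (prob_algebra M) \<Longrightarrow>
      (\<integral>x. f x \<partial>(Giry_Monad.bind \<nu> (P t))) = (\<integral>x. semigroup_op P t f x \<partial>\<nu>)"
proof -
  show "semigroup_op P t f \<in> borel_measurable M"
    unfolding semigroup_op_def[abs_def]
    by (rule measurable_compose[OF measurable_prob_algebraD[OF feller_kernel[OF t]]
       integral_measurable_subprob_algebra[OF f(1)]])
  show "\<bar>semigroup_op P t f x\<bar> \<le> B" if x: "x \<in> space M"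
  proof -
    have P: "prob_space (P t x)" "sets (P t x) = sets M"
      using measurable_space[OF feller_kernel[OF t] x] by (auto simp: space_prob_algebra)
    interpret prob_space "P t x" by (rule P)
    have sp: "space (P t x) = space M" by (rule sets_eq_imp_space_eq[OF P(2)])
    have "integrable (P t x) f"
      by (rule integrable_const_bound[of _ B]) (use f P sp in \<open>auto cong: measurable_cong_sets\<close>)
    then show ?thesis unfolding semigroup_op_def
      by (intro abs_leI) (use f(2) sp in \<open>auto intro!: integral_le_const integral_ge_const simp: minus_le_iff abs_le_iff\<close>)
  qed
  show "(\<integral>x. f x \<partial>(Giry_Monad.bind \<nu> (P t))) = (\<integral>x. semigroup_op P t f x \<partial>\<nu>)"
    if \<nu>: "\<nu> \<in> space (prob_algebra M)"
    unfolding semigroup_op_def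
    by (rule integral_bind_bounded(2)[OF _ _ f])
      (use \<nu> feller_kernel[OF t] in \<open>auto simp: space_prob_algebra cong: measurable_cong_sets\<close>)
qed

lemma strongly_continuous:
  assumes f: "f \<in> C0 (space M)" and e: "0 < e"
  shows "\<exists>d>0. \<forall>h. 0 < h \<and> h < d \<longrightarrow> (\<forall>x\<in>space M. \<bar>semigroup_op P h f x - f x\<bar> \<le> e)"
proof -
  have "uniform_limit (space M) (\<lambda>t. semigroup_op P t f) f (at_right 0)"
    using feller f by (simp add: feller_semigroup_def)
  then have "\<forall>\<^sub>F t in at_right 0. \<forall>x\<in>space M. dist (semigroup_op P t f x) (f x) < e"
    using e by (rule uniform_limitD)
  then obtain d where d: "d > 0" "\<And>h. 0 < h \<Longrightarrow> h < d \<Longrightarrow> \<forall>x\<in>space M. \<bar>semigroup_op P h f x - f x\<bar> < e"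
    by (auto simp: eventually_at_right_field dist_real_def)
  then show ?thesis by (intro exI[of _ d]) (auto intro: less_imp_le)
qed

lemma generator_step:
  assumes fg: "generator_graph M P f g" and e: "0 < e"
  shows "\<exists>d>0. \<forall>h. 0 < h \<and> h < d \<longrightarrow>
    (\<forall>x\<in>space M. \<bar>semigroup_op P h f x - f x - h * g x\<bar> \<le> e * h)"
proof -
  have "uniform_limit (space M) (\<lambda>t x. (semigroup_op P t f x - f x) / t) g (at_right 0)"
    using fg by (simp add: generator_graph_def)
  then have "\<forall>\<^sub>F t in at_right 0. \<forall>x\<in>space M. dist ((semigroup_op P t f x - f x) / t) (g x) < e"
    using e by (rule uniform_limitD)
  then obtain d where d: "d > 0" "\<And>h. 0 < h \<Longrightarrow> h < d \<Longrightarrow>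
      \<forall>x\<in>space M. \<bar>(semigroup_op P h f x - f x) / h - g x\<bar> < e"
    by (auto simp: eventually_at_right_field dist_real_def)
  show ?thesis
  proof (intro exI[of _ d] conjI allI impI ballI)
    fix h x assume h: "0 < h \<and> h < d" and x: "x \<in> space M"
    have "semigroup_op P h f x - f x - h * g x = h * ((semigroup_op P h f x - f x) / h - g x)"
      using h by (simp add: field_simps)
    then have "\<bar>semigroup_op P h f x - f x - h * g x\<bar> = h * \<bar>(semigroup_op P h f x - f x) / h - g x\<bar>"
      using h by (simp add: abs_mult)
    also have "\<dots> \<le> h * e" using d(2)[of h] h x by (intro mult_left_mono) (auto simp: less_imp_le)
    finally show "\<bar>semigroup_op P h f x - f x - h * g x\<bar> \<le> e * h" by (simp add: mult.commute)
  qed (rule d)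
qed

text \<open>Membership of \<open>g\<close> in \<open>C0\<close> speaks about the topology.
  Measurability and a bound are read off from the difference quotients at times
  \<open>1 / (n + 1)\<close>, which are measurable and bounded and converge to \<open>g\<close>
  uniformly.\<close>

lemma generator_image_measurable_bounded:
  assumes fg: "generator_graph M P f g" and f: "f \<in> borel_measurable M" "\<And>x. x \<in> space M \<Longrightarrow> \<bar>f x\<bar> \<le> B"
  shows "g \<in> borel_measurable M" "\<exists>B. \<forall>x\<in>space M. \<bar>g x\<bar> \<le> B"
proof -
  note sm = semigroup_op_props[OF f]
  define F where "F n x = (semigroup_op P (inverse (real (Suc n))) f x - f x) / inverse (real (Suc n))" for n x
  have Fm: "F n \<in> borel_measurable M" for n
    unfolding F_def by (intro borel_measurable_divide borel_measurable_diff sm f) auto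
  have "uniform_limit (space M) F g sequentially"
  proof -
    have l: "filterlim (\<lambda>n. inverse (real (Suc n))) (at_right 0) sequentially"
      using LIMSEQ_inverse_real_of_nat by (auto simp: filterlim_at)
    have "uniform_limit (space M) (\<lambda>t x. (semigroup_op P t f x - f x) / t) g (at_right 0)"
      using fg by (simp add: generator_graph_def)
    from filterlim_compose[OF this l] show ?thesis unfolding F_def[abs_def] .
  qed
  note F = this
  have "(\<lambda>n. F n x) \<longlonglongrightarrow> g x" if "x \<in> space M" for x
    using tendsto_uniform_limitI[OF F that] .
  then show "g \<in> borel_measurable M" by (rule borel_measurable_LIMSEQ_real[OF _ Fm])
  obtain n where n: "\<forall>x\<in>space M. dist (F n x) (g x) < 1"
    using uniform_limitD[OF F, of 1] by (auto simp: eventually_sequentially)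
  have "\<bar>g x\<bar> \<le> 2 * B * real (Suc n) + 1" if x: "x \<in> space M" for x
  proof -
    have "\<bar>F n x\<bar> = \<bar>semigroup_op P (inverse (real (Suc n))) f x - f x\<bar> * real (Suc n)"
      by (simp add: F_def divide_inverse abs_mult)
    also have "\<dots> \<le> (2 * B) * real (Suc n)"
      using sm(2)[OF _ _ x, of "inverse (real (Suc n))"] f(2)[OF x] by (intro mult_right_mono) auto
    finally show ?thesis using n x by (force simp: dist_real_def)
  qed
  then show "\<exists>B. \<forall>x\<in>space M. \<bar>g x\<bar> \<le> B" by blast
qed

end

text \<open>Continuity in \<open>t\<close> for fixed \<open>s\<close>, together with a modulus in
  \<open>s\<close> that does not depend on \<open>t\<close>, gives continuity along every convergent
  sequence of pairs.\<close>

lemma joint_continuity: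
  fixes f :: "real \<Rightarrow> 'b::metric_space \<Rightarrow> real"
  assumes t: "\<And>s. s \<in> B \<Longrightarrow> continuous_on A (\<lambda>t. f t s)"
    and w: "\<And>s. s \<in> B \<Longrightarrow> continuous_on B (w s)" "\<And>s. w s s = 0"
    and le: "\<And>t s s'. t \<in> A \<Longrightarrow> s \<in> B \<Longrightarrow> s' \<in> B \<Longrightarrow> \<bar>f t s' - f t s\<bar> \<le> w s s'"
  shows "continuous_on (A \<times> B) (\<lambda>(t, s). f t s)"
  unfolding continuous_on_sequentially
proof (intro allI ballI impI, elim conjE)
  fix x :: "nat \<Rightarrow> real \<times> 'b" and a
  assume a: "a \<in> A \<times> B" and x: "\<forall>n. x n \<in> A \<times> B" and lim: "x \<longlonglongrightarrow> a"
  obtain t0 s0 where a': "a = (t0, s0)" "t0 \<in> A" "s0 \<in> B" using a by auto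
  have l1: "(\<lambda>n. fst (x n)) \<longlonglongrightarrow> t0" and l2: "(\<lambda>n. snd (x n)) \<longlonglongrightarrow> s0"
    using tendsto_fst[OF lim] tendsto_snd[OF lim] a' by auto
  have x': "fst (x n) \<in> A" "snd (x n) \<in> B" for n using x by (auto simp: mem_Times_iff)
  have "(\<lambda>n. f (fst (x n)) s0) \<longlonglongrightarrow> f t0 s0"
    by (rule continuous_on_tendsto_compose[OF t[OF a'(3)] l1 a'(2)]) (use x' in auto)
  moreover have "(\<lambda>n. f (fst (x n)) (snd (x n)) - f (fst (x n)) s0) \<longlonglongrightarrow> 0"
  proof (rule Lim_null_comparison)
    show "\<forall>\<^sub>F n in sequentially. norm (f (fst (x n)) (snd (x n)) - f (fst (x n)) s0) \<le> w s0 (snd (x n))"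
      unfolding real_norm_def by (rule always_eventually, rule allI, rule le[OF x'(1) a'(3) x'(2)])
    show "(\<lambda>n. w s0 (snd (x n))) \<longlonglongrightarrow> 0"
      using continuous_on_tendsto_compose[OF w(1)[OF a'(3)] l2 a'(3)] x' w(2) by simp
  qed
  ultimately have "(\<lambda>n. f (fst (x n)) s0 + (f (fst (x n)) (snd (x n)) - f (fst (x n)) s0)) \<longlonglongrightarrow> f t0 s0 + 0"
    by (rule tendsto_add)
  then show "((\<lambda>(t, s). f t s) \<circ> x) \<longlonglongrightarrow> (\<lambda>(t, s). f t s) a"
    by (simp add: a' o_def case_prod_unfold)
qed

section \<open>Evolution of the averages along the semigroup\<close>

context profile begin

context
  fixes N :: nat and P V
  assumes N: "N \<ge> 1"
    and F: "feller_semigroup (config_space N) P"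
    and V: "\<And>s. s \<in> params N \<Longrightarrow> 0 \<le> V s"
    and G: "\<And>s. s \<in> params N \<Longrightarrow> generator_graph (config_space N) P (E N s)
      (\<lambda>x. dual_op N (\<lambda>s. E N s x) s - V s * E N s x)"
begin

abbreviation LE :: "(nat \<Rightarrow> real) \<Rightarrow> (nat \<Rightarrow> real) \<Rightarrow> real" where
  "LE s x \<equiv> dual_op N (\<lambda>s. E N s x) s - V s * E N s x"

abbreviation law :: "(nat \<Rightarrow> real) measure \<Rightarrow> real \<Rightarrow> (nat \<Rightarrow> real) measure" where
  "law \<nu> t \<equiv> Giry_Monad.bind \<nu> (P t)"

lemma E_abs_le: "s \<in> params N \<Longrightarrow> x \<in> orthant N \<Longrightarrow> \<bar>E N s x\<bar> \<le> 1"
  using E_params[of x N s] by auto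

lemma LE_measurable_bounded:
  assumes "s \<in> params N"
  shows "LE s \<in> borel_measurable (config_space N)" "\<exists>B. \<forall>x\<in>orthant N. \<bar>LE s x\<bar> \<le> B"
  using generator_image_measurable_bounded[OF F G[OF assms] E_measurable E_abs_le[OF assms]] by auto

lemma integral_LE:
  assumes "s \<in> params N" "\<nu> \<in> laws N"
  shows "(\<integral>x. LE s x \<partial>\<nu>) = dual_op N (avg N \<nu>) s - V s * avg N \<nu> s"
  using integral_dual_op[OF assms(2,1)] E_integrable[OF assms(2,1)] by (simp add: avg_def)

lemma avg_law:
  assumes "s \<in> params N" "\<nu> \<in> laws N" "0 \<le> t"
  shows "avg N (law \<nu> t) s = (\<integral>x. semigroup_op P t (E N s) x \<partial>\<nu>)"
  unfolding avg_def by (rule semigroup_op_props(3)[OF F E_measurable E_abs_le[OF assms(1)] assms(3,2)])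

lemma semigroup_E_integrable:
  assumes "s \<in> params N" "\<nu> \<in> laws N" "0 \<le> t"
  shows "integrable \<nu> (semigroup_op P t (E N s))"
  by (rule integrable_bounded_config[OF assms(2)])
    (rule semigroup_op_props[OF F E_measurable E_abs_le[OF assms(1)] assms(3)], assumption+)+

text \<open>The step size \<open>d\<close> is chosen before the law, because the generator is a
  limit that is uniform in the configuration. Hence the expansion can start from a law that itself
  varies with \<open>h\<close>, as needed for increments from the past.\<close>

lemma avg_law_step:
  assumes s: "s \<in> params N" and e: "0 < e"
  shows "\<exists>d>0. \<forall>h \<nu>. 0 < h \<and> h < d \<and> \<nu> \<in> laws N \<longrightarrow>
    \<bar>avg N (law \<nu> h) s - avg N \<nu> s - h * (\<integral>x. LE s x \<partial>\<nu>)\<bar> \<le> e * h"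
proof -
  obtain d where d: "d > 0" "\<And>h x. 0 < h \<Longrightarrow> h < d \<Longrightarrow> x \<in> orthant N \<Longrightarrow>
     \<bar>semigroup_op P h (E N s) x - E N s x - h * LE s x\<bar> \<le> e * h"
    using generator_step[OF F G[OF s] e] by blast
  show ?thesis
  proof (intro exI[of _ d] conjI allI impI)
    fix h \<nu> assume h': "0 < h \<and> h < d \<and> \<nu> \<in> laws N"
    then have h: "0 < h" "h < d" "0 \<le> h" and \<nu>: "\<nu> \<in> laws N" by auto
    obtain B where "\<And>x. x \<in> orthant N \<Longrightarrow> \<bar>LE s x\<bar> \<le> B"
      using LE_measurable_bounded(2)[OF s] by blast
    then have i: "integrable \<nu> (LE s)"
      by (rule integrable_bounded_config[OF \<nu> LE_measurable_bounded(1)[OF s]])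
    note j = semigroup_E_integrable[OF s \<nu> h(3)] E_integrable[OF \<nu> s]
    have "avg N (law \<nu> h) s - avg N \<nu> s - h * (\<integral>x. LE s x \<partial>\<nu>)
       = (\<integral>x. semigroup_op P h (E N s) x \<partial>\<nu>) - (\<integral>x. E N s x \<partial>\<nu>) - (\<integral>x. h * LE s x \<partial>\<nu>)"
      unfolding avg_law[OF s \<nu> h(3)] by (simp only: avg_def integral_mult_right_zero)
    also have "\<dots> = (\<integral>x. semigroup_op P h (E N s) x - E N s x - h * LE s x \<partial>\<nu>)"
      using i j by (simp only: Bochner_Integration.integral_diff Bochner_Integration.integrable_diff integrable_mult_right)
    also have "\<bar>\<dots>\<bar> \<le> e * h"
    proof (rule integral_abs_le_config[OF \<nu>])
      show "(\<lambda>x. semigroup_op P h (E N s) x - E N s x - h * LE s x) \<in> borel_measurable (config_space N)"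
        by (intro borel_measurable_diff borel_measurable_times borel_measurable_const
            LE_measurable_bounded(1)[OF s] E_measurable
            semigroup_op_props(1)[OF F E_measurable E_abs_le[OF s] h(3)])
    qed (use d h in auto)
    finally show "\<bar>avg N (law \<nu> h) s - avg N \<nu> s - h * (\<integral>x. LE s x \<partial>\<nu>)\<bar> \<le> e * h" .
  qed (rule d)
qed

text \<open>Strong continuity integrated against a law, again with \<open>d\<close> independent of
  the law.\<close>

lemma integral_law_near:
  assumes f: "f \<in> C0 (orthant N)" "f \<in> borel_measurable (config_space N)"
      "\<And>x. x \<in> orthant N \<Longrightarrow> \<bar>f x\<bar> \<le> B" and e: "0 < e"
  shows "\<exists>d>0. \<forall>h \<nu>. 0 < h \<and> h < d \<and> \<nu> \<in> laws N \<longrightarrow>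
    \<bar>(\<integral>x. f x \<partial>(law \<nu> h)) - (\<integral>x. f x \<partial>\<nu>)\<bar> \<le> e"
proof -
  obtain d where d: "d > 0" "\<And>h x. 0 < h \<Longrightarrow> h < d \<Longrightarrow> x \<in> orthant N \<Longrightarrow>
     \<bar>semigroup_op P h f x - f x\<bar> \<le> e"
    using strongly_continuous[OF F f(1) e] by blast
  show ?thesis
  proof (intro exI[of _ d] conjI allI impI)
    fix h \<nu> assume h': "0 < h \<and> h < d \<and> \<nu> \<in> laws N"
    then have h: "0 < h" "h < d" "0 \<le> h" and \<nu>: "\<nu> \<in> laws N" by auto
    note p = semigroup_op_props[OF F f(2,3) h(3)]
    have i: "integrable \<nu> (semigroup_op P h f)" by (rule integrable_bounded_config[OF \<nu> p(1,2)])
    have j: "integrable \<nu> f" by (rule integrable_bounded_config[OF \<nu> f(2,3)])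
    have "(\<integral>x. f x \<partial>(law \<nu> h)) - (\<integral>x. f x \<partial>\<nu>) = (\<integral>x. semigroup_op P h f x - f x \<partial>\<nu>)"
      using p(3)[OF _ \<nu>] i j by simp
    also have "\<bar>\<dots>\<bar> \<le> e"
      by (rule integral_abs_le_config[OF \<nu>]) (use d h p(1) f(2) in auto)
    finally show "\<bar>(\<integral>x. f x \<partial>(law \<nu> h)) - (\<integral>x. f x \<partial>\<nu>)\<bar> \<le> e" .
  qed (rule d)
qed

text \<open>For an invariant law the increments of the averages are zero, so the first-order
  expansion forces the integral of \<open>LE s\<close> to vanish.\<close>

lemma avg_invariant:
  assumes s: "s \<in> params N" and inv: "invariant_measure (config_space N) P \<nu>"
  shows "dual_op N (avg N \<nu>) s = V s * avg N \<nu> s"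
proof -
  have \<nu>: "\<nu> \<in> laws N" and l: "\<And>t. 0 \<le> t \<Longrightarrow> law \<nu> t = \<nu>"
    using inv by (auto simp: invariant_measure_def)
  have "\<bar>\<integral>x. LE s x \<partial>\<nu>\<bar> \<le> 0 + e" if e: "0 < e" for e
  proof -
    obtain d where d: "d > 0" "\<And>h \<nu>. 0 < h \<Longrightarrow> h < d \<Longrightarrow> \<nu> \<in> laws N \<Longrightarrow>
      \<bar>avg N (law \<nu> h) s - avg N \<nu> s - h * (\<integral>x. LE s x \<partial>\<nu>)\<bar> \<le> e * h"
      using avg_law_step[OF s e] by blast
    have "\<bar>avg N (law \<nu> (d/2)) s - avg N \<nu> s - (d/2) * (\<integral>x. LE s x \<partial>\<nu>)\<bar> \<le> e * (d/2)"
      by (rule d(2)) (use d \<nu> in auto)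
    then have "\<bar>(d/2) * (\<integral>x. LE s x \<partial>\<nu>)\<bar> \<le> e * (d/2)" using l[of "d/2"] d(1) by simp
    then have "\<bar>\<integral>x. LE s x \<partial>\<nu>\<bar> * (d/2) \<le> e * (d/2)" using d(1) by (simp add: abs_mult mult.commute)
    then show ?thesis using d(1) by simp
  qed
  then have "\<bar>\<integral>x. LE s x \<partial>\<nu>\<bar> \<le> 0" by (rule field_le_epsilon)
  then show ?thesis using integral_LE[OF s \<nu>] by simp
qed

lemma avg_law_continuous:
  assumes \<nu>: "\<nu> \<in> laws N"
  shows "continuous_on ({0..} \<times> params N) (\<lambda>(t, s). avg N (law \<nu> t) s)"
proof (rule joint_continuity[where w="\<lambda>s t. \<Sum>i\<in>{1..N}. \<bar>t i - s i\<bar> / min (t i) (s i)"])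
  note l = bind_prob_algebra[OF F \<nu>]
  fix s assume s: "s \<in> params N"
  show "continuous_on (params N) (\<lambda>t. \<Sum>i\<in>{1..N}. \<bar>t i - s i\<bar> / min (t i) (s i))"
    by (rule continuous_on_relative_distance[OF s])
  show "\<bar>avg N (law \<nu> t) s' - avg N (law \<nu> t) s\<bar> \<le> (\<Sum>i\<in>{1..N}. \<bar>s' i - s i\<bar> / min (s' i) (s i))"
    if "t \<in> {0..}" "s' \<in> params N" for t s'
    using that by (intro avg_diff_bound[OF l] E_param_diff s) auto
  show "continuous_on {0..} (\<lambda>t. avg N (law \<nu> t) s)"
    unfolding continuous_on_iff
  proof (intro ballI allI impI)
    fix t e :: real assume t: "t \<in> {0..}" and e: "0 < e"
    have "E N s \<in> C0 (orthant N)" using G[OF s] by (simp add: generator_graph_def)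
    then obtain d where d: "d > 0" "\<And>h \<nu>. 0 < h \<Longrightarrow> h < d \<Longrightarrow> \<nu> \<in> laws N \<Longrightarrow>
      \<bar>(\<integral>x. E N s x \<partial>(law \<nu> h)) - (\<integral>x. E N s x \<partial>\<nu>)\<bar> \<le> e/2"
      using integral_law_near[OF _ E_measurable E_abs_le[OF s], of "e/2"] e by (meson half_gt_zero)
    have c: "\<bar>avg N (law \<nu> b) s - avg N (law \<nu> a) s\<bar> < e" if ab: "0 \<le> a" "a < b" "b - a < d" for a b
    proof -
      have "law \<nu> b = law (law \<nu> a) (b - a)" using bind_semigroup[OF F \<nu>, of a "b - a"] ab by simp
      then show ?thesis using d(2)[of "b - a" "law \<nu> a"] l[OF ab(1)] ab e by (simp add: avg_def)
    qed
    show "\<exists>d>0. \<forall>t'\<in>{0..}. dist t' t < d \<longrightarrow> dist (avg N (law \<nu> t') s) (avg N (law \<nu> t) s) < e"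
    proof (intro exI[of _ d] conjI ballI impI)
      fix t' assume t': "t' \<in> {0..}" "dist t' t < d"
      then show "dist (avg N (law \<nu> t') s) (avg N (law \<nu> t) s) < e"
        using c[of t t'] c[of t' t] t e
        by (cases t t' rule: linorder_cases) (auto simp: dist_real_def abs_minus_commute)
    qed (rule d)
  qed
qed simp

text \<open>The semigroup is only known to be differentiable at time 0 from the right. An increment
  ending at \<open>t\<close> is therefore expanded from the law at time \<open>t - h\<close>, and
  the integral of \<open>LE s\<close> at that time is then compared with the one at
  \<open>t\<close>. Both steps rest on the uniformity in the law. The sign \<sigma> lets one proof
  give upper and lower bounds.\<close>

lemma avg_law_derivative:
  assumes \<nu>: "\<nu> \<in> laws N" and t: "0 < t" and s: "s \<in> params N"
    and \<sigma>: "\<bar>\<sigma>\<bar> = 1"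
    and c: "\<And>h. 0 < h \<Longrightarrow> h \<le> t \<Longrightarrow> c * h \<le> \<sigma> * (avg N (law \<nu> t) s - avg N (law \<nu> (t - h)) s)"
  shows "c \<le> \<sigma> * (\<integral>x. LE s x \<partial>(law \<nu> t))"
proof (rule field_le_epsilon)
  fix e :: real assume e: "0 < e"
  then have e2: "0 < e / 2" by simp
  note l = bind_prob_algebra[OF F \<nu>]
  obtain d1 where d1: "d1 > 0" "\<And>h \<nu>. 0 < h \<Longrightarrow> h < d1 \<Longrightarrow> \<nu> \<in> laws N \<Longrightarrow>
      \<bar>avg N (law \<nu> h) s - avg N \<nu> s - h * (\<integral>x. LE s x \<partial>\<nu>)\<bar> \<le> e/2 * h"
    using avg_law_step[OF s e2] by blast
  have C: "LE s \<in> C0 (orthant N)" using G[OF s] by (simp add: generator_graph_def)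
  obtain B where B: "\<And>x. x \<in> orthant N \<Longrightarrow> \<bar>LE s x\<bar> \<le> B"
    using LE_measurable_bounded(2)[OF s] by blast
  obtain d2 where d2: "d2 > 0" "\<And>h \<nu>. 0 < h \<Longrightarrow> h < d2 \<Longrightarrow> \<nu> \<in> laws N \<Longrightarrow>
      \<bar>(\<integral>x. LE s x \<partial>(law \<nu> h)) - (\<integral>x. LE s x \<partial>\<nu>)\<bar> \<le> e/2"
    using integral_law_near[OF C LE_measurable_bounded(1)[OF s] B e2] by blast
  \<comment> \<open>Within reach of both uniform estimates and not reaching back beyond time
    0.\<close>
  define h where "h = min t (min (d1/2) (d2/2))"
  have h: "0 < h" "h \<le> t" "h < d1" "h < d2" using t d1 d2 by (auto simp: h_def)
  define \<nu>' where "\<nu>' = law \<nu> (t - h)"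
  have \<nu>': "\<nu>' \<in> laws N" unfolding \<nu>'_def using h by (intro l) simp
  have lt: "law \<nu> t = law \<nu>' h" unfolding \<nu>'_def using bind_semigroup[OF F \<nu>, of "t - h" h] h by simp
  have s1: "\<sigma> = 1 \<or> \<sigma> = -1" using \<sigma> by auto
  define I where "I = (\<integral>x. LE s x \<partial>\<nu>')"
  define J where "J = (\<integral>x. LE s x \<partial>(law \<nu> t))"
  have 1: "c * h \<le> \<sigma> * (avg N (law \<nu>' h) s - avg N \<nu>' s)" using c[OF h(1,2)] lt by (simp add: \<nu>'_def)
  have 2: "\<bar>avg N (law \<nu>' h) s - avg N \<nu>' s - h * I\<bar> \<le> e/2 * h"
    unfolding I_def by (rule d1(2)[OF h(1,3) \<nu>'])
  have "c * h \<le> \<sigma> * (h * I) + e/2 * h"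
    using s1
  proof
    assume "\<sigma> = 1"
    then show ?thesis using 1 2 by (simp only: mult_1_left; linarith)
  next
    assume "\<sigma> = -1"
    then show ?thesis using 1 2 by (simp only: mult_minus1; linarith)
  qed
  also have "\<dots> = (\<sigma> * I + e/2) * h" by (simp only: algebra_simps)
  finally have 3: "c \<le> \<sigma> * I + e/2" by (rule mult_right_le_imp_le) (rule h(1))
  have 4: "\<bar>J - I\<bar> \<le> e/2" unfolding I_def J_def lt by (rule d2(2)[OF h(1,4) \<nu>'])
  have "c \<le> \<sigma> * J + e"
    using s1
  proof
    assume "\<sigma> = 1"
    then show ?thesis using 3 4 by (simp only: mult_1_left; linarith)
  next
    assume "\<sigma> = -1"
    then show ?thesis using 3 4 by (simp only: mult_minus1; linarith)
  qed
  then show "c \<le> \<sigma> * (\<integral>x. LE s x \<partial>(law \<nu> t)) + e" by (simp only: J_def)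
qed

text \<open>The deviation of the evolved averages from those of \<mu> starts at 0 and solves the
  same linear evolution equation, because \<mu> solves the stationary one. The maximum principle
  bounds it from above for both signs \<sigma>.\<close>

lemma avg_law_stationary:
  assumes \<mu>: "\<mu> \<in> laws N"
    and eq: "\<And>s. s \<in> params N \<Longrightarrow> dual_op N (avg N \<mu>) s = V s * avg N \<mu> s"
    and s0: "s0 \<in> params N" and t0: "0 \<le> t0" and \<sigma>: "\<bar>\<sigma>\<bar> = 1"
  shows "\<sigma> * (avg N (law \<mu> t0) s0 - avg N \<mu> s0) \<le> 0"
proof -
  note l = bind_prob_algebra[OF F \<mu>]
  let ?D = "\<lambda>t s. \<sigma> * (avg N (law \<mu> t) s - avg N \<mu> s)"
  have d: "(\<lambda>u. (?D t (move s i j u) - ?D t s) / u)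
    = (\<lambda>u. \<sigma> * ((avg N (law \<mu> t) (move s i j u) - avg N (law \<mu> t) s) / u - (avg N \<mu> (move s i j u) - avg N \<mu> s) / u))"
    for t s i j by (rule ext) (simp only: diff_divide_distrib[symmetric] times_divide_eq_right right_diff_distrib, simp add: algebra_simps)
  note int = dual_integrable(1)[OF l] dual_integrable(1)[OF \<mu>]
  show ?thesis
  proof (rule parabolic_max_principle[OF N, of ?D 1 V, OF _ _ V _ _ _ s0 t0])
    have c: "continuous_on ({0..} \<times> params N) (\<lambda>p. avg N \<mu> (snd p))"
      by (rule continuous_on_compose2[OF avg_continuous[OF \<mu>] continuous_on_snd[OF continuous_on_id]]) auto
    show "continuous_on ({0..} \<times> params N) (\<lambda>(t, s). ?D t s)"
      using continuous_on_mult[OF continuous_on_const continuous_on_diff[OF avg_law_continuous[OF \<mu>, unfolded case_prod_unfold] c], of \<sigma>]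
      by (simp only: case_prod_unfold)
    show "?D t s \<le> 1" if "0 \<le> t" "s \<in> params N" for t s
    proof -
      have "\<bar>?D t s\<bar> = \<bar>avg N (law \<mu> t) s - avg N \<mu> s\<bar>" using \<sigma> by (simp only: abs_mult) simp
      also have "\<dots> \<le> 1"
        using avg_bounds[OF l[OF that(1)] that(2)] avg_bounds[OF \<mu> that(2)] by linarith
      finally show ?thesis by linarith
    qed
    show "set_integrable lborel {0<..<1} (\<lambda>u. (?D t (move s i j u) - ?D t s) / u)"
      if "0 \<le> t" "s \<in> params N" "i \<in> {1..N}" for t s i j
      unfolding d
      by (rule set_integrable_mult_right, rule set_integral_diff(1)[OF int(1)[OF that] int(2)[OF that(2,3)]])
    show "?D 0 s \<le> 0" for s using bind_0[OF F \<mu>] by simp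
    show "c \<le> dual_op N (?D t) s - V s * ?D t s"
      if t: "0 < t" and s: "s \<in> params N" and c: "\<And>h. 0 < h \<Longrightarrow> h \<le> t \<Longrightarrow> c * h \<le> ?D t s - ?D (t - h) s" for t s c
    proof -
      have t': "0 \<le> t" using t by simp
      have i: "dual_term (?D t) s i j = \<sigma> * (dual_term (avg N (law \<mu> t)) s i j - dual_term (avg N \<mu>) s i j)"
        if "i \<in> {1..N}" for i j
        unfolding dual_term_def d
        by (simp only: set_integral_mult_right set_integral_diff(2)[OF int(1)[OF t' s that] int(2)[OF s that]])
      have "dual_op N (?D t) s = \<sigma> * (dual_op N (avg N (law \<mu> t)) s - dual_op N (avg N \<mu>) s)"
        unfolding dual_op_def sum_subtractf[symmetric] sum_distrib_left
        by (intro sum.cong refl) (simp only: i, simp only: algebra_simps)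
      then have "dual_op N (?D t) s = \<sigma> * (dual_op N (avg N (law \<mu> t)) s - V s * avg N \<mu> s)"
        by (simp only: eq[OF s])
      then have "dual_op N (?D t) s - V s * ?D t s = \<sigma> * (dual_op N (avg N (law \<mu> t)) s - V s * avg N (law \<mu> t) s)"
        by algebra
      then have "dual_op N (?D t) s - V s * ?D t s = \<sigma> * (\<integral>x. LE s x \<partial>(law \<mu> t))"
        by (simp only: integral_LE[OF s l[OF t']])
      moreover have "c \<le> \<sigma> * (\<integral>x. LE s x \<partial>(law \<mu> t))"
      proof (rule avg_law_derivative[OF \<mu> t s \<sigma>])
        fix h assume "0 < h" "h \<le> t"
        then have "c * h \<le> ?D t s - ?D (t - h) s" by (rule c)
        also have "\<dots> = \<sigma> * (avg N (law \<mu> t) s - avg N (law \<mu> (t - h)) s)" by algebra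
        finally show "c * h \<le> \<sigma> * (avg N (law \<mu> t) s - avg N (law \<mu> (t - h)) s)" .
      qed
      ultimately show ?thesis by (simp only:)
    qed
  qed
qed

lemma invariant_measure_iff:
  assumes \<mu>: "\<mu> \<in> laws N"
    and eq: "\<And>s. s \<in> params N \<Longrightarrow> dual_op N (avg N \<mu>) s = V s * avg N \<mu> s"
    and det: "\<And>\<nu> \<nu>'. \<nu> \<in> laws N \<Longrightarrow> \<nu>' \<in> laws N \<Longrightarrow>
      (\<And>s. s \<in> params N \<Longrightarrow> avg N \<nu> s = avg N \<nu>' s) \<Longrightarrow> \<nu> = \<nu>'"
  shows "invariant_measure (config_space N) P \<nu> \<longleftrightarrow> \<nu> = \<mu>"
proof
  assume inv: "invariant_measure (config_space N) P \<nu>"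
  then have \<nu>: "\<nu> \<in> laws N" by (simp add: invariant_measure_def)
  show "\<nu> = \<mu>"
  proof (rule det[OF \<nu> \<mu>])
    fix s assume s: "s \<in> params N"
    have "avg N \<nu> s \<le> avg N \<mu> s"
      by (rule avg_unique[OF N \<nu> \<mu>, of V]) (simp_all only: V eq avg_invariant[OF _ inv] s)
    moreover have "avg N \<mu> s \<le> avg N \<nu> s"
      by (rule avg_unique[OF N \<mu> \<nu>, of V]) (simp_all only: V eq avg_invariant[OF _ inv] s)
    ultimately show "avg N \<nu> s = avg N \<mu> s" by (rule antisym)
  qed
next
  assume \<nu>: "\<nu> = \<mu>"
  have "law \<mu> t = \<mu>" if t: "0 \<le> t" for t
  proof (rule det[OF bind_prob_algebra[OF F \<mu> t] \<mu>])
    fix s assume s: "s \<in> params N"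
    show "avg N (law \<mu> t) s = avg N \<mu> s"
      using avg_law_stationary[OF \<mu> eq s t, of 1] avg_law_stationary[OF \<mu> eq s t, of "-1"] by simp
  qed
  then show "invariant_measure (config_space N) P \<nu>" using \<mu> \<nu> by (simp add: invariant_measure_def)
qed

end

end

section \<open>Determination of a law by its averages\<close>

lemma space_nonneg_borel: "space nonneg_borel = {0..}"
  by (simp add: nonneg_borel_def space_restrict_space)

lemma measurable_nonneg_borelD:
  assumes "sets M = sets nonneg_borel" "f \<in> borel_measurable borel"
  shows "f \<in> borel_measurable M"
proof -
  have "f \<in> borel_measurable nonneg_borel"
    unfolding nonneg_borel_def using assms(2) by (rule measurable_restrict_space1)
  then show ?thesis using assms(1) by (simp cong: measurable_cong_sets)
qed

section \<open>The moment problem on the unit interval\<close>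

lemma polynomial_integral_eq:
  fixes \<alpha> \<beta> :: "'a measure" and h :: "'a \<Rightarrow> real"
  assumes int: "\<And>k. integrable \<alpha> (\<lambda>x. h x ^ k)" "\<And>k. integrable \<beta> (\<lambda>x. h x ^ k)"
    and eq: "\<And>k. (\<integral>x. h x ^ k \<partial>\<alpha>) = (\<integral>x. h x ^ k \<partial>\<beta>)"
    and p: "real_polynomial_function p"
  shows "integrable \<alpha> (\<lambda>x. p (h x))" "integrable \<beta> (\<lambda>x. p (h x))" "(\<integral>x. p (h x) \<partial>\<alpha>) = (\<integral>x. p (h x) \<partial>\<beta>)"
proof -
  obtain a n where p: "p = (\<lambda>x. \<Sum>i\<le>n. a i * x ^ i)"
    using p by (auto simp: real_polynomial_function_iff_sum)
  show "integrable \<alpha> (\<lambda>x. p (h x))" "integrable \<beta> (\<lambda>x. p (h x))"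
    unfolding p using int by auto
  show "(\<integral>x. p (h x) \<partial>\<alpha>) = (\<integral>x. p (h x) \<partial>\<beta>)"
    unfolding p using int eq by (simp add: Bochner_Integration.integral_sum)
qed

lemma continuous_integral_eq:
  fixes \<alpha> \<beta> :: "'a measure" and h :: "'a \<Rightarrow> real" and f :: "real \<Rightarrow> real"
  assumes fin: "finite_measure \<alpha>" "finite_measure \<beta>"
    and meas: "h \<in> borel_measurable \<alpha>" "h \<in> borel_measurable \<beta>"
    and range: "\<And>x. x \<in> space \<alpha> \<Longrightarrow> h x \<in> {0..1}" "\<And>x. x \<in> space \<beta> \<Longrightarrow> h x \<in> {0..1}"
    and eq: "\<And>k. (\<integral>x. h x ^ k \<partial>\<alpha>) = (\<integral>x. h x ^ k \<partial>\<beta>)"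
    and f: "continuous_on UNIV f"
  shows "(\<integral>x. f (h x) \<partial>\<alpha>) = (\<integral>x. f (h x) \<partial>\<beta>)"
proof -
  interpret a: finite_measure \<alpha> by fact
  interpret b: finite_measure \<beta> by fact
  note meas[measurable]
  have fm[measurable]: "f \<in> borel_measurable borel" by (rule borel_measurable_continuous_onI[OF f])
  have ik: "integrable \<alpha> (\<lambda>x. h x ^ k)" "integrable \<beta> (\<lambda>x. h x ^ k)" for k
    by (rule a.integrable_const_bound[of _ 1] b.integrable_const_bound[of _ 1];
        use range in \<open>force intro!: AE_I2 power_le_one simp: abs_of_nonneg\<close>)+
  have "compact (f ` {0..1})"
    by (rule compact_continuous_image[OF continuous_on_subset[OF f]]) auto
  then obtain B where B: "\<And>y. y \<in> {0..1} \<Longrightarrow> \<bar>f y\<bar> \<le> B"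
    by (metis compact_imp_bounded bounded_iff image_eqI real_norm_def)
  have fint: "integrable \<alpha> (\<lambda>x. f (h x))" "integrable \<beta> (\<lambda>x. f (h x))"
    by (rule a.integrable_const_bound[of _ B], use range B in auto) 
      (rule b.integrable_const_bound[of _ B], use range B in auto)
  let ?A = "measure \<alpha> (space \<alpha>)" and ?B = "measure \<beta> (space \<beta>)"
  have "\<bar>(\<integral>x. f (h x) \<partial>\<alpha>) - (\<integral>x. f (h x) \<partial>\<beta>)\<bar> \<le> 0 + e" if e: "0 < e" for e
  proof -
    \<comment> \<open>Weighted with the total masses, so that the two approximation errors together
      are at most \<open>e\<close>; the summand 1 keeps the denominator positive.\<close>
    define d where "d = e / (?A + ?B + 1)"
    have AB: "0 \<le> ?A" "0 \<le> ?B" by auto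
    then have pos: "0 < ?A + ?B + 1" by linarith
    then have d: "0 < d" using e unfolding d_def by (rule divide_pos_pos[rotated])
    have "d * (?A + ?B + 1) = e" using pos by (simp add: d_def)
    then have de: "d * ?A + d * ?B \<le> e" using d by (simp add: algebra_simps)
    obtain p where p: "real_polynomial_function p" "\<And>y. y \<in> {0..1} \<Longrightarrow> \<bar>f y - p y\<bar> < d"
      using Stone_Weierstrass_real_polynomial_function[of "{0..1::real}" f d]
        continuous_on_subset[OF f] d by (metis compact_Icc subset_UNIV)
    note pe = polynomial_integral_eq[OF ik eq p(1)]
    have 1: "\<bar>(\<integral>x. f (h x) \<partial>\<alpha>) - (\<integral>x. p (h x) \<partial>\<alpha>)\<bar> \<le> d * ?A"
    proof -
      have "\<bar>(\<integral>x. f (h x) - p (h x) \<partial>\<alpha>)\<bar> \<le> (\<integral>x. d \<partial>\<alpha>)"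
        by (rule order_trans[OF integral_abs_bound integral_mono])
          (use fint pe p(2)[OF range(1)] in \<open>auto intro: less_imp_le\<close>)
      then show ?thesis using fint pe by (simp add: mult.commute)
    qed
    have 2: "\<bar>(\<integral>x. f (h x) \<partial>\<beta>) - (\<integral>x. p (h x) \<partial>\<beta>)\<bar> \<le> d * ?B"
    proof -
      have "\<bar>(\<integral>x. f (h x) - p (h x) \<partial>\<beta>)\<bar> \<le> (\<integral>x. d \<partial>\<beta>)"
        by (rule order_trans[OF integral_abs_bound integral_mono])
          (use fint pe p(2)[OF range(2)] in \<open>auto intro: less_imp_le\<close>)
      then show ?thesis using fint pe by (simp add: mult.commute)
    qed
    show ?thesis using 1 2 pe(3) de by linarith
  qed
  then have "\<bar>(\<integral>x. f (h x) \<partial>\<alpha>) - (\<integral>x. f (h x) \<partial>\<beta>)\<bar> \<le> 0" by (rule field_le_epsilon)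
  then show ?thesis by simp
qed

lemma moments_determine_distr:
  fixes \<alpha> \<beta> :: "'a measure" and h :: "'a \<Rightarrow> real"
  assumes fin: "finite_measure \<alpha>" "finite_measure \<beta>"
    and meas: "h \<in> borel_measurable \<alpha>" "h \<in> borel_measurable \<beta>"
    and range: "\<And>x. x \<in> space \<alpha> \<Longrightarrow> h x \<in> {0..1}" "\<And>x. x \<in> space \<beta> \<Longrightarrow> h x \<in> {0..1}"
    and eq: "\<And>k. (\<integral>x. h x ^ k \<partial>\<alpha>) = (\<integral>x. h x ^ k \<partial>\<beta>)"
  shows "distr \<alpha> borel h = distr \<beta> borel h"
proof (rule measure_eqI_lessThan)
  interpret a: finite_measure \<alpha> by fact
  interpret b: finite_measure \<beta> by fact
  note meas[measurable]
  show "emeasure (distr \<alpha> borel h) {c<..} < \<infinity>" for c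
    using a.emeasure_finite by (simp add: emeasure_distr less_top[symmetric])
  fix c :: real
  \<comment> \<open>Continuous ramps that converge pointwise to the indicator of the open ray above
    \<open>c\<close>.\<close>
  define g where "g n y = min 1 (real n * max 0 (y - c))" for n y
  have gc: "continuous_on UNIV (g n)" for n unfolding g_def by (intro continuous_intros)
  have gm[measurable]: "g n \<in> borel_measurable borel" for n by (rule borel_measurable_continuous_onI[OF gc])
  have g01: "\<bar>g n y\<bar> \<le> 1" for n y by (auto simp: g_def)
  have glim: "(\<lambda>n. g n y) \<longlonglongrightarrow> indicator {c<..} y" for y
  proof (cases "c < y")
    case True
    then obtain n0 where n0: "1 / (y - c) < real n0" using reals_Archimedean2 by blast
    have "g n y = 1" if "n0 \<le> n" for n
    proof -
      have "1 / (y - c) \<le> real n" using n0 that by linarith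
      then have "1 \<le> real n * (y - c)" using True by (simp add: field_simps)
      then show ?thesis using True by (simp add: g_def)
    qed
    then have "\<forall>\<^sub>F n in sequentially. g n y = indicator {c<..} y"
      using True by (auto simp: eventually_sequentially)
    then show ?thesis by (rule tendsto_eventually)
  qed (auto simp: g_def)
  have lim: "(\<lambda>n. \<integral>x. g n (h x) \<partial>M) \<longlonglongrightarrow> measure M {x \<in> space M. c < h x}"
    if M: "finite_measure M" "h \<in> borel_measurable M" for M
  proof -
    interpret finite_measure M by fact
    note M(2)[measurable]
    have "(\<lambda>n. \<integral>x. g n (h x) \<partial>M) \<longlonglongrightarrow> (\<integral>x. indicator {c<..} (h x) \<partial>M)"
      by (rule integral_dominated_convergence[where w="\<lambda>_. 1"]) (use glim g01 in auto)
    also have "(\<integral>x. indicator {c<..} (h x) \<partial>M) = (\<integral>x. indicator {x \<in> space M. c < h x} x \<partial>M)"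
      by (intro Bochner_Integration.integral_cong) (auto simp: indicator_def)
    also have "\<dots> = measure M {x \<in> space M. c < h x}" by simp
    finally show ?thesis .
  qed
  have "measure \<alpha> {x \<in> space \<alpha>. c < h x} = measure \<beta> {x \<in> space \<beta>. c < h x}"
  proof -
    have "(\<integral>x. g n (h x) \<partial>\<alpha>) = (\<integral>x. g n (h x) \<partial>\<beta>)" for n
      by (rule continuous_integral_eq[OF fin meas range eq gc])
    from lim[OF fin(1) meas(1), unfolded this] lim[OF fin(2) meas(2)] show ?thesis
      by (rule LIMSEQ_unique)
  qed
  then show "emeasure (distr \<alpha> borel h) {c<..} = emeasure (distr \<beta> borel h) {c<..}"
    by (simp add: emeasure_distr vimage_def Int_def conj_commute a.emeasure_eq_measure b.emeasure_eq_measure)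
qed auto

section \<open>Families of test functions that determine finite measures on the half-line\<close>

text \<open>Stated for finite measures of arbitrary mass, since the induction over the sites applies
  it to weighted marginals. Only \<open>s > 0\<close> is tested, so equality of the total masses is
  part of the conclusion.\<close>

definition determines :: "(real \<Rightarrow> real) \<Rightarrow> bool" where
  "determines q \<longleftrightarrow> (\<forall>\<alpha> \<beta>. finite_measure \<alpha> \<longrightarrow> finite_measure \<beta> \<longrightarrow>
     sets \<alpha> = sets nonneg_borel \<longrightarrow> sets \<beta> = sets nonneg_borel \<longrightarrow>
     (\<forall>s>0. (\<integral>\<^sup>+x. ennreal (q (s * x)) \<partial>\<alpha>) = (\<integral>\<^sup>+x. ennreal (q (s * x)) \<partial>\<beta>)) \<longrightarrow> \<alpha> = \<beta>)"

text \<open>Weighting the measures by \<open>h\<close> makes the moment of order 0 dispensable.\<close>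

lemma positive_moments_determine:
  fixes \<alpha> \<beta> :: "real measure" and h g :: "real \<Rightarrow> real"
  assumes fin: "finite_measure \<alpha>" "finite_measure \<beta>"
    and sets: "sets \<alpha> = sets nonneg_borel" "sets \<beta> = sets nonneg_borel"
    and h: "h \<in> borel_measurable borel" and g: "g \<in> borel_measurable borel"
    and range: "\<And>x. 0 \<le> x \<Longrightarrow> 0 < h x \<and> h x \<le> 1" and inv: "\<And>x. 0 \<le> x \<Longrightarrow> g (h x) = x"
    and eq: "\<And>k. (\<integral>x. h x ^ Suc k \<partial>\<alpha>) = (\<integral>x. h x ^ Suc k \<partial>\<beta>)"
  shows "\<alpha> = \<beta>"
proof -
  define W where "W M = density M (\<lambda>x. ennreal (h x))" for M
  have sp: "space M = {0..}" if "sets M = sets nonneg_borel" for M :: "real measure"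
    using sets_eq_imp_space_eq[OF that] by (simp add: space_nonneg_borel)
  have hm: "h \<in> borel_measurable M" if "sets M = sets nonneg_borel" for M :: "real measure"
    by (rule measurable_nonneg_borelD[OF that h])
  have W: "finite_measure (W M)" "sets (W M) = sets nonneg_borel" "density (W M) (\<lambda>x. ennreal (1 / h x)) = M"
    "\<And>k. (\<integral>x. h x ^ k \<partial>(W M)) = (\<integral>x. h x ^ Suc k \<partial>M)"
    "distr (distr (W M) borel h) nonneg_borel (\<lambda>y. max 0 (g y)) = W M"
    if M: "finite_measure M" "sets M = sets nonneg_borel" for M :: "real measure"
  proof -
    interpret finite_measure M by fact
    note hm[OF M(2), measurable]
    show s: "sets (W M) = sets nonneg_borel" using M by (simp add: W_def)
    have "emeasure (W M) (space M) = (\<integral>\<^sup>+x. ennreal (h x) \<partial>M)"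
      unfolding W_def by (subst emeasure_density) (auto intro!: nn_integral_cong)
    also have "\<dots> \<le> (\<integral>\<^sup>+x. 1 \<partial>M)"
      by (rule nn_integral_mono) (use range sp[OF M(2)] in auto)
    also have "\<dots> < \<infinity>" using emeasure_finite by (simp add: less_top[symmetric])
    finally show "finite_measure (W M)" by (intro finite_measureI) (auto simp: W_def)
    show "density (W M) (\<lambda>x. ennreal (1 / h x)) = M"
    proof (rule measure_eqI)
      fix A assume "A \<in> sets (density (W M) (\<lambda>x. ennreal (1 / h x)))"
      then have A[measurable]: "A \<in> sets M" by (simp add: W_def)
      have "emeasure (density (W M) (\<lambda>x. ennreal (1 / h x))) A = (\<integral>\<^sup>+x. ennreal (h x) * (ennreal (1 / h x) * indicator A x) \<partial>M)"
        unfolding W_def by (subst emeasure_density) (auto simp: nn_integral_density)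
      also have "\<dots> = (\<integral>\<^sup>+x. indicator A x \<partial>M)"
      proof (rule nn_integral_cong)
        fix x assume "x \<in> space M"
        then have "0 < h x" using range sp[OF M(2)] by auto
        then show "ennreal (h x) * (ennreal (1 / h x) * indicator A x) = indicator A x"
          by (simp add: mult.assoc[symmetric] ennreal_mult[symmetric])
      qed
      finally show "emeasure (density (W M) (\<lambda>x. ennreal (1 / h x))) A = emeasure M A" by simp
    qed (simp add: W_def)
    show "(\<integral>x. h x ^ k \<partial>(W M)) = (\<integral>x. h x ^ Suc k \<partial>M)" for k
    proof -
      have "(\<integral>x. h x ^ k \<partial>(W M)) = (\<integral>x. h x *\<^sub>R h x ^ k \<partial>M)"
        unfolding W_def
      proof (rule integral_density)
        show "(\<lambda>x. h x ^ k) \<in> borel_measurable M" by (rule borel_measurable_power[OF hm[OF M(2)]])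
        show "AE x in M. 0 \<le> h x"
          by (rule AE_I2) (use range sp[OF M(2)] in \<open>auto intro: less_imp_le\<close>)
      qed (rule hm[OF M(2)])
      then show ?thesis by simp
    qed
    have hW: "h \<in> borel_measurable (W M)" by (rule hm[OF s])
    \<comment> \<open>The function \<open>g\<close> inverts \<open>h\<close> only on the image of
      the half-line; the maximum with 0 turns it into a map from all reals to the half-line.\<close>
    have gm: "(\<lambda>y. max 0 (g y)) \<in> borel \<rightarrow>\<^sub>M nonneg_borel"
      unfolding nonneg_borel_def using g by (intro measurable_restrict_space2) auto
    have "distr (distr (W M) borel h) nonneg_borel (\<lambda>y. max 0 (g y)) = distr (W M) nonneg_borel (\<lambda>x. max 0 (g (h x)))"
      unfolding distr_distr[OF gm hW] by (simp only: o_def)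
    also have "\<dots> = distr (W M) (W M) (\<lambda>x. x)"
    proof (rule distr_cong[OF refl])
      show "sets nonneg_borel = sets (W M)" by (simp only: s)
      show "max 0 (g (h x)) = x" if "x \<in> space (W M)" for x
        using that inv[of x] sp[OF s] by simp
    qed
    also have "\<dots> = W M" by (rule distr_id)
    finally show "distr (distr (W M) borel h) nonneg_borel (\<lambda>y. max 0 (g y)) = W M" .
  qed
  have "distr (W \<alpha>) borel h = distr (W \<beta>) borel h"
  proof (rule moments_determine_distr[OF W(1)[OF fin(1) sets(1)] W(1)[OF fin(2) sets(2)]
        hm[OF W(2)[OF fin(1) sets(1)]] hm[OF W(2)[OF fin(2) sets(2)]]])
    show "h x \<in> {0..1}" if "x \<in> space (W \<alpha>)" for x
      using range[of x] that sp[OF W(2)[OF fin(1) sets(1)]] by auto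
    show "h x \<in> {0..1}" if "x \<in> space (W \<beta>)" for x
      using range[of x] that sp[OF W(2)[OF fin(2) sets(2)]] by auto
    show "(\<integral>x. h x ^ k \<partial>(W \<alpha>)) = (\<integral>x. h x ^ k \<partial>(W \<beta>))" for k
      unfolding W(4)[OF fin(1) sets(1)] W(4)[OF fin(2) sets(2)] by (rule eq)
  qed
  then have "W \<alpha> = W \<beta>" by (metis W(5)[OF fin(1) sets(1)] W(5)[OF fin(2) sets(2)])
  then show ?thesis by (metis W(3)[OF fin(1) sets(1)] W(3)[OF fin(2) sets(2)])
qed

lemma determinesI:
  fixes h g q :: "real \<Rightarrow> real"
  assumes h: "h \<in> borel_measurable borel" and g: "g \<in> borel_measurable borel"
    and range: "\<And>x. 0 \<le> x \<Longrightarrow> 0 < h x \<and> h x \<le> 1" and inv: "\<And>x. 0 \<le> x \<Longrightarrow> g (h x) = x"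
    and q: "q \<in> borel_measurable borel" "\<And>x. 0 \<le> x \<Longrightarrow> 0 \<le> q x"
    and moments: "\<And>\<alpha> \<beta>. finite_measure \<alpha> \<Longrightarrow> finite_measure \<beta> \<Longrightarrow>
      sets \<alpha> = sets nonneg_borel \<Longrightarrow> sets \<beta> = sets nonneg_borel \<Longrightarrow>
      (\<And>s. 0 < s \<Longrightarrow> (\<integral>x. q (s * x) \<partial>\<alpha>) = (\<integral>x. q (s * x) \<partial>\<beta>)) \<Longrightarrow>
      (\<And>k. (\<integral>x. h x ^ Suc k \<partial>\<alpha>) = (\<integral>x. h x ^ Suc k \<partial>\<beta>))"
  shows "determines q"
  unfolding determines_def
proof (intro allI impI)
  fix \<alpha> \<beta> :: "real measure"
  assume fin: "finite_measure \<alpha>" "finite_measure \<beta>"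
    and sets: "sets \<alpha> = sets nonneg_borel" "sets \<beta> = sets nonneg_borel"
    and eq: "\<forall>s>0. (\<integral>\<^sup>+x. ennreal (q (s * x)) \<partial>\<alpha>) = (\<integral>\<^sup>+x. ennreal (q (s * x)) \<partial>\<beta>)"
  have I: "(\<integral>x. q (s * x) \<partial>M) = enn2real (\<integral>\<^sup>+x. ennreal (q (s * x)) \<partial>M)"
    if M: "sets M = sets nonneg_borel" and s: "0 < s" for M s
  proof (rule integral_eq_nn_integral)
    have "(\<lambda>x. q (s * x)) \<in> borel_measurable borel"
      by (rule measurable_compose[OF _ q(1)]) simp
    then show "(\<lambda>x. q (s * x)) \<in> borel_measurable M"
      by (rule measurable_nonneg_borelD[OF M])
    show "AE x in M. 0 \<le> q (s * x)"
      using sets_eq_imp_space_eq[OF M] s q(2) by (auto simp: space_nonneg_borel intro!: AE_I2)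
  qed
  have "(\<integral>x. q (s * x) \<partial>\<alpha>) = (\<integral>x. q (s * x) \<partial>\<beta>)" if "0 < s" for s
    using eq that by (simp only: I[OF sets(1) that] I[OF sets(2) that])
  then have m: "(\<integral>x. h x ^ Suc k \<partial>\<alpha>) = (\<integral>x. h x ^ Suc k \<partial>\<beta>)" for k
    by (rule moments[OF fin sets])
  show "\<alpha> = \<beta>"
  proof (rule positive_moments_determine[OF fin sets h g])
    show "0 < h x \<and> h x \<le> 1" "g (h x) = x" if "0 \<le> x" for x using range[OF that] inv[OF that] by auto
    show "(\<integral>x. h x ^ Suc k \<partial>\<alpha>) = (\<integral>x. h x ^ Suc k \<partial>\<beta>)" for k by (rule m)
  qed
qed

text \<open>The moments of \<open>exp (- x)\<close> of order at least 1 are values of the Laplace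
  transform at positive integers.\<close>

lemma determines_exp: "determines (\<lambda>y. exp (- y))"
proof (rule determinesI[where h="\<lambda>x. exp (- x)" and g="\<lambda>y. - ln y"])
  fix \<alpha> \<beta> :: "real measure" and k
  assume eq: "\<And>s. 0 < s \<Longrightarrow> (\<integral>x. exp (- (s * x)) \<partial>\<alpha>) = (\<integral>x. exp (- (s * x)) \<partial>\<beta>)"
  have e: "exp (- x) ^ Suc k = exp (- (real (Suc k) * x))" for x :: real
    by (simp only: exp_of_nat_mult[symmetric] mult_minus_right)
  show "(\<integral>x. exp (- x) ^ Suc k \<partial>\<alpha>) = (\<integral>x. exp (- x) ^ Suc k \<partial>\<beta>)"
    unfolding e by (rule eq) simp
qed auto

text \<open>Once the lower coefficients vanish, dividing by \<open>x ^ n\<close> gives a power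
  series that is 0 for \<open>x \<noteq> 0\<close> and has limit \<open>a n\<close> at 0.\<close>

lemma power_series_zero_coeff:
  fixes a :: "nat \<Rightarrow> real"
  assumes "\<And>x. \<bar>x\<bar> < 1 \<Longrightarrow> (\<lambda>n. a n * x ^ n) sums 0"
  shows "a n = 0"
proof (induction n rule: less_induct)
  case (less n)
  have "(\<lambda>k. a (k + n) * x ^ k) sums 0" if x: "x \<noteq> 0" "norm x < 1" for x
  proof -
    have "(\<lambda>k. a (k + n) * x ^ (k + n)) sums 0"
      using assms[of x] x less by (subst sums_iff_shift) simp
    then have "(\<lambda>k. a (k + n) * x ^ (k + n) / x ^ n) sums (0 / x ^ n)" by (rule sums_divide)
    then show ?thesis using x by (simp add: power_add)
  qed
  then have "((\<lambda>_. 0) \<longlongrightarrow> a (0 + n)) (at (0::real))" by (rule powser_limit_0_strong[rotated]) auto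
  then show ?case using tendsto_const_iff[of "at (0::real)" "0::real" "a n"] by simp
qed

text \<open>Put \<open>h = 1 / (1 + x)\<close> and \<open>s = 1 / (1 - r)\<close>. Then
  \<open>s / (1 + s * x) = h / (1 - h * r)\<close>, which expands into the sum of
  \<open>h ^ (k + 1) * r ^ k\<close>. As a function of \<open>r\<close> the transform is thus a
  power series whose coefficients are the moments of \<open>h\<close> of order at least 1.\<close>

lemma determines_inverse: "determines (\<lambda>y. 1 / (1 + y))"
proof (rule determinesI[where h="\<lambda>x. 1 / (1 + x)" and g="\<lambda>y. 1 / y - 1"])
  fix \<alpha> \<beta> :: "real measure" and k
  assume fin: "finite_measure \<alpha>" "finite_measure \<beta>"
    and sets: "sets \<alpha> = sets nonneg_borel" "sets \<beta> = sets nonneg_borel"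
    and eq: "\<And>s. 0 < s \<Longrightarrow> (\<integral>x. 1 / (1 + s * x) \<partial>\<alpha>) = (\<integral>x. 1 / (1 + s * x) \<partial>\<beta>)"
  define m where "m M k = (\<integral>x. (1 / (1 + x)) ^ Suc k \<partial>M)" for M :: "real measure" and k
  have ser: "(\<lambda>k. m M k * r ^ k) sums (\<integral>x. 1 / (1 - r) * (1 / (1 + 1 / (1 - r) * x)) \<partial>M)"
    if M: "finite_measure M" "sets M = sets nonneg_borel" and r: "\<bar>r\<bar> < 1" for M r
  proof -
    interpret finite_measure M by fact
    have sp: "space M = {0..}" using sets_eq_imp_space_eq[OF M(2)] by (simp add: space_nonneg_borel)
    let ?f = "\<lambda>k x. (1 / (1 + x)) ^ Suc k * r ^ k"
    have meas: "(\<lambda>x. ?f k x) \<in> borel_measurable M" for k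
    proof -
      have "(\<lambda>x. ?f k x) \<in> borel_measurable borel" by measurable
      then show ?thesis by (rule measurable_nonneg_borelD[OF M(2)])
    qed
    have le: "\<bar>?f k x\<bar> \<le> \<bar>r\<bar> ^ k" if "0 \<le> x" for k x
    proof -
      have "\<bar>?f k x\<bar> = (1 / (1 + x)) ^ Suc k * \<bar>r\<bar> ^ k" using that by (simp add: abs_mult power_abs)
      also have "\<dots> \<le> 1 * \<bar>r\<bar> ^ k" using that by (intro mult_right_mono power_le_one) auto
      finally show ?thesis by simp
    qed
    have int: "integrable M (?f k)" for k
      by (rule integrable_const_bound[OF _ meas, of _ "\<bar>r\<bar> ^ k"]) (use le sp in auto)
    have sm: "summable (\<lambda>k. \<bar>r\<bar> ^ k)" using r by (simp add: summable_geometric)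
    have "(\<lambda>k. integral\<^sup>L M (?f k)) sums (\<integral>x. (\<Sum>k. ?f k x) \<partial>M)"
    proof (rule sums_integral[OF int])
      show "AE x in M. summable (\<lambda>k. norm (?f k x))"
        by (rule AE_I2, rule summable_comparison_test'[OF sm, of 0]) (use le sp in auto)
      show "summable (\<lambda>k. \<integral>x. norm (?f k x) \<partial>M)"
      proof (rule summable_comparison_test'[OF summable_mult2[OF sm, of "measure M (space M)"], of 0])
        fix k
        have "(\<integral>x. norm (?f k x) \<partial>M) \<le> (\<integral>x. \<bar>r\<bar> ^ k \<partial>M)"
          by (rule integral_mono) (use int le sp in \<open>auto simp del: power_Suc\<close>)
        then show "norm (\<integral>x. norm (?f k x) \<partial>M) \<le> \<bar>r\<bar> ^ k * measure M (space M)"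
          by (simp add: mult.commute)
      qed
    qed
    moreover have "(\<integral>x. (\<Sum>k. ?f k x) \<partial>M) = (\<integral>x. 1 / (1 - r) * (1 / (1 + 1 / (1 - r) * x)) \<partial>M)"
    proof (rule Bochner_Integration.integral_cong[OF refl])
      fix x assume "x \<in> space M"
      then have x: "0 \<le> x" using sp by auto
      define h where "h = 1 / (1 + x)"
      have h: "0 < h" "h \<le> 1" using x by (auto simp: h_def)
      have "\<bar>h * r\<bar> < 1" using h r by (simp add: abs_mult) (smt (verit) mult_left_le_one_le abs_ge_zero)
      then have "(\<lambda>k. h * (h * r) ^ k) sums (h * (1 / (1 - h * r)))"
        by (intro sums_mult geometric_sums) simp
      moreover have "h * (h * r) ^ k = ?f k x" for k by (simp add: h_def[symmetric] power_mult_distrib)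
      moreover have "h * (1 / (1 - h * r)) = 1 / (1 - r) * (1 / (1 + 1 / (1 - r) * x))"
      proof -
        have "1 - r \<noteq> 0" "1 - r + x > 0" using r x by auto
        then show ?thesis using x by (simp add: h_def divide_simps)
      qed
      ultimately show "(\<Sum>k. ?f k x) = 1 / (1 - r) * (1 / (1 + 1 / (1 - r) * x))"
        by (simp add: sums_iff)
    qed
    ultimately show ?thesis by (simp add: m_def del: power_Suc)
  qed
  have "(\<lambda>k. (m \<alpha> k - m \<beta> k) * r ^ k) sums 0" if r: "\<bar>r\<bar> < 1" for r
  proof -
    have "0 < 1 / (1 - r)" using r by auto
    from eq[OF this] have "(\<integral>x. 1 / (1 - r) * (1 / (1 + 1 / (1 - r) * x)) \<partial>\<alpha>) = (\<integral>x. 1 / (1 - r) * (1 / (1 + 1 / (1 - r) * x)) \<partial>\<beta>)"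
      by (simp only: integral_mult_right_zero)
    then show ?thesis
      using sums_diff[OF ser[OF fin(1) sets(1) r] ser[OF fin(2) sets(2) r]] by (simp add: left_diff_distrib)
  qed
  then have "m \<alpha> k - m \<beta> k = 0" by (rule power_series_zero_coeff)
  then show "(\<integral>x. (1 / (1 + x)) ^ Suc k \<partial>\<alpha>) = (\<integral>x. (1 / (1 + x)) ^ Suc k \<partial>\<beta>)" by (simp add: m_def)
qed (auto simp: divide_simps)

section \<open>From one coordinate to the whole configuration\<close>

context profile begin

text \<open>The factors \<open>q (s i * x i)\<close> are exchanged one site at a time for indicators
  of arbitrary measurable sets. After the last site the mixed product is the indicator of a box, and
  boxes determine the law. The parameter stays general in the induction, since the exchange at site
  \<open>k\<close> tests all values of \<open>s k\<close>.\<close>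

lemma avg_determines:
  assumes q: "determines q"
    and \<nu>: "\<nu> \<in> laws N" and \<nu>': "\<nu>' \<in> laws N"
    and eq: "\<And>s. s \<in> params N \<Longrightarrow> avg N \<nu> s = avg N \<nu>' s"
  shows "\<nu> = \<nu>'"
proof -
  define T where "T A B s i y = (if i \<in> A then indicator (B i) y else q (s i * y))"
    for A B and s :: "nat \<Rightarrow> real" and i and y :: real
  have Tn: "0 \<le> T A B s i y" "T A B s i y \<le> 1" if "0 \<le> y" "s \<in> params N" for A B s i y
    using that params_nonneg[of s N i] q_pos[of "s i * y"] q_le_1[of "s i * y"]
    by (auto simp: T_def indicator_def less_imp_le)
  have Tm: "(\<lambda>x. T A B s i (x i)) \<in> borel_measurable (config_space N)"
    if "i \<in> {1..N}" "\<And>i. B i \<in> sets nonneg_borel" for A B s i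
  proof (cases "i \<in> A")
    case True
    have "(\<lambda>x. x i) \<in> config_space N \<rightarrow>\<^sub>M nonneg_borel"
      unfolding config_space_def using that(1) by (rule measurable_component_singleton)
    then have "(\<lambda>x. indicator (B i) (x i) :: real) \<in> borel_measurable (config_space N)"
      by (rule measurable_compose) (rule borel_measurable_indicator[OF that(2)])
    then show ?thesis using True by (simp add: T_def)
  next
    case False
    have "(\<lambda>x. q (s i * x i)) \<in> borel_measurable (config_space N)"
      by (intro measurable_compose[OF _ q_measurable] borel_measurable_times borel_measurable_const measurable_coordinate that(1))
    then show ?thesis using False by (simp add: T_def)
  qed
  have main: "(\<integral>\<^sup>+x. ennreal (\<Prod>i\<in>{1..N}. T A B s i (x i)) \<partial>\<nu>) = (\<integral>\<^sup>+x. ennreal (\<Prod>i\<in>{1..N}. T A B s i (x i)) \<partial>\<nu>')"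
    if "finite A" "A \<subseteq> {1..N}" "\<And>i. B i \<in> sets nonneg_borel" "s \<in> params N" for A B s
    using that
  proof (induction A arbitrary: s rule: finite_induct)
    case empty
    have "(\<integral>\<^sup>+x. ennreal (\<Prod>i\<in>{1..N}. T {} B s i (x i)) \<partial>M) = ennreal (avg N M s)"
      if M: "M \<in> laws N" for M
    proof -
      have "(\<integral>\<^sup>+x. ennreal (E N s x) \<partial>M) = ennreal (avg N M s)"
        unfolding avg_def
        by (rule nn_integral_eq_integral[OF E_integrable[OF M empty.prems(3)]])
          (use E_params(1) empty.prems(3) space_config_law[OF M] in \<open>auto intro!: AE_I2\<close>)
      then show ?thesis by (simp add: T_def E_def)
    qed
    then show ?case using eq[OF empty.prems(3)] \<nu> \<nu>' by simp
  next
    case (insert k A)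
    have k: "k \<in> {1..N}" and A: "A \<subseteq> {1..N}" using insert.prems by auto
    define w where "w x = (\<Prod>i\<in>{1..N} - {k}. T A B s i (x i))" for x
    \<comment> \<open>The marginal at site \<open>k\<close>, weighted by the other factors. Its
      integral of \<open>q (r * y)\<close> is the mixed average with \<open>s k\<close> replaced by
      \<open>r\<close>, and the induction hypothesis applies to that.\<close>
    define \<alpha> where "\<alpha> M = distr (density M (\<lambda>x. ennreal (w x))) nonneg_borel (\<lambda>x. x k)" for M
    have wm: "w \<in> borel_measurable (config_space N)"
      unfolding w_def using insert.prems(2) by (intro borel_measurable_prod Tm) auto
    have w01: "0 \<le> w x" "w x \<le> 1" if "x \<in> orthant N" for x
      unfolding w_def using that insert.prems(3) Tn config_nonneg
      by (auto intro!: prod_nonneg prod_le_1 simp: less_imp_le)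
    have \<alpha>: "finite_measure (\<alpha> M)" "sets (\<alpha> M) = sets nonneg_borel"
      "\<And>f. f \<in> borel_measurable nonneg_borel \<Longrightarrow> (\<integral>\<^sup>+y. f y \<partial>(\<alpha> M)) = (\<integral>\<^sup>+x. ennreal (w x) * f (x k) \<partial>M)"
      if M: "M \<in> laws N" for M
    proof -
      note sM = sets_config_law[OF M]
      have wM: "w \<in> borel_measurable M" using wm sM by (simp cong: measurable_cong_sets)
      have c: "(\<lambda>x. x k) \<in> M \<rightarrow>\<^sub>M nonneg_borel"
        using measurable_component_singleton[OF k, of "\<lambda>_. nonneg_borel"] sM
        by (simp add: config_space_def cong: measurable_cong_sets)
      show "sets (\<alpha> M) = sets nonneg_borel" by (simp add: \<alpha>_def)
      show f: "(\<integral>\<^sup>+y. f y \<partial>(\<alpha> M)) = (\<integral>\<^sup>+x. ennreal (w x) * f (x k) \<partial>M)"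
        if "f \<in> borel_measurable nonneg_borel" for f
      proof -
        have "(\<integral>\<^sup>+y. f y \<partial>(\<alpha> M)) = (\<integral>\<^sup>+x. f (x k) \<partial>(density M (\<lambda>x. ennreal (w x))))"
          unfolding \<alpha>_def by (rule nn_integral_distr) (use c that in simp_all)
        also have "\<dots> = (\<integral>\<^sup>+x. ennreal (w x) * f (x k) \<partial>M)"
          by (rule nn_integral_density) (use wM measurable_compose[OF c that] in simp_all)
        finally show ?thesis .
      qed
      have "emeasure (\<alpha> M) (space (\<alpha> M)) = (\<integral>\<^sup>+y. 1 \<partial>(\<alpha> M))" by simp
      also have "\<dots> = (\<integral>\<^sup>+x. ennreal (w x) * 1 \<partial>M)" by (rule f) simp
      also have "\<dots> \<le> (\<integral>\<^sup>+x. 1 \<partial>M)"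
        by (rule nn_integral_mono) (use w01 space_config_law[OF M] in auto)
      also have "\<dots> = 1" using prob_space.emeasure_space_1[OF prob_space_config_law[OF M]] by simp
      finally show "finite_measure (\<alpha> M)" by (intro finite_measureI) (auto simp: top_unique)
    qed
    have split: "(\<integral>\<^sup>+x. ennreal (\<Prod>i\<in>{1..N}. T A' B s' i (x i)) \<partial>M) = (\<integral>\<^sup>+y. ennreal (T A' B s' k y) \<partial>(\<alpha> M))"
      if M: "M \<in> laws N" and s': "s' \<in> params N"
        and T: "\<And>i y. i \<noteq> k \<Longrightarrow> T A' B s' i y = T A B s i y"
        and Tk: "(\<lambda>y. ennreal (T A' B s' k y)) \<in> borel_measurable nonneg_borel" for M A' s'
    proof -
      have "ennreal (\<Prod>i\<in>{1..N}. T A' B s' i (x i)) = ennreal (w x) * ennreal (T A' B s' k (x k))"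
        if x: "x \<in> space M" for x
      proof -
        have x': "x \<in> orthant N" using x space_config_law[OF M] by simp
        have "(\<Prod>i\<in>{1..N}. T A' B s' i (x i)) = T A' B s' k (x k) * (\<Prod>i\<in>{1..N} - {k}. T A' B s' i (x i))"
          using k by (subst prod.remove[of _ k]) auto
        also have "(\<Prod>i\<in>{1..N} - {k}. T A' B s' i (x i)) = w x" unfolding w_def by (rule prod.cong) (auto simp: T)
        finally show ?thesis
          using w01[OF x'] Tn(1)[OF config_nonneg[OF x' k] s', of A' B k]
          by (simp add: ennreal_mult mult.commute)
      qed
      then have "(\<integral>\<^sup>+x. ennreal (\<Prod>i\<in>{1..N}. T A' B s' i (x i)) \<partial>M) = (\<integral>\<^sup>+x. ennreal (w x) * ennreal (T A' B s' k (x k)) \<partial>M)"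
        by (rule nn_integral_cong)
      then show ?thesis using \<alpha>(3)[OF M Tk] by simp
    qed
    have "\<alpha> \<nu> = \<alpha> \<nu>'"
    proof (rule q[unfolded determines_def, rule_format, OF \<alpha>(1)[OF \<nu>] \<alpha>(1)[OF \<nu>'] \<alpha>(2)[OF \<nu>] \<alpha>(2)[OF \<nu>']])
      fix r :: real assume r: "0 < r"
      define s' where "s' = s(k := r)"
      have s': "s' \<in> params N" using insert.prems(3) k r by (auto simp: s'_def params_def)
      have Tq: "T A B s' k y = q (r * y)" for y using insert.hyps(2) by (simp add: T_def s'_def)
      have T: "T A B s' i y = T A B s i y" if "i \<noteq> k" for i y using that by (simp add: T_def s'_def)
      have "(\<lambda>y. q (r * y)) \<in> borel_measurable nonneg_borel"
        by (rule measurable_nonneg_borelD[OF refl]) measurable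
      then have m: "(\<lambda>y. ennreal (T A B s' k y)) \<in> borel_measurable nonneg_borel" unfolding Tq by measurable
      show "(\<integral>\<^sup>+y. ennreal (q (r * y)) \<partial>(\<alpha> \<nu>)) = (\<integral>\<^sup>+y. ennreal (q (r * y)) \<partial>(\<alpha> \<nu>'))"
        using split[OF \<nu> s' T m] split[OF \<nu>' s' T m] insert.IH[OF A insert.prems(2) s'] by (simp add: Tq)
    qed
    moreover have "T (insert k A) B s i y = T A B s i y" if "i \<noteq> k" for i y using that by (simp add: T_def)
    moreover have "(\<lambda>y. ennreal (T (insert k A) B s k y)) \<in> borel_measurable nonneg_borel"
      using insert.prems(2) by (simp add: T_def)
    ultimately show ?case
      using split[OF \<nu> insert.prems(3), of "insert k A"] split[OF \<nu>' insert.prems(3), of "insert k A"] by simp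
  qed
  define s0 :: "nat \<Rightarrow> real" where "s0 i = (if i \<in> {1..N} then 1 else 0)" for i
  have s0: "s0 \<in> params N" by (auto simp: s0_def params_def)
  show "\<nu> = \<nu>'"
  proof (rule measure_eqI_PiM_finite[where I="{1..N}" and M="\<lambda>_. nonneg_borel" and A="\<lambda>_. orthant N"])
    show "sets \<nu> = sets (Pi\<^sub>M {1..N} (\<lambda>_. nonneg_borel))" "sets \<nu>' = sets (Pi\<^sub>M {1..N} (\<lambda>_. nonneg_borel))"
      using sets_config_law[OF \<nu>] sets_config_law[OF \<nu>'] by (simp_all add: config_space_def)
    show "range (\<lambda>_. orthant N) \<subseteq> prod_algebra {1..N} (\<lambda>_. nonneg_borel)"
      unfolding config_space_def space_PiM by (auto intro!: prod_algebraI_finite)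
    show "emeasure \<nu> (orthant N) \<noteq> \<infinity>" using in_space_prob_algebra[OF \<nu>] by simp
    show "(\<Union>i. orthant N) = space (Pi\<^sub>M {1..N} (\<lambda>_. nonneg_borel))" by (simp add: config_space_def)
    fix B :: "nat \<Rightarrow> real set" assume B: "\<And>i. i \<in> {1..N} \<Longrightarrow> B i \<in> sets nonneg_borel"
    \<comment> \<open>The induction asks for measurable sets at all indices, so the family is
      continued by the empty set.\<close>
    define B' where "B' i = (if i \<in> {1..N} then B i else {})" for i
    have B': "B' i \<in> sets nonneg_borel" for i using B by (simp add: B'_def)
    have "emeasure M (Pi\<^sub>E {1..N} B) = (\<integral>\<^sup>+x. ennreal (\<Prod>i\<in>{1..N}. T {1..N} B' s0 i (x i)) \<partial>M)"
      if M: "M \<in> laws N" for M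
    proof -
      have "Pi\<^sub>E {1..N} B \<in> sets M"
        using sets_config_law[OF M] B by (auto simp: config_space_def intro!: sets_PiM_I_finite)
      then have "emeasure M (Pi\<^sub>E {1..N} B) = (\<integral>\<^sup>+x. indicator (Pi\<^sub>E {1..N} B) x \<partial>M)" by simp
      also have "\<dots> = (\<integral>\<^sup>+x. ennreal (\<Prod>i\<in>{1..N}. T {1..N} B' s0 i (x i)) \<partial>M)"
      proof (rule nn_integral_cong)
        fix x assume "x \<in> space M"
        then have x: "x \<in> PiE {1..N} (\<lambda>_. {0..})" using space_config_law[OF M] by (simp add: space_config_space)
        have "(\<Prod>i\<in>{1..N}. T {1..N} B' s0 i (x i)) = (\<Prod>i\<in>{1..N}. indicator (B i) (x i))"
          by (rule prod.cong) (auto simp: T_def B'_def)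
        also have "\<dots> = indicator (Pi\<^sub>E {1..N} B) x"
        proof (cases "x \<in> Pi\<^sub>E {1..N} B")
          case True
          then show ?thesis by (auto simp: PiE_iff intro!: prod.neutral)
        next
          case False
          then obtain i where "i \<in> {1..N}" "x i \<notin> B i" using x by (auto simp: PiE_iff)
          then have "(\<Prod>i\<in>{1..N}. indicator (B i) (x i)) = (0::real)" by (intro prod_zero bexI[of _ i]) auto
          then show ?thesis using False by simp
        qed
        finally show "indicator (Pi\<^sub>E {1..N} B) x = ennreal (\<Prod>i\<in>{1..N}. T {1..N} B' s0 i (x i))"
          by (simp only: ennreal_indicator)
      qed
      finally show ?thesis .
    qed
    then show "emeasure \<nu> (Pi\<^sub>E {1..N} B) = emeasure \<nu>' (Pi\<^sub>E {1..N} B)"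
      using main[of "{1..N}" B' s0] B' s0 \<nu> \<nu>' by simp
  qed simp
qed

end

section \<open>Jump operators on functions vanishing at infinity\<close>

definition escapes :: "nat \<Rightarrow> (nat \<Rightarrow> nat \<Rightarrow> real) \<Rightarrow> bool" where
  "escapes N X \<longleftrightarrow> (\<forall>n. X n \<in> orthant N) \<and> filterlim (\<lambda>n. \<Sum>i\<in>{1..N}. X n i) at_top sequentially"

definition converges :: "nat \<Rightarrow> (nat \<Rightarrow> nat \<Rightarrow> real) \<Rightarrow> (nat \<Rightarrow> real) \<Rightarrow> bool" where
  "converges N X x \<longleftrightarrow> (\<forall>n. X n \<in> orthant N) \<and> x \<in> orthant N \<and>
     (\<forall>i\<in>{1..N}. (\<lambda>n. X n i) \<longlonglongrightarrow> x i)"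

text \<open>A form of membership in \<open>C0\<close> that suits dominated convergence. On the
  orthant all coordinates are nonnegative, so escaping to infinity means that their sum
  diverges.\<close>

definition seq_C0 :: "nat \<Rightarrow> ((nat \<Rightarrow> real) \<Rightarrow> real) \<Rightarrow> bool" where
  "seq_C0 N f \<longleftrightarrow> (\<forall>X x. converges N X x \<longrightarrow> (\<lambda>n. f (X n)) \<longlonglongrightarrow> f x) \<and>
     (\<forall>X. escapes N X \<longrightarrow> (\<lambda>n. f (X n)) \<longlonglongrightarrow> 0)"

text \<open>If smallness failed outside of every bounded region, points with sums beyond
  \<open>n\<close> and values at least \<open>e\<close> would form an escaping sequence. The compact
  sets are then the cubes with side \<open>n\<close>.\<close>

lemma seq_C0_imp_C0:
  assumes "seq_C0 N f" shows "f \<in> C0 (orthant N)"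
  unfolding C0_def
proof (intro CollectI conjI allI impI)
  show "continuous_on (orthant N) f"
    unfolding continuous_on_sequentially
  proof (intro allI ballI impI, elim conjE)
    fix X x assume x: "x \<in> orthant N" and X: "\<forall>n. X n \<in> orthant N" and lim: "X \<longlonglongrightarrow> x"
    have "(\<lambda>n. X n i) \<longlonglongrightarrow> x i" for i
      by (rule continuous_on_tendsto_compose[OF continuous_on_product_coordinates lim]) auto
    then have "converges N X x" using x X by (simp add: converges_def)
    then show "(f \<circ> X) \<longlonglongrightarrow> f x" using assms by (simp add: seq_C0_def o_def)
  qed
  fix e :: real assume e: "0 < e"
  have "\<exists>n::nat. \<forall>x\<in>orthant N. real n < (\<Sum>i\<in>{1..N}. x i) \<longrightarrow> \<bar>f x\<bar> < e"
  proof (rule ccontr)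
    assume "\<not> ?thesis"
    then have "\<forall>n::nat. \<exists>x. x \<in> orthant N \<and> real n < (\<Sum>i\<in>{1..N}. x i) \<and> \<not> \<bar>f x\<bar> < e" by blast
    then obtain X where X: "\<And>n::nat. X n \<in> orthant N" "\<And>n. real n < (\<Sum>i\<in>{1..N}. X n i)" "\<And>n. \<not> \<bar>f (X n)\<bar> < e"
      by metis
    have "filterlim (\<lambda>n. \<Sum>i\<in>{1..N}. X n i) at_top sequentially"
      by (rule filterlim_at_top_mono[OF filterlim_real_sequentially]) (use X(2) in \<open>auto intro!: always_eventually less_imp_le\<close>)
    then have "escapes N X" using X(1) by (simp add: escapes_def)
    then have "(\<lambda>n. \<bar>f (X n)\<bar>) \<longlonglongrightarrow> 0" using assms by (auto simp: seq_C0_def intro: tendsto_rabs_zero)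
    then have "\<forall>\<^sub>F n in sequentially. \<bar>f (X n)\<bar> < e" using e by (rule order_tendstoD)
    then show False using X(3) by (auto simp: eventually_sequentially)
  qed
  then obtain n :: nat where n: "\<And>x. x \<in> orthant N \<Longrightarrow> real n < (\<Sum>i\<in>{1..N}. x i) \<Longrightarrow> \<bar>f x\<bar> < e" by blast
  \<comment> \<open>Configurations equal \<open>undefined\<close> outside of the chain, so the box
    is degenerate in those coordinates.\<close>
  define c d :: "nat \<Rightarrow> real" where "c i = (if i \<in> {1..N} then 0 else undefined)"
    and "d i = (if i \<in> {1..N} then real n else undefined)" for i
  have K: "PiE {1..N} (\<lambda>_. {0..real n}) = {x. \<forall>i. x i \<in> {c i..d i}}"
  proof (intro set_eqI iffI)
    fix x assume "x \<in> PiE {1..N} (\<lambda>_. {0..real n})"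
    then show "x \<in> {x. \<forall>i. x i \<in> {c i..d i}}" by (auto simp: c_def d_def PiE_iff extensional_def)
  next
    fix x assume "x \<in> {x. \<forall>i. x i \<in> {c i..d i}}"
    then have x: "x i \<in> {c i..d i}" for i by simp
    show "x \<in> PiE {1..N} (\<lambda>_. {0..real n})"
    proof (rule PiE_I)
      show "x i \<in> {0..real n}" if "i \<in> {1..N}" for i using x[of i] that by (simp add: c_def d_def)
      show "x i = undefined" if "i \<notin> {1..N}" for i
        using x[of i] unfolding c_def d_def if_not_P[OF that] by simp
    qed
  qed
  show "\<exists>K. compact K \<and> K \<subseteq> orthant N \<and> (\<forall>x\<in>orthant N - K. \<bar>f x\<bar> < e)"
  proof (intro exI[of _ "PiE {1..N} (\<lambda>_. {0..real n})"] conjI ballI)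
    show "compact (PiE {1..N} (\<lambda>_. {0..real n}))" unfolding K by (rule compact_box)
    show "PiE {1..N} (\<lambda>_. {0..real n}) \<subseteq> orthant N"
      unfolding space_config_space by (rule PiE_mono) auto
    fix x assume x: "x \<in> orthant N - PiE {1..N} (\<lambda>_. {0..real n})"
    then obtain i where i: "i \<in> {1..N}" "real n < x i"
      by (force simp: space_config_space PiE_iff)
    have "x i \<le> (\<Sum>i\<in>{1..N}. x i)"
      using x i config_nonneg by (intro member_le_sum) auto
    then show "\<bar>f x\<bar> < e" using n x i by force
  qed
qed

lemma generator_graph_cong:
  assumes "generator_graph M P f g" "\<And>x. x \<in> space M \<Longrightarrow> g x = g' x"
  shows "generator_graph M P f g'"
proof -
  have "continuous_on (space M) g \<longleftrightarrow> continuous_on (space M) g'"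
    by (rule continuous_on_cong) (use assms(2) in auto)
  then have "g' \<in> C0 (space M)"
    using assms unfolding generator_graph_def C0_def by (auto 0 4)
  moreover have "uniform_limit (space M) F g A \<longleftrightarrow> uniform_limit (space M) F g' A" for F :: "real \<Rightarrow> 'a \<Rightarrow> real" and A
    by (rule uniform_limit_cong') (use assms(2) in auto)
  ultimately show ?thesis using assms(1) by (simp add: generator_graph_def)
qed

section \<open>Cutoffs and jump operators\<close>

definition jump_term :: "real set \<Rightarrow> (real \<Rightarrow> real) \<Rightarrow> (real \<Rightarrow> 'a \<Rightarrow> 'a) \<Rightarrow> ('a \<Rightarrow> real) \<Rightarrow> 'a \<Rightarrow> real" where
  "jump_term I w \<tau> f x = (LBINT u:I. w u * (f (\<tau> u x) - f x))"

text \<open>A soft threshold: the result depends on the value of \<open>F\<close> in a 1-Lipschitz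
  way, stays within \<open>1 / (n + 1)\<close> of a nonnegative \<open>F\<close>, and is 0 where
  \<open>F\<close> is at most that height.\<close>

definition cutoff :: "('a \<Rightarrow> real) \<Rightarrow> nat \<Rightarrow> 'a \<Rightarrow> real" where
  "cutoff F n x = max (F x - inverse (real (Suc n))) 0"

lemma cutoff_diff: "\<bar>cutoff F n x - cutoff F n y\<bar> \<le> \<bar>F x - F y\<bar>"
  by (auto simp: cutoff_def max_def abs_if)

lemma cutoff_close: "0 \<le> F x \<Longrightarrow> \<bar>cutoff F n x - F x\<bar> \<le> inverse (real (Suc n))"
  by (auto simp: cutoff_def max_def)

text \<open>The part removed by the cutoff is the minimum of \<open>F\<close> and
  \<open>1 / (n + 1)\<close>, a 1-Lipschitz function of \<open>F\<close> with values between 0 and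
  \<open>1 / (n + 1)\<close>. The first bound makes the error tend to 0 at each \<open>u\<close>;
  the second keeps it integrable against a rate that is singular at \<open>u = 0\<close>.\<close>

lemma cutoff_remainder_diff:
  "0 \<le> F x \<Longrightarrow> 0 \<le> F y \<Longrightarrow>
    \<bar>(cutoff F n x - cutoff F n y) - (F x - F y)\<bar> \<le> min (inverse (real (Suc n))) \<bar>F x - F y\<bar>"
  by (auto simp: cutoff_def max_def min_def abs_if)

text \<open>Since only \<open>u * w u\<close> is integrable, \<open>est\<close> has to compensate
  the singularity of the rate. The lower bound \<open>grow\<close> ensures that for each fixed
  \<open>u\<close> the jumped configurations escape to infinity together with the original ones; its
  factor \<open>c u\<close> may degenerate as \<open>u\<close> varies.\<close>

locale jump =
  fixes N :: nat and F :: "(nat \<Rightarrow> real) \<Rightarrow> real" and I :: "real set" and w :: "real \<Rightarrow> real"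
    and \<tau> :: "real \<Rightarrow> (nat \<Rightarrow> real) \<Rightarrow> nat \<Rightarrow> real" and c :: "real \<Rightarrow> real" and C :: real
  assumes F: "seq_C0 N F" and F_nonneg: "\<And>x. x \<in> orthant N \<Longrightarrow> 0 \<le> F x"
    and I: "I \<in> sets borel" and w: "w \<in> borel_measurable borel" "\<And>u. u \<in> I \<Longrightarrow> 0 \<le> w u"
      "set_integrable lborel I (\<lambda>u. u * w u)"
    and \<tau>: "\<And>u x. u \<in> I \<Longrightarrow> x \<in> orthant N \<Longrightarrow> \<tau> u x \<in> orthant N"
    and c: "\<And>u. u \<in> I \<Longrightarrow> 0 < c u"
    and grow: "\<And>u x i. u \<in> I \<Longrightarrow> x \<in> orthant N \<Longrightarrow> i \<in> {1..N} \<Longrightarrow> c u * x i \<le> \<tau> u x i"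
    and cont: "\<And>u X x i. u \<in> I \<Longrightarrow> converges N X x \<Longrightarrow> i \<in> {1..N} \<Longrightarrow> (\<lambda>n. \<tau> u (X n) i) \<longlonglongrightarrow> \<tau> u x i"
    and meas: "\<And>x. (\<lambda>u. F (\<tau> u x)) \<in> borel_measurable borel"
    and est: "\<And>u x. u \<in> I \<Longrightarrow> x \<in> orthant N \<Longrightarrow> \<bar>F (\<tau> u x) - F x\<bar> \<le> C * u"
begin

lemma dominating: "integrable lborel (\<lambda>u. indicator I u *\<^sub>R (C * (u * w u)))"
  using set_integrable_mult_right[OF w(3), of C] unfolding set_integrable_def by simp

lemma C_nonneg: "x \<in> orthant N \<Longrightarrow> u \<in> I \<Longrightarrow> 0 \<le> C * u"
  using est[of u x] by linarith

lemma weighted_est: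
  assumes "x \<in> orthant N" "u \<in> I" "\<bar>d\<bar> \<le> C * u"
  shows "\<bar>w u * d\<bar> \<le> C * (u * w u)" "0 \<le> C * (u * w u)"
proof -
  have eq: "w u * (C * u) = C * (u * w u)" by (simp only: ac_simps)
  have "\<bar>w u * d\<bar> = w u * \<bar>d\<bar>" using w(2)[OF assms(2)] by (simp only: abs_mult abs_of_nonneg)
  also have "\<dots> \<le> w u * (C * u)" using assms(3) w(2)[OF assms(2)] by (rule mult_left_mono)
  finally show "\<bar>w u * d\<bar> \<le> C * (u * w u)" unfolding eq .
  show "0 \<le> C * (u * w u)"
    unfolding eq[symmetric] by (intro mult_nonneg_nonneg[OF w(2)[OF assms(2)] C_nonneg[OF assms(1,2)]])
qed

lemma jump_integrable:
  assumes x: "x \<in> orthant N" and G: "\<And>y. G y = g (F y)" "g \<in> borel_measurable borel"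
    and le: "\<And>a b. \<bar>g a - g b\<bar> \<le> \<bar>a - b\<bar>"
  shows "set_integrable lborel I (\<lambda>u. w u * (G (\<tau> u x) - G x))"
  unfolding set_integrable_def
proof (rule Bochner_Integration.integrable_bound[OF dominating])
  have "(\<lambda>u. G (\<tau> u x)) \<in> borel_measurable borel"
    unfolding G(1) by (rule measurable_compose[OF meas G(2)])
  then show "(\<lambda>u. indicator I u *\<^sub>R (w u * (G (\<tau> u x) - G x))) \<in> borel_measurable lborel"
    using I w(1) by simp
  show "AE u in lborel. norm (indicator I u *\<^sub>R (w u * (G (\<tau> u x) - G x))) \<le> norm (indicator I u *\<^sub>R (C * (u * w u)))"
  proof (rule AE_I2)
    fix u :: real
    show "norm (indicator I u *\<^sub>R (w u * (G (\<tau> u x) - G x))) \<le> norm (indicator I u *\<^sub>R (C * (u * w u)))"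
    proof (cases "u \<in> I")
      case True
      have "\<bar>G (\<tau> u x) - G x\<bar> \<le> C * u"
        unfolding G(1) by (rule order_trans[OF le est[OF True x]])
      from weighted_est[OF x True this] show ?thesis using True
        by (simp only: indicator_simps scaleR_one real_norm_def abs_of_nonneg)
    qed simp
  qed
qed

lemma cutoff_integrable:
  assumes "x \<in> orthant N"
  shows "set_integrable lborel I (\<lambda>u. w u * (cutoff F n (\<tau> u x) - cutoff F n x))"
    "set_integrable lborel I (\<lambda>u. w u * (F (\<tau> u x) - F x))"
proof -
  show "set_integrable lborel I (\<lambda>u. w u * (cutoff F n (\<tau> u x) - cutoff F n x))"
    by (rule jump_integrable[OF assms, where g="\<lambda>y. max (y - inverse (real (Suc n))) 0"])
      (simp add: cutoff_def, simp, auto simp: max_def abs_if)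
  show "set_integrable lborel I (\<lambda>u. w u * (F (\<tau> u x) - F x))"
    by (rule jump_integrable[OF assms, where g="\<lambda>y. y"]) simp_all
qed

text \<open>The limits \<open>a\<close> and \<open>b\<close> are left abstract, so that one
  application of dominated convergence serves convergent configurations and, with both limits 0,
  escaping ones.\<close>

lemma jump_term_limit:
  assumes X: "\<And>n. X n \<in> orthant N"
    and lim: "\<And>u. u \<in> I \<Longrightarrow> (\<lambda>n. F (\<tau> u (X n))) \<longlonglongrightarrow> a u" "(\<lambda>n. F (X n)) \<longlonglongrightarrow> b"
    and a: "(\<lambda>u. indicator I u *\<^sub>R (w u * (a u - b))) \<in> borel_measurable borel"
  shows "(\<lambda>n. jump_term I w \<tau> F (X n)) \<longlonglongrightarrow> (LBINT u:I. w u * (a u - b))"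
  unfolding jump_term_def set_lebesgue_integral_def
proof (rule integral_dominated_convergence[OF _ _ dominating])
  show "(\<lambda>u. indicator I u *\<^sub>R (w u * (a u - b))) \<in> borel_measurable lborel" using a by simp
  show "(\<lambda>u. indicator I u *\<^sub>R (w u * (F (\<tau> u (X n)) - F (X n)))) \<in> borel_measurable lborel" for n
    using meas[of "X n"] I w(1) by simp
  show "AE u in lborel. (\<lambda>n. indicator I u *\<^sub>R (w u * (F (\<tau> u (X n)) - F (X n)))) \<longlonglongrightarrow> indicator I u *\<^sub>R (w u * (a u - b))"
  proof (rule AE_I2)
    fix u show "(\<lambda>n. indicator I u *\<^sub>R (w u * (F (\<tau> u (X n)) - F (X n)))) \<longlonglongrightarrow> indicator I u *\<^sub>R (w u * (a u - b))"
      by (cases "u \<in> I") (auto intro!: tendsto_intros lim)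
  qed
  show "AE u in lborel. norm (indicator I u *\<^sub>R (w u * (F (\<tau> u (X n)) - F (X n)))) \<le> indicator I u *\<^sub>R (C * (u * w u))" for n
  proof (rule AE_I2)
    fix u :: real
    show "norm (indicator I u *\<^sub>R (w u * (F (\<tau> u (X n)) - F (X n)))) \<le> indicator I u *\<^sub>R (C * (u * w u))"
    proof (cases "u \<in> I")
      case True
      from weighted_est(1)[OF X True est[OF True X]] show ?thesis using True
        by (simp only: indicator_simps scaleR_one real_norm_def)
    qed simp
  qed
qed

lemma seq_C0_jump_term: "seq_C0 N (jump_term I w \<tau> F)"
  unfolding seq_C0_def
proof (intro conjI allI impI)
  fix X x assume conv: "converges N X x"
  then have X: "\<And>n. X n \<in> orthant N" and x: "x \<in> orthant N" by (auto simp: converges_def)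
  have "converges N (\<lambda>n. \<tau> u (X n)) (\<tau> u x)" if u: "u \<in> I" for u
    using cont[OF u conv] \<tau>[OF u X] \<tau>[OF u x] by (simp add: converges_def)
  then have "(\<lambda>n. F (\<tau> u (X n))) \<longlonglongrightarrow> F (\<tau> u x)" if "u \<in> I" for u
    using F that by (simp add: seq_C0_def)
  moreover have "(\<lambda>n. F (X n)) \<longlonglongrightarrow> F x" using F conv by (simp add: seq_C0_def)
  moreover have "(\<lambda>u. indicator I u *\<^sub>R (w u * (F (\<tau> u x) - F x))) \<in> borel_measurable borel"
    using meas[of x] I w(1) by simp
  ultimately show "(\<lambda>n. jump_term I w \<tau> F (X n)) \<longlonglongrightarrow> jump_term I w \<tau> F x"
    unfolding jump_term_def[of _ _ _ _ x] by (rule jump_term_limit[OF X])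
next
  fix X assume esc: "escapes N X"
  then have X: "\<And>n. X n \<in> orthant N"
    and lim: "filterlim (\<lambda>n. \<Sum>i\<in>{1..N}. X n i) at_top sequentially" by (auto simp: escapes_def)
  have "escapes N (\<lambda>n. \<tau> u (X n))" if u: "u \<in> I" for u
  proof -
    have "filterlim (\<lambda>n. c u * (\<Sum>i\<in>{1..N}. X n i)) at_top sequentially"
      by (rule filterlim_tendsto_pos_mult_at_top[OF tendsto_const c[OF u] lim])
    then have "filterlim (\<lambda>n. \<Sum>i\<in>{1..N}. \<tau> u (X n) i) at_top sequentially"
    proof (rule filterlim_at_top_mono, intro always_eventually allI)
      fix n show "c u * (\<Sum>i\<in>{1..N}. X n i) \<le> (\<Sum>i\<in>{1..N}. \<tau> u (X n) i)"
        unfolding sum_distrib_left by (intro sum_mono grow[OF u X])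
    qed
    then show ?thesis using \<tau>[OF u X] by (simp add: escapes_def)
  qed
  then have "(\<lambda>n. F (\<tau> u (X n))) \<longlonglongrightarrow> 0" if "u \<in> I" for u using F that by (simp add: seq_C0_def)
  moreover have "(\<lambda>n. F (X n)) \<longlonglongrightarrow> 0" using F esc by (simp add: seq_C0_def)
  moreover have "(\<lambda>u. indicator I u *\<^sub>R (w u * (0 - 0))) \<in> borel_measurable borel"
    by (simp only: diff_zero mult_zero_right scaleR_zero_right borel_measurable_const)
  ultimately have "(\<lambda>n. jump_term I w \<tau> F (X n)) \<longlonglongrightarrow> (LBINT u:I. w u * (0 - 0))"
    by (rule jump_term_limit[OF X])
  then show "(\<lambda>n. jump_term I w \<tau> F (X n)) \<longlonglongrightarrow> 0" by simp
qed

text \<open>The error is bounded by the integral of a function of \<open>u\<close> alone, which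
  makes the convergence uniform in the configuration.\<close>

lemma uniform_limit_cutoff:
  "uniform_limit (orthant N) (\<lambda>n. jump_term I w \<tau> (cutoff F n)) (jump_term I w \<tau> F) sequentially"
proof (cases "\<exists>x. x \<in> orthant N")
  case True
  then obtain x0 where x0: "x0 \<in> orthant N" by blast
  \<comment> \<open>The bound of \<open>cutoff_remainder_diff\<close> combined with
    \<open>est\<close>: it tends to 0 pointwise and is dominated by
    \<open>C * (u * w u)\<close>.\<close>
  define b where "b n u = indicator I u *\<^sub>R (w u * min (inverse (real (Suc n))) (C * u))" for n :: nat and u
  have bm: "b n \<in> borel_measurable lborel" for n unfolding b_def using I w(1) by simp
  have bb: "norm (b n u) \<le> indicator I u *\<^sub>R (C * (u * w u))" for n u
  proof (cases "u \<in> I")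
    case True
    have "\<bar>min (inverse (real (Suc n))) (C * u)\<bar> \<le> C * u"
      using C_nonneg[OF x0 True] by (simp add: min_def del: of_nat_Suc)
    from weighted_est(1)[OF x0 True this] show ?thesis using True
      by (simp only: b_def indicator_simps scaleR_one real_norm_def)
  qed (simp add: b_def)
  have bi: "integrable lborel (b n)" for n
    by (rule Bochner_Integration.integrable_bound[OF dominating bm]) (use bb in \<open>auto intro!: AE_I2 order_trans[OF _ abs_ge_self]\<close>)
  have "(\<lambda>n. integral\<^sup>L lborel (b n)) \<longlonglongrightarrow> (\<integral>u. 0 \<partial>(lborel :: real measure))"
  proof (rule integral_dominated_convergence[OF _ bm dominating])
    show "AE u in lborel. (\<lambda>n. b n u) \<longlonglongrightarrow> 0"
    proof (rule AE_I2)
      fix u show "(\<lambda>n. b n u) \<longlonglongrightarrow> 0"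
      proof (cases "u \<in> I")
        case True
        have "(\<lambda>n. w u * min (inverse (real (Suc n))) (C * u)) \<longlonglongrightarrow> w u * min 0 (C * u)"
          by (intro tendsto_intros LIMSEQ_inverse_real_of_nat)
        then show ?thesis using True C_nonneg[OF x0 True] by (simp add: b_def)
      qed (simp add: b_def)
    qed
    show "AE u in lborel. norm (b n u) \<le> indicator I u *\<^sub>R (C * (u * w u))" for n
      using bb by (intro AE_I2)
  qed simp
  then have lim: "(\<lambda>n. integral\<^sup>L lborel (b n)) \<longlonglongrightarrow> 0" by simp
  have le: "\<bar>jump_term I w \<tau> (cutoff F n) x - jump_term I w \<tau> F x\<bar> \<le> integral\<^sup>L lborel (b n)"
    if x: "x \<in> orthant N" for n x
  proof -
    have "jump_term I w \<tau> (cutoff F n) x - jump_term I w \<tau> F x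
      = (LBINT u:I. w u * (cutoff F n (\<tau> u x) - cutoff F n x) - w u * (F (\<tau> u x) - F x))"
      unfolding jump_term_def by (rule set_integral_diff(2)[symmetric]) (rule cutoff_integrable[OF x])+
    also have "\<bar>\<dots>\<bar> \<le> integral\<^sup>L lborel (b n)"
      unfolding set_lebesgue_integral_def
    proof (rule order_trans[OF integral_abs_bound integral_mono])
      show "integrable lborel (\<lambda>u. \<bar>indicator I u *\<^sub>R (w u * (cutoff F n (\<tau> u x) - cutoff F n x) - w u * (F (\<tau> u x) - F x))\<bar>)"
        using set_integral_diff(1)[OF cutoff_integrable[OF x]] unfolding set_integrable_def by (rule integrable_abs)
      fix u :: real
      show "\<bar>indicator I u *\<^sub>R (w u * (cutoff F n (\<tau> u x) - cutoff F n x) - w u * (F (\<tau> u x) - F x))\<bar> \<le> b n u"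
      proof (cases "u \<in> I")
        case True
        have "\<bar>(cutoff F n (\<tau> u x) - cutoff F n x) - (F (\<tau> u x) - F x)\<bar> \<le> min (inverse (real (Suc n))) (C * u)"
          using cutoff_remainder_diff[of F "\<tau> u x" x n] F_nonneg[OF x] F_nonneg[OF \<tau>[OF True x]] est[OF True x]
          by linarith
        then have "w u * \<bar>(cutoff F n (\<tau> u x) - cutoff F n x) - (F (\<tau> u x) - F x)\<bar> \<le> w u * min (inverse (real (Suc n))) (C * u)"
          using w(2)[OF True] by (rule mult_left_mono)
        then show ?thesis using True w(2)[OF True]
          by (simp only: b_def indicator_simps scaleR_one right_diff_distrib[symmetric] abs_mult abs_of_nonneg)
      qed (simp add: b_def)
    qed (rule bi)
    finally show ?thesis .
  qed
  show ?thesis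
  proof (rule uniform_limitI)
    fix e :: real assume "0 < e"
    then have "\<forall>\<^sub>F n in sequentially. integral\<^sup>L lborel (b n) < e" by (rule order_tendstoD(2)[OF lim])
    then show "\<forall>\<^sub>F n in sequentially. \<forall>x\<in>orthant N.
       dist (jump_term I w \<tau> (cutoff F n) x) (jump_term I w \<tau> F x) < e"
      by eventually_elim (use le in \<open>auto simp: dist_real_def intro: le_less_trans\<close>)
  qed
qed (auto intro!: uniform_limitI)

end

section \<open>The hidden parameter model\<close>

context profile begin

lemma q_tendsto:
  assumes "(\<lambda>n. y n) \<longlonglongrightarrow> z" "\<And>n. 0 \<le> y n" "0 \<le> z"
  shows "(\<lambda>n. q (y n)) \<longlonglongrightarrow> q z"
proof -
  have "(\<lambda>n. \<bar>y n - z\<bar>) \<longlonglongrightarrow> 0" using assms(1) by (simp add: LIM_zero tendsto_rabs_zero)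
  then have "(\<lambda>n. q (y n) - q z) \<longlonglongrightarrow> 0"
    by (rule Lim_null_comparison[rotated]) (use q_abs_diff assms in auto)
  then show ?thesis by (simp add: LIM_zero_iff)
qed

text \<open>By \<open>q_decay\<close>, each factor alone already gives
  \<open>E N s x * x i \<le> 1 / s i\<close>. The sum turns this into decay in the quantity that
  defines escape to infinity.\<close>

lemma E_times_sum_le:
  assumes "s \<in> params N" "x \<in> orthant N"
  shows "E N s x * (\<Sum>i\<in>{1..N}. x i) \<le> (\<Sum>i\<in>{1..N}. 1 / s i)"
  unfolding sum_distrib_left
proof (rule sum_mono)
  fix i assume i: "i \<in> {1..N}"
  have s: "0 < s i" and x: "0 \<le> x i" using params_pos[OF assms(1) i] config_nonneg[OF assms(2) i] by auto
  show "E N s x * x i \<le> 1 / s i"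
  proof (cases "x i = 0")
    case False
    then have x0: "0 < x i" using x by simp
    have "E N s x * x i \<le> q (s i * x i) * x i"
      using E_le_q[OF assms(2) params_nonneg[OF assms(1)] i] x by (rule mult_right_mono)
    also have "\<dots> \<le> 1 / (s i * x i) * x i" using s x0 by (intro mult_right_mono q_decay) auto
    also have "\<dots> = 1 / s i" using x0 by simp
    finally show ?thesis .
  qed (use s in simp)
qed

lemma E_seq_C0:
  assumes s: "s \<in> params N" shows "seq_C0 N (E N s)"
  unfolding seq_C0_def
proof (intro conjI allI impI)
  fix X x assume c: "converges N X x"
  show "(\<lambda>n. E N s (X n)) \<longlonglongrightarrow> E N s x"
    unfolding E_def
  proof (intro tendsto_prod q_tendsto)
    fix i assume i: "i \<in> {1..N}"
    show "(\<lambda>n. s i * X n i) \<longlonglongrightarrow> s i * x i" using c i by (intro tendsto_intros) (simp add: converges_def)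
    show "0 \<le> s i * X n i" for n
      using c i by (intro mult_nonneg_nonneg params_nonneg[OF s] config_nonneg) (auto simp: converges_def)
    show "0 \<le> s i * x i"
      using c i by (intro mult_nonneg_nonneg params_nonneg[OF s] config_nonneg) (auto simp: converges_def)
  qed
next
  fix X assume esc: "escapes N X"
  then have X: "\<And>n. X n \<in> orthant N"
    and lim: "filterlim (\<lambda>n. \<Sum>i\<in>{1..N}. X n i) at_top sequentially" by (auto simp: escapes_def)
  have "(\<lambda>n. (\<Sum>i\<in>{1..N}. 1 / s i) / (\<Sum>i\<in>{1..N}. X n i)) \<longlonglongrightarrow> 0"
    by (rule tendsto_divide_0[OF tendsto_const filterlim_at_top_imp_at_infinity[OF lim]])
  moreover have "\<forall>\<^sub>F n in sequentially. norm (E N s (X n)) \<le> (\<Sum>i\<in>{1..N}. 1 / s i) / (\<Sum>i\<in>{1..N}. X n i)"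
  proof -
    have "\<forall>\<^sub>F n in sequentially. 0 < (\<Sum>i\<in>{1..N}. X n i)"
      using lim by (simp add: filterlim_at_top_dense)
    then show ?thesis
    proof eventually_elim
      case (elim n)
      then show ?case using E_times_sum_le[OF s X, of n] E_params(1)[OF X s, of n] by (simp add: pos_le_divide_eq)
    qed
  qed
  ultimately show "(\<lambda>n. E N s (X n)) \<longlonglongrightarrow> 0" by (rule Lim_null_comparison[rotated])
qed

text \<open>The sum of the parameters dominates every single \<open>s i\<close> and serves as
  Lipschitz constant. Once \<open>x i\<close> exceeds \<open>(n + 1) / s i\<close>,
  \<open>q_decay\<close> puts the product below the height of the cutoff.\<close>

lemma cutoff_E_test_function:
  assumes s: "s \<in> params N" shows "cutoff (E N s) n \<in> test_functions N"
proof -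
  let ?C = "\<Sum>i\<in>{1..N}. s i"
  have "\<bar>cutoff (E N s) n x - cutoff (E N s) n y\<bar> \<le> ?C * (\<Sum>i\<in>{1..N}. \<bar>x i - y i\<bar>)"
    if x: "x \<in> orthant N" and y: "y \<in> orthant N" for x y
  proof -
    have p: "0 \<le> s i * x i" "0 \<le> s i * y i" if "i \<in> {1..N}" for i
      using params_nonneg[OF s] config_nonneg[OF x that] config_nonneg[OF y that] by auto
    have "\<bar>cutoff (E N s) n x - cutoff (E N s) n y\<bar> \<le> \<bar>E N s x - E N s y\<bar>" by (rule cutoff_diff)
    also have "\<dots> \<le> (\<Sum>i\<in>{1..N}. \<bar>q (s i * x i) - q (s i * y i)\<bar>)" by (rule E_abs_diff) (use p in auto)
    also have "\<dots> \<le> (\<Sum>i\<in>{1..N}. ?C * \<bar>x i - y i\<bar>)"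
    proof (rule sum_mono)
      fix i assume i: "i \<in> {1..N}"
      have "\<bar>q (s i * x i) - q (s i * y i)\<bar> \<le> \<bar>s i * x i - s i * y i\<bar>" by (rule q_abs_diff[OF p[OF i]])
      also have "\<dots> = s i * \<bar>x i - y i\<bar>"
        using params_nonneg[OF s, of i] by (simp only: right_diff_distrib[symmetric] abs_mult abs_of_nonneg)
      also have "\<dots> \<le> ?C * \<bar>x i - y i\<bar>" by (intro mult_right_mono params_le_sum[OF s]) simp
      finally show "\<bar>q (s i * x i) - q (s i * y i)\<bar> \<le> ?C * \<bar>x i - y i\<bar>" .
    qed
    finally show ?thesis by (simp only: sum_distrib_left)
  qed
  moreover have "cutoff (E N s) n x = 0"
    if x: "x \<in> orthant N" and i: "i \<in> {1..N}" and big: "(\<Sum>i\<in>{1..N}. real (Suc n) / s i) < x i" for x i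
  proof -
    have si: "0 < s i" by (rule params_pos[OF s i])
    have "real (Suc n) / s i \<le> (\<Sum>i\<in>{1..N}. real (Suc n) / s i)"
      using i params_pos[OF s] by (intro member_le_sum) (auto intro: less_imp_le)
    then have "real (Suc n) / s i < x i" using big by linarith
    then have b: "real (Suc n) < s i * x i" using si by (simp add: field_simps)
    then have "0 < s i * x i" using of_nat_0_less_iff[of "Suc n", where 'a=real] by linarith
    have "E N s x \<le> q (s i * x i)" by (rule E_le_q[OF x params_nonneg[OF s] i])
    also have "\<dots> \<le> 1 / (s i * x i)" by (rule q_decay) fact
    also have "\<dots> \<le> inverse (real (Suc n))"
      unfolding inverse_eq_divide using b by (intro divide_left_mono) auto
    finally show ?thesis by (simp add: cutoff_def)
  qed
  ultimately show ?thesis unfolding test_functions_def by blast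
qed

end

section \<open>From jump operators to the graph of the generator\<close>

lemma seq_C0_sum:
  assumes "\<And>j. j \<in> J \<Longrightarrow> seq_C0 N (f j)"
  shows "seq_C0 N (\<lambda>x. \<Sum>j\<in>J. f j x)"
  unfolding seq_C0_def
proof (intro conjI allI impI)
  show "(\<lambda>n. \<Sum>j\<in>J. f j (X n)) \<longlonglongrightarrow> (\<Sum>j\<in>J. f j x)" if "converges N X x" for X x
    by (rule tendsto_sum) (use assms that in \<open>auto simp: seq_C0_def\<close>)
  show "(\<lambda>n. \<Sum>j\<in>J. f j (X n)) \<longlonglongrightarrow> 0" if "escapes N X" for X
    by (rule tendsto_null_sum) (use assms that in \<open>auto simp: seq_C0_def\<close>)
qed

lemma uniform_limit_finite_sum:
  fixes f :: "'j \<Rightarrow> 'n \<Rightarrow> 'x \<Rightarrow> real"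
  assumes "finite J" "\<And>j. j \<in> J \<Longrightarrow> uniform_limit X (f j) (g j) A"
  shows "uniform_limit X (\<lambda>n x. \<Sum>j\<in>J. f j n x) (\<lambda>x. \<Sum>j\<in>J. g j x) A"
  using assms
proof (induction J)
  case empty
  then show ?case by (simp add: uniform_limit_const)
next
  case (insert j J)
  then show ?case by (simp add: uniform_limit_add)
qed

text \<open>The generator is the closure of \<open>L\<close> on the test functions, so it suffices
  that the cutoffs of \<open>F\<close> and their images under \<open>L\<close> both converge
  uniformly.\<close>

lemma generator_graph_of_jumps:
  fixes I :: "'j \<Rightarrow> real set"
  assumes P: "markov_semigroup_with_generator (config_space N) (test_functions N) L P"
    and J: "finite J"
    and F: "seq_C0 N F" "\<And>x. x \<in> orthant N \<Longrightarrow> 0 \<le> F x"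
    and test: "\<And>n. cutoff F n \<in> test_functions N"
    and jump: "\<And>j. j \<in> J \<Longrightarrow> jump N F (I j) (w j) (\<tau> j) (c j) (C j)"
    and L: "\<And>n x. x \<in> orthant N \<Longrightarrow>
      L (cutoff F n) x = (\<Sum>j\<in>J. jump_term (I j) (w j) (\<tau> j) (cutoff F n) x)"
    and G: "\<And>x. x \<in> orthant N \<Longrightarrow> (\<Sum>j\<in>J. jump_term (I j) (w j) (\<tau> j) F x) = G x"
  shows "generator_graph (config_space N) P F G"
proof (rule generator_graph_cong[OF _ G])
  let ?G = "\<lambda>x. \<Sum>j\<in>J. jump_term (I j) (w j) (\<tau> j) F x"
  have FC0: "F \<in> C0 (orthant N)" by (rule seq_C0_imp_C0[OF F(1)])
  have GC0: "?G \<in> C0 (orthant N)"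
    by (intro seq_C0_imp_C0 seq_C0_sum jump.seq_C0_jump_term[OF jump])
  have 1: "uniform_limit (orthant N) (cutoff F) F sequentially"
  proof (rule uniform_limitI)
    fix e :: real assume "0 < e"
    then have "\<forall>\<^sub>F n in sequentially. inverse (real (Suc n)) < e"
      by (rule order_tendstoD(2)[OF LIMSEQ_inverse_real_of_nat])
    then show "\<forall>\<^sub>F n in sequentially. \<forall>x\<in>orthant N. dist (cutoff F n x) (F x) < e"
    proof eventually_elim
      case (elim n)
      show ?case
      proof
        fix x assume "x \<in> orthant N"
        from cutoff_close[of F x n, OF F(2)[OF this]] elim show "dist (cutoff F n x) (F x) < e"
          unfolding dist_real_def by linarith
      qed
    qed
  qed
  have "uniform_limit (orthant N) (\<lambda>n x. \<Sum>j\<in>J. jump_term (I j) (w j) (\<tau> j) (cutoff F n) x) ?G sequentially"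
    by (intro uniform_limit_finite_sum J jump.uniform_limit_cutoff[OF jump])
  then have 2: "uniform_limit (orthant N) (\<lambda>n. L (cutoff F n)) ?G sequentially"
    by (rule uniform_limit_cong'[THEN iffD1, rotated 2]) (use L in auto)
  have "(\<exists>h :: nat \<Rightarrow> (nat \<Rightarrow> real) \<Rightarrow> real. (\<forall>n. h n \<in> test_functions N) \<and>
           uniform_limit (orthant N) h F sequentially \<and>
           uniform_limit (orthant N) (\<lambda>n. L (h n)) ?G sequentially)"
    by (intro exI[of _ "cutoff F"] conjI allI test 1 2)
  with P FC0 GC0 show "generator_graph (config_space N) P F ?G"
    unfolding markov_semigroup_with_generator_def by simp
qed

text \<open>Both orientations of every bond occur, as well as the edges from the end sites to the
  reservoirs at 0 and \<open>N + 1\<close>; the first component is the site that jumps.\<close>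

definition bonds :: "nat \<Rightarrow> (nat \<times> nat) set" where
  "bonds N = (SIGMA i:{1..N}. {i - 1, i + 1})"

lemma finite_bonds [simp]: "finite (bonds N)"
  by (simp add: bonds_def)

lemma sum_bonds: "(\<Sum>(i, j)\<in>bonds N. a i j) = (\<Sum>i\<in>{1..N}. a i (i - 1) + a i (i + 1 :: nat) :: real)"
  unfolding bonds_def by (subst sum.Sigma[symmetric]) auto

lemma unit_weight:
  "(\<lambda>u::real. 1 / u) \<in> borel_measurable borel"
  "u \<in> {0<..<1} \<Longrightarrow> 0 \<le> 1 / (u::real)"
  "set_integrable lborel {0<..<1} (\<lambda>u::real. u * (1 / u))"
proof -
  have "set_integrable lborel {0<..<1} (\<lambda>u::real. 1::real)" by (simp add: set_integrable_def)
  then show "set_integrable lborel {0<..<1} (\<lambda>u::real. u * (1 / u))"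
    by (rule set_integrable_cong[THEN iffD1, rotated 3]) auto
qed auto

text \<open>The numerator of the difference contains a factor \<open>u\<close>, which cancels the
  rate. What remains is the derivative of \<open>- ln (A + u * (B - A)) / A\<close>.\<close>

lemma log_kernel_integral:
  fixes A B :: real
  assumes "0 < A" "0 < B"
  shows "(LBINT u:{0<..<1}. 1 / u * (1 / (A + u * (B - A)) - 1 / A)) = - (ln B - ln A) / A"
proof -
  have pos: "0 < A + u * (B - A)" if "0 \<le> u" "u \<le> 1" for u
  proof -
    have "A + u * (B - A) = (1 - u) * A + u * B" by (simp add: algebra_simps)
    moreover have "0 < (1 - u) * A + u * B"
      using that assms by (cases "u = 0") (auto intro!: add_nonneg_pos)
    ultimately show ?thesis by simp
  qed
  let ?f = "\<lambda>u. - ((B - A) / (A + u * (B - A)) / A)"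
  have "(LBINT u:{0<..<1}. 1 / u * (1 / (A + u * (B - A)) - 1 / A)) = (LBINT u:{0<..<1}. ?f u)"
  proof (rule set_lebesgue_integral_cong, simp, intro allI impI)
    fix u :: real assume "u \<in> {0<..<1}"
    then show "1 / u * (1 / (A + u * (B - A)) - 1 / A) = ?f u"
      using pos[of u] assms by (simp add: divide_simps; simp add: algebra_simps)
  qed
  also have "\<dots> = (LBINT u=0..1. ?f u)"
    using interval_integral_Ioo[of 0 1 ?f] by (simp add: zero_ereal_def one_ereal_def)
  also have "\<dots> = - (ln (A + 1 * (B - A)) / A) - - (ln (A + 0 * (B - A)) / A)"
    unfolding zero_ereal_def one_ereal_def
  proof (rule interval_integral_FTC_finite)
    show "continuous_on {min 0 1..max 0 1} ?f"
      using pos assms by (intro continuous_intros) (auto simp: less_imp_neq[symmetric])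
    fix x :: real assume "min 0 1 \<le> x" "x \<le> max 0 1"
    then have "0 < A + x * (B - A)" using pos by auto
    then have "((\<lambda>u. ln (A + u * (B - A))) has_real_derivative 1 / (A + x * (B - A)) * (B - A)) (at x within {min 0 1..max 0 1})"
      by (auto intro!: derivative_eq_intros)
    from DERIV_minus[OF DERIV_cdivide[OF this, of A]]
    have "((\<lambda>u. - (ln (A + u * (B - A)) / A)) has_real_derivative ?f x) (at x within {min 0 1..max 0 1})"
      by simp
    then show "((\<lambda>u. - (ln (A + u * (B - A)) / A)) has_vector_derivative ?f x) (at x within {min 0 1..max 0 1})"
      by (simp add: has_real_derivative_iff_has_vector_derivative)
  qed
  finally show ?thesis by (simp add: diff_divide_distrib)
qed

context profile begin

lemma E_update:
  assumes "i \<in> {1..N}"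
  shows "E N s (x(i := y)) = q (s i * y) * (\<Prod>k\<in>{1..N} - {i}. q (s k * x k))"
    "E N (s(i := r)) x = q (r * x i) * (\<Prod>k\<in>{1..N} - {i}. q (s k * x k))"
    "E N s x = q (s i * x i) * (\<Prod>k\<in>{1..N} - {i}. q (s k * x k))"
proof -
  have P: "(\<Prod>k\<in>{1..N}. g k) = g i * (\<Prod>k\<in>{1..N} - {i}. g k)" for g :: "nat \<Rightarrow> real"
    by (rule prod.remove) (use assms in auto)
  show "E N s (x(i := y)) = q (s i * y) * (\<Prod>k\<in>{1..N} - {i}. q (s k * x k))"
    unfolding E_def P by (rule arg_cong2[where f="(*)"]) (auto intro: prod.cong)
  show "E N (s(i := r)) x = q (r * x i) * (\<Prod>k\<in>{1..N} - {i}. q (s k * x k))"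
    unfolding E_def P by (rule arg_cong2[where f="(*)"]) (auto intro: prod.cong)
  show "E N s x = q (s i * x i) * (\<Prod>k\<in>{1..N} - {i}. q (s k * x k))"
    unfolding E_def P ..
qed

lemma rest_bounds:
  assumes s: "s \<in> params N" and x: "x \<in> orthant N"
  shows "0 \<le> (\<Prod>k\<in>{1..N} - {i}. q (s k * x k))" "(\<Prod>k\<in>{1..N} - {i}. q (s k * x k)) \<le> 1"
    "j \<in> {1..N} - {i} \<Longrightarrow> (\<Prod>k\<in>{1..N} - {i}. q (s k * x k)) \<le> q (s j * x j)"
proof -
  have p: "0 \<le> q (s k * x k)" "q (s k * x k) \<le> 1" if "k \<in> {1..N}" for k
    using params_nonneg[OF s, of k] config_nonneg[OF x that] by (auto intro!: less_imp_le[OF q_pos] q_le_1)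
  show "0 \<le> (\<Prod>k\<in>{1..N} - {i}. q (s k * x k))" "(\<Prod>k\<in>{1..N} - {i}. q (s k * x k)) \<le> 1"
    using p by (auto intro!: prod_nonneg prod_le_1)
  assume j: "j \<in> {1..N} - {i}"
  have "(\<Prod>k\<in>{1..N} - {i}. q (s k * x k)) = q (s j * x j) * (\<Prod>k\<in>{1..N} - {i} - {j}. q (s k * x k))"
    using j by (subst prod.remove[of _ j]) auto
  also have "\<dots> \<le> q (s j * x j) * 1"
    using p j by (intro mult_left_mono prod_le_1) auto
  finally show "(\<Prod>k\<in>{1..N} - {i}. q (s k * x k)) \<le> q (s j * x j)" by simp
qed

text \<open>A downward move leaves at least half of \<open>y\<close>, and \<open>q_relative\<close>
  gives a bound independent of \<open>y\<close>. For an upward move only the Lipschitz bound is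
  available; its factor \<open>t\<close> is unbounded and will be absorbed by the factor of the
  neighbour at which \<open>t\<close> is the value.\<close>

lemma q_interpolate_diff:
  assumes "0 < r" "0 \<le> y" "0 \<le> t" "0 \<le> u" "u < 1/2"
  shows "\<bar>q (r * (y - u * y + u * t)) - q (r * y)\<bar> \<le> (if t \<le> y then 2 * u else r * t * u)"
proof (cases "t \<le> y")
  case True
  define z where "z = y - u * y + u * t"
  have z: "z = y - u * (y - t)" by (simp add: z_def algebra_simps)
  then have zy: "z \<le> y" using True assms by simp
  show ?thesis
  proof (cases "y = 0")
    case False
    have "1 / 2 * y \<le> (1 - u) * y" using assms by (intro mult_right_mono) auto
    then have "y / 2 \<le> (1 - u) * y" by simp
    also have "\<dots> \<le> z" using assms by (simp add: z_def algebra_simps)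
    finally have zh: "y / 2 \<le> z" .
    have z0: "0 < z" using zh False assms by linarith
    have le: "r * z \<le> r * y" using zy assms by simp
    have "\<bar>q (r * z) - q (r * y)\<bar> = q (r * z) - q (r * y)"
      using q_antimono[OF _ le] z0 assms by simp
    also have "\<dots> \<le> (r * y - r * z) / (r * z)" using z0 assms le by (intro q_relative) auto
    also have "\<dots> = (y - z) / z" using z0 assms by (simp add: right_diff_distrib[symmetric])
    also have "\<dots> \<le> (u * y) / z"
    proof (rule divide_right_mono)
      have "u * (y - t) \<le> u * y" using assms by (intro mult_left_mono) auto
      then show "y - z \<le> u * y" by (simp add: z)
    qed (use z0 in simp)
    also have "\<dots> \<le> (u * (2 * z)) / z" using z0 zh assms by (intro divide_right_mono mult_left_mono) auto
    also have "\<dots> = 2 * u" using z0 by simp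
    finally show ?thesis using True by (simp add: z_def)
  qed (use True assms in simp)
next
  case False
  have "\<bar>q (r * (y - u * y + u * t)) - q (r * y)\<bar> \<le> \<bar>r * (y - u * y + u * t) - r * y\<bar>"
    using False assms by (intro q_abs_diff mult_nonneg_nonneg add_nonneg_nonneg) (auto simp: mult_left_le_one_le)
  also have "r * (y - u * y + u * t) - r * y = r * (u * (t - y))" by algebra
  also have "\<bar>r * (u * (t - y))\<bar> = r * (u * (t - y))" using False assms by (intro abs_of_nonneg mult_nonneg_nonneg) auto
  also have "\<dots> \<le> r * (u * t)" using assms by (intro mult_left_mono) auto
  finally show ?thesis using False by (simp add: mult_ac)
qed

end

section \<open>Jumps of the hidden parameters\<close>

definition hidden_value :: "nat \<Rightarrow> real \<Rightarrow> real \<Rightarrow> (nat \<Rightarrow> real) \<Rightarrow> nat \<Rightarrow> real" where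
  "hidden_value N a b \<theta> j = (if j = 0 then a else if j = N + 1 then b else \<theta> j)"

definition hidden_jump :: "nat \<Rightarrow> real \<Rightarrow> real \<Rightarrow> nat \<Rightarrow> nat \<Rightarrow> real \<Rightarrow> (nat \<Rightarrow> real) \<Rightarrow> nat \<Rightarrow> real" where
  "hidden_jump N a b i j u \<theta> = \<theta>(i := \<theta> i - u * \<theta> i + u * hidden_value N a b \<theta> j)"

lemma config_update:
  "x \<in> orthant N \<Longrightarrow> i \<in> {1..N} \<Longrightarrow> 0 \<le> y \<Longrightarrow> x(i := y) \<in> orthant N"
  by (auto simp: space_config_space PiE_iff extensional_def)

lemma bonds_cases:
  assumes "(i, j) \<in> bonds N"
  shows "i \<in> {1..N}" "j \<noteq> i" "j \<noteq> 0 \<Longrightarrow> j \<noteq> N + 1 \<Longrightarrow> j \<in> {1..N} - {i}"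
  using assms by (auto simp: bonds_def)

context profile begin

text \<open>The three parts of the constant: 2 covers downward moves and all
  \<open>u \<ge> 1/2\<close>; \<open>s i * (a + b)\<close> covers upward moves towards a reservoir;
  \<open>s i / s j\<close> covers upward moves towards a site \<open>j\<close>, where the factor of
  that site in the product is at most \<open>1 / (s j * x j)\<close> and cancels the unbounded value
  \<open>x j\<close>.\<close>

lemma hidden_jump_E:
  assumes s: "s \<in> params N" and ij: "(i, j) \<in> bonds N" and ab: "0 \<le> a" "0 \<le> b"
  shows "jump N (E N s) {0<..<1} (\<lambda>u. 1 / u) (hidden_jump N a b i j) (\<lambda>u. 1 - u)
    (2 + s i * (a + b) + (if j = 0 \<or> j = N + 1 then 0 else s i / s j))"
proof
  note i = bonds_cases(1)[OF ij]
  have si: "0 < s i" by (rule params_pos[OF s i])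
  have t0: "0 \<le> hidden_value N a b x j" if "x \<in> orthant N" for x
    using ab bonds_cases(3)[OF ij] config_nonneg[OF that] by (auto simp: hidden_value_def)
  have y0: "0 \<le> x i - u * x i + u * hidden_value N a b x j" "(1 - u) * x i \<le> x i - u * x i + u * hidden_value N a b x j"
    if "x \<in> orthant N" "u \<in> {0<..<1}" for x u
  proof -
    have "0 \<le> (1 - u) * x i" "0 \<le> u * hidden_value N a b x j"
      using config_nonneg[OF that(1) i] t0[OF that(1)] that(2) by auto
    then show "0 \<le> x i - u * x i + u * hidden_value N a b x j" "(1 - u) * x i \<le> x i - u * x i + u * hidden_value N a b x j"
      by (auto simp: algebra_simps)
  qed
  show "seq_C0 N (E N s)" by (rule E_seq_C0[OF s])
  show "0 \<le> E N s x" if "x \<in> orthant N" for x by (rule E_params(1)[OF that s])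
  show "(\<lambda>u::real. 1 / u) \<in> borel_measurable borel" "set_integrable lborel {0<..<1} (\<lambda>u::real. u * (1 / u))"
    by (rule unit_weight)+
  show "0 \<le> 1 / u" if "u \<in> {0<..<1}" for u :: real by (rule unit_weight(2)[OF that])
  show "hidden_jump N a b i j u x \<in> orthant N" if "u \<in> {0<..<1}" "x \<in> orthant N" for u x
    unfolding hidden_jump_def by (rule config_update[OF that(2) i y0(1)[OF that(2,1)]])
  show "(1 - u) * x k \<le> hidden_jump N a b i j u x k"
    if "u \<in> {0<..<1}" "x \<in> orthant N" "k \<in> {1..N}" for u x k
    using y0(2)[OF that(2,1)] config_nonneg[OF that(2,3)] that(1)
    by (auto simp: hidden_jump_def mult_left_le_one_le)
  show "(\<lambda>n. hidden_jump N a b i j u (X n) k) \<longlonglongrightarrow> hidden_jump N a b i j u x k"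
    if "u \<in> {0<..<1}" "converges N X x" "k \<in> {1..N}" for u X x k
  proof -
    have l: "(\<lambda>n. X n k) \<longlonglongrightarrow> x k" if "k \<in> {1..N}" for k using \<open>converges N X x\<close> that by (simp add: converges_def)
    have "(\<lambda>n. hidden_value N a b (X n) j) \<longlonglongrightarrow> hidden_value N a b x j"
      using l[of j] bonds_cases(3)[OF ij] by (cases "j = 0 \<or> j = N + 1") (auto simp: hidden_value_def)
    then have "(\<lambda>n. X n i - u * X n i + u * hidden_value N a b (X n) j) \<longlonglongrightarrow> x i - u * x i + u * hidden_value N a b x j"
      by (intro tendsto_intros l i)
    then show ?thesis using l[OF that(3)] by (cases "k = i") (simp_all add: hidden_jump_def)
  qed
  show "(\<lambda>u. E N s (hidden_jump N a b i j u x)) \<in> borel_measurable borel" for x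
    unfolding hidden_jump_def E_update(1)[OF i]
    by (intro borel_measurable_times borel_measurable_const measurable_compose[OF _ q_measurable]) simp
  show "\<bar>E N s (hidden_jump N a b i j u x) - E N s x\<bar>
      \<le> (2 + s i * (a + b) + (if j = 0 \<or> j = N + 1 then 0 else s i / s j)) * u"
    if u: "u \<in> {0<..<1}" and x: "x \<in> orthant N" for u x
  proof (cases "u < 1/2")
    case True
    define R where "R = (\<Prod>k\<in>{1..N} - {i}. q (s k * x k))"
    define t where "t = hidden_value N a b x j"
    define d where "d = q (s i * (x i - u * x i + u * t)) - q (s i * x i)"
    have R: "0 \<le> R" "R \<le> 1" "j \<in> {1..N} - {i} \<Longrightarrow> R \<le> q (s j * x j)"
      unfolding R_def by (rule rest_bounds[OF s x], assumption?)+
    have xi: "0 \<le> x i" by (rule config_nonneg[OF x i])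
    have t: "0 \<le> t" unfolding t_def by (rule t0[OF x])
    have d: "\<bar>d\<bar> \<le> (if t \<le> x i then 2 * u else s i * t * u)"
      unfolding d_def by (rule q_interpolate_diff[OF si xi t]) (use u True in auto)
    have "E N s (hidden_jump N a b i j u x) - E N s x = d * R"
      unfolding hidden_jump_def E_update(1)[OF i] E_update(3)[OF i, of s x] d_def R_def t_def by (simp only: left_diff_distrib)
    then have eq: "\<bar>E N s (hidden_jump N a b i j u x) - E N s x\<bar> = \<bar>d\<bar> * R" using R(1) by (simp only: abs_mult abs_of_nonneg)
    have p: "0 \<le> 2 * u" "0 \<le> s i * (a + b) * u" "0 \<le> s i / s j * u"
      using u ab si params_nonneg[OF s, of j] by auto
    have "\<bar>d\<bar> * R \<le> 2 * u + s i * (a + b) * u + (if j = 0 \<or> j = N + 1 then 0 else s i / s j * u)"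
    proof (cases "t \<le> x i")
      case True
      have "\<bar>d\<bar> * R \<le> (2 * u) * 1" using d R True u by (intro mult_mono) auto
      then show ?thesis using p by auto
    next
      case False
      then have d': "\<bar>d\<bar> \<le> s i * t * u" using d by simp
      show ?thesis
      proof (cases "j = 0 \<or> j = N + 1")
        case True
        have tab: "t \<le> a + b" using True ab by (auto simp: t_def hidden_value_def)
        have "\<bar>d\<bar> * R \<le> (s i * t * u) * 1" using d' R u si t by (intro mult_mono) auto
        also have "\<dots> \<le> s i * (a + b) * u"
          unfolding mult_1_right using tab u si by (intro mult_right_mono mult_left_mono) auto
        finally show ?thesis using p True by simp
      next
        case jn: False
        then have j: "j \<in> {1..N} - {i}" using bonds_cases(3)[OF ij] by auto
        then have sj: "0 < s j" by (intro params_pos[OF s]) auto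
        have tj: "t = x j" using jn by (simp add: t_def hidden_value_def)
        have t0: "0 < t" using False xi by linarith
        have "R \<le> 1 / (s j * t)"
          using R(3)[OF j] q_decay[of "s j * t"] sj t0 by (simp add: tj)
        then have "\<bar>d\<bar> * R \<le> (s i * t * u) * (1 / (s j * t))" using d' R u si t by (intro mult_mono) auto
        also have "\<dots> = s i / s j * u" using t0 by simp
        finally show ?thesis using p jn by simp
      qed
    qed
    then show ?thesis unfolding eq
      by (cases "j = 0 \<or> j = N + 1") (simp_all only: if_True if_False distrib_right mult_zero_left)
  next
    case False
    have "hidden_jump N a b i j u x \<in> orthant N"
      unfolding hidden_jump_def by (rule config_update[OF x i y0(1)[OF x u]])
    from E_params[OF this s] E_params[OF x s]
    have "\<bar>E N s (hidden_jump N a b i j u x) - E N s x\<bar> \<le> 1" by linarith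
    also have "\<dots> \<le> 2 * u" using False by simp
    also have "\<dots> \<le> (2 + s i * (a + b) + (if j = 0 \<or> j = N + 1 then 0 else s i / s j)) * u"
      using u ab si params_nonneg[OF s, of j] by (intro mult_right_mono) auto
    finally show ?thesis .
  qed
qed auto

end

section \<open>Duality for the profile \<open>1 / (1 + y)\<close>\<close>

interpretation stieltjes: profile "\<lambda>y. 1 / (1 + y)"
proof
  fix y z :: real
  have e: "1 / (1 + y) - 1 / (1 + z) = (z - y) * (1 / ((1 + y) * (1 + z)))" if "0 \<le> y" "y \<le> z"
    using that by (simp add: field_simps)
  show "1 / (1 + y) - 1 / (1 + z) \<le> z - y" if "0 \<le> y" "y \<le> z"
  proof -
    have "1 * 1 \<le> (1 + y) * (1 + z)" using that by (intro mult_mono) auto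
    then have "(z - y) * (1 / ((1 + y) * (1 + z))) \<le> (z - y) * 1" using that by (intro mult_left_mono) auto
    then show ?thesis using e[OF that] by simp
  qed
  show "1 / (1 + y) - 1 / (1 + z) \<le> (z - y) / y" if "0 < y" "y \<le> z"
  proof -
    have "y * 1 \<le> (1 + y) * (1 + z)" using that by (intro mult_mono) auto
    then have "1 / ((1 + y) * (1 + z)) \<le> 1 / y" using that by (intro divide_left_mono) auto
    then have "(z - y) * (1 / ((1 + y) * (1 + z))) \<le> (z - y) * (1 / y)" using that by (intro mult_left_mono) auto
    then show ?thesis using e that by simp
  qed
qed (auto simp: divide_simps)

text \<open>Along the jump, \<open>1 + s i * x i\<close> becomes an affine function of
  \<open>u\<close>, so the logarithmic kernel integral applies. It is equally affine when
  \<open>s i\<close> moves instead of \<open>x i\<close>, which is why the dual term has the same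
  form with the other index exchanged.\<close>

lemma stieltjes_jump_term:
  assumes s: "s \<in> params N" and i: "i \<in> {1..N}" and x: "x \<in> orthant N" and t: "0 \<le> hidden_value N a b x j"
  shows "jump_term {0<..<1} (\<lambda>u. 1 / u) (hidden_jump N a b i j) (stieltjes.E N s) x
    = stieltjes.E N s x * (ln (1 + s i * x i) - ln (1 + s i * hidden_value N a b x j))"
proof -
  define R where "R = (\<Prod>k\<in>{1..N} - {i}. 1 / (1 + s k * x k))"
  define A B where "A = 1 + s i * x i" and "B = 1 + s i * hidden_value N a b x j"
  have pos: "0 < A" "0 < B"
    using params_nonneg[OF s, of i] config_nonneg[OF x i] t by (auto simp: A_def B_def intro!: add_pos_nonneg)
  have "1 / u * (stieltjes.E N s (hidden_jump N a b i j u x) - stieltjes.E N s x)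
     = R * (1 / u * (1 / (A + u * (B - A)) - 1 / A))" for u
  proof -
    have arg: "1 + s i * (x i - u * x i + u * hidden_value N a b x j) = A + u * (B - A)"
      unfolding A_def B_def by (simp only: algebra_simps; simp)
    show ?thesis
      unfolding hidden_jump_def stieltjes.E_update(1)[OF i] stieltjes.E_update(3)[OF i, of s x] arg R_def[symmetric] A_def[symmetric]
      by (simp only: algebra_simps)
  qed
  then have "jump_term {0<..<1} (\<lambda>u. 1 / u) (hidden_jump N a b i j) (stieltjes.E N s) x
     = R * (- (ln B - ln A) / A)"
    unfolding jump_term_def by (simp only: set_integral_mult_right log_kernel_integral[OF pos])
  also have "\<dots> = (1 / A * R) * (ln A - ln B)" by simp
  also have "1 / A * R = stieltjes.E N s x"
    unfolding stieltjes.E_update(3)[OF i, of s x] R_def A_def ..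
  finally show ?thesis by (simp only: A_def B_def)
qed

lemma stieltjes_dual_term:
  assumes s: "s \<in> params N" and i: "i \<in> {1..N}" and x: "x \<in> orthant N"
  shows "dual_term (\<lambda>s. stieltjes.E N s x) s i j = stieltjes.E N s x * (ln (1 + s i * x i) - ln (1 + s j * x i))"
proof -
  define R where "R = (\<Prod>k\<in>{1..N} - {i}. 1 / (1 + s k * x k))"
  define A B where "A = 1 + s i * x i" and "B = 1 + s j * x i"
  have pos: "0 < A" "0 < B"
    using params_nonneg[OF s] config_nonneg[OF x i] by (auto simp: A_def B_def intro!: add_pos_nonneg)
  have "(stieltjes.E N (move s i j u) x - stieltjes.E N s x) / u
     = R * (1 / u * (1 / (A + u * (B - A)) - 1 / A))" for u
  proof -
    have arg: "1 + (s i + u * (s j - s i)) * x i = A + u * (B - A)"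
      unfolding A_def B_def by (simp only: algebra_simps; simp)
    show ?thesis
      unfolding move_def stieltjes.E_update(2)[OF i] stieltjes.E_update(3)[OF i, of s x] arg R_def[symmetric] A_def[symmetric]
      by (simp add: diff_divide_distrib algebra_simps)
  qed
  then have "dual_term (\<lambda>s. stieltjes.E N s x) s i j = R * (- (ln B - ln A) / A)"
    unfolding dual_term_def by (simp only: set_integral_mult_right log_kernel_integral[OF pos])
  also have "\<dots> = (1 / A * R) * (ln A - ln B)" by simp
  also have "1 / A * R = stieltjes.E N s x"
    unfolding stieltjes.E_update(3)[OF i, of s x] R_def A_def ..
  finally show ?thesis by (simp only: A_def B_def)
qed

definition potential :: "nat \<Rightarrow> real \<Rightarrow> real \<Rightarrow> (nat \<Rightarrow> real) \<Rightarrow> real" where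
  "potential N a b s = ln (1 + a * s 1) + ln (1 + b * s N)"

lemma hidden_value_nonneg:
  "0 \<le> a \<Longrightarrow> 0 \<le> b \<Longrightarrow> x \<in> orthant N \<Longrightarrow> (i, j) \<in> bonds N \<Longrightarrow> 0 \<le> hidden_value N a b x j"
  using bonds_cases(3)[of i j N] config_nonneg[of x N j] by (auto simp: hidden_value_def)

text \<open>With \<open>l i j = ln (1 + s i * v j)\<close>, the operator on configurations subtracts
  \<open>l i j\<close> and the one on parameters subtracts \<open>l j i\<close> over the oriented
  edges. Inside the chain both orientations of each bond occur, so the two sums agree there. At the
  reservoirs the first yields \<open>l 1 0 + l N (N + 1)\<close>, the potential, and the second
  yields \<open>ln 1 = 0\<close>, as \<open>s\<close> vanishes there.\<close>

lemma hidden_duality: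
  assumes N: "N \<ge> 1" and s: "s \<in> params N" and x: "x \<in> orthant N" and ab: "0 \<le> a" "0 \<le> b"
  shows "(\<Sum>(i, j)\<in>bonds N. jump_term {0<..<1} (\<lambda>u. 1 / u) (hidden_jump N a b i j) (stieltjes.E N s) x)
    = dual_op N (\<lambda>s. stieltjes.E N s x) s - potential N a b s * stieltjes.E N s x"
proof -
  define F where "F = stieltjes.E N s x"
  define v where "v = hidden_value N a b x"
  define l where "l i j = ln (1 + s i * v j)" for i j
  have v: "v i = x i" if "i \<in> {1..N}" for i using that by (auto simp: v_def hidden_value_def)
  have j: "jump_term {0<..<1} (\<lambda>u. 1 / u) (hidden_jump N a b i j) (stieltjes.E N s) x = F * (l i i - l i j)"
    if "(i, j) \<in> bonds N" for i j
    using stieltjes_jump_term[OF s bonds_cases(1)[OF that] x hidden_value_nonneg[OF ab x that]] v[OF bonds_cases(1)[OF that]]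
    by (simp add: F_def l_def v_def)
  have d: "dual_term (\<lambda>s. stieltjes.E N s x) s i j = F * (l i i - l j i)" if "i \<in> {1..N}" for i j
    using stieltjes_dual_term[OF s that x] v[OF that] by (simp add: F_def l_def)
  have s0: "s 0 = 0" "s (N + 1) = 0" using s by (auto simp: params_def)
  have "(\<Sum>i\<in>{1..N}. l i (i - 1) + l i (i + 1)) = l 1 0 + l N (N + 1) + (\<Sum>i\<in>{1..<N}. l i (i + 1) + l (i + 1) i)"
    by (rule sum_neighbours[OF N])
  moreover have "(\<Sum>i\<in>{1..N}. l (i - 1) i + l (i + 1) i) = l 0 1 + l (N + 1) N + (\<Sum>i\<in>{1..<N}. l (i + 1) i + l i (i + 1))"
    by (rule sum_neighbours[OF N, of "\<lambda>i j. l j i"])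
  moreover have "l 0 1 = 0" "l (N + 1) N = 0" using s0 by (simp_all add: l_def)
  moreover have "potential N a b s = l 1 0 + l N (N + 1)"
    by (simp add: potential_def l_def v_def hidden_value_def mult.commute)
  ultimately have sums: "(\<Sum>i\<in>{1..N}. l i (i - 1) + l i (i + 1)) = (\<Sum>i\<in>{1..N}. l (i - 1) i + l (i + 1) i) + potential N a b s"
    by (simp add: add.commute)
  have "(\<Sum>(i, j)\<in>bonds N. jump_term {0<..<1} (\<lambda>u. 1 / u) (hidden_jump N a b i j) (stieltjes.E N s) x)
     = (\<Sum>(i, j)\<in>bonds N. F * (l i i - l i j))"
    by (rule sum.cong[OF refl]) (auto simp: j)
  also have "\<dots> = (\<Sum>i\<in>{1..N}. F * (l i i - l i (i - 1)) + F * (l i i - l i (i + 1)))" by (rule sum_bonds)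
  also have "\<dots> = F * ((\<Sum>i\<in>{1..N}. 2 * l i i) - (\<Sum>i\<in>{1..N}. l i (i - 1) + l i (i + 1)))"
    unfolding sum_subtractf[symmetric] sum_distrib_left by (intro sum.cong refl) (simp only: algebra_simps mult_2)
  also have "\<dots> = F * ((\<Sum>i\<in>{1..N}. 2 * l i i) - (\<Sum>i\<in>{1..N}. l (i - 1) i + l (i + 1) i)) - potential N a b s * F"
    unfolding sums by (simp only: algebra_simps)
  also have "F * ((\<Sum>i\<in>{1..N}. 2 * l i i) - (\<Sum>i\<in>{1..N}. l (i - 1) i + l (i + 1) i))
     = (\<Sum>i\<in>{1..N}. F * (l i i - l (i - 1) i) + F * (l i i - l (i + 1) i))"
    unfolding sum_subtractf[symmetric] sum_distrib_left by (intro sum.cong refl) (simp only: algebra_simps mult_2)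
  also have "\<dots> = dual_op N (\<lambda>s. stieltjes.E N s x) s"
    unfolding dual_op_def by (rule sum.cong[OF refl]) (simp only: d)
  finally show ?thesis by (simp only: F_def)
qed

lemma hidden_generator_eq:
  assumes N: "N \<ge> 1" and s: "s \<in> params N" and x: "x \<in> orthant N" and ab: "0 \<le> a" "0 \<le> b"
  shows "hidden_generator N a b (cutoff (stieltjes.E N s) n) x
    = (\<Sum>(i, j)\<in>bonds N. jump_term {0<..<1} (\<lambda>u. 1 / u) (hidden_jump N a b i j) (cutoff (stieltjes.E N s) n) x)"
proof -
  define f where "f = cutoff (stieltjes.E N s) n"
  define T where "T i j = jump_term {0<..<1} (\<lambda>u. 1 / u) (hidden_jump N a b i j) f x" for i j
  \<comment> \<open>Integrability of each single jump, needed because the bond operator puts both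
    jumps under one integral.\<close>
  have int: "set_integrable lborel {0<..<1} (\<lambda>u. 1 / u * (f (hidden_jump N a b i j u x) - f x))"
    if "(i, j) \<in> bonds N" for i j
    unfolding f_def by (rule jump.cutoff_integrable(1)[OF stieltjes.hidden_jump_E[OF s that ab] x])
  have b1: "hidden_boundary 1 a f x = T 1 0"
    unfolding hidden_boundary_def T_def jump_term_def hidden_jump_def hidden_value_def by simp
  have b2: "hidden_boundary N b f x = T N (N + 1)"
    unfolding hidden_boundary_def T_def jump_term_def hidden_jump_def hidden_value_def by simp
  have bb: "hidden_bond i f x = T i (i + 1) + T (i + 1) i" if i: "i \<in> {1..<N}" for i
  proof -
    have m: "(i, i + 1) \<in> bonds N" "(i + 1, i) \<in> bonds N" using i by (auto simp: bonds_def)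
    have v: "hidden_value N a b x (i + 1) = x (i + 1)" "hidden_value N a b x i = x i"
      using i by (auto simp: hidden_value_def)
    have "T i (i + 1) + T (i + 1) i = (LBINT u:{0<..<1}. 1 / u * (f (hidden_jump N a b i (i + 1) u x) - f x)
       + 1 / u * (f (hidden_jump N a b (i + 1) i u x) - f x))"
      unfolding T_def jump_term_def by (rule set_integral_add(2)[OF int[OF m(1)] int[OF m(2)], symmetric])
    also have "\<dots> = hidden_bond i f x"
      unfolding hidden_bond_def hidden_jump_def v
      by (rule set_lebesgue_integral_cong) (simp_all add: add_divide_distrib diff_divide_distrib)
    finally show ?thesis by simp
  qed
  have "hidden_generator N a b f x = T 1 0 + T N (N + 1) + (\<Sum>i\<in>{1..<N}. T i (i + 1) + T (i + 1) i)"
    unfolding hidden_generator_def b1 b2 using bb by simp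
  also have "\<dots> = (\<Sum>i\<in>{1..N}. T i (i - 1) + T i (i + 1))" by (rule sum_neighbours[OF N, symmetric])
  also have "\<dots> = (\<Sum>(i, j)\<in>bonds N. T i j)" by (rule sum_bonds[symmetric])
  finally show ?thesis by (simp only: f_def T_def)
qed

lemma hidden_generator_graph:
  assumes N: "N \<ge> 1" and s: "s \<in> params N" and ab: "0 \<le> a" "0 \<le> b"
    and P: "markov_semigroup_with_generator (config_space N) (test_functions N) (hidden_generator N a b) P"
  shows "generator_graph (config_space N) P (stieltjes.E N s)
    (\<lambda>x. dual_op N (\<lambda>s. stieltjes.E N s x) s - potential N a b s * stieltjes.E N s x)"
proof (rule generator_graph_of_jumps[OF P finite_bonds[of N] stieltjes.E_seq_C0[OF s] stieltjes.E_params(1)[OF _ s]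
      stieltjes.cutoff_E_test_function[OF s]])
  show "jump N (stieltjes.E N s) {0<..<1} (\<lambda>u. 1 / u) (\<lambda>u. case p of (i, j) \<Rightarrow> hidden_jump N a b i j u)
     (\<lambda>u. 1 - u) (case p of (i, j) \<Rightarrow> 2 + s i * (a + b) + (if j = 0 \<or> j = N + 1 then 0 else s i / s j))"
    if "p \<in> bonds N" for p
    using stieltjes.hidden_jump_E[OF s _ ab] that by (cases p) simp
  show "hidden_generator N a b (cutoff (stieltjes.E N s) n) x
     = (\<Sum>p\<in>bonds N. jump_term {0<..<1} (\<lambda>u. 1 / u) (\<lambda>u. case p of (i, j) \<Rightarrow> hidden_jump N a b i j u) (cutoff (stieltjes.E N s) n) x)"
    if "x \<in> orthant N" for n x
    unfolding hidden_generator_eq[OF N s that ab] by (rule sum.cong) auto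
  show "(\<Sum>p\<in>bonds N. jump_term {0<..<1} (\<lambda>u. 1 / u) (\<lambda>u. case p of (i, j) \<Rightarrow> hidden_jump N a b i j u) (stieltjes.E N s) x)
     = dual_op N (\<lambda>s. stieltjes.E N s x) s - potential N a b s * stieltjes.E N s x"
    if "x \<in> orthant N" for x
    unfolding hidden_duality[OF N s that ab, symmetric] by (rule sum.cong) auto
qed

section \<open>The harmonic model\<close>

interpretation laplace: profile "\<lambda>y. exp (- y)"
proof
  fix y z :: real
  have e: "exp (- y) - exp (- z) = exp (- y) * (1 - exp (- (z - y)))"
    by (simp add: right_diff_distrib exp_add[symmetric])
  have le: "0 \<le> 1 - exp (- (z - y))" "1 - exp (- (z - y)) \<le> z - y" if "y \<le> z"
  proof -
    show "0 \<le> 1 - exp (- (z - y))" using that by simp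
    show "1 - exp (- (z - y)) \<le> z - y" using exp_ge_add_one_self[of "- (z - y)"] by linarith
  qed
  have ey: "exp (- y) \<le> 1 / y" if "0 < y"
  proof -
    have "y \<le> exp y" using exp_ge_add_one_self[of y] by linarith
    then show ?thesis using that by (simp add: exp_minus field_simps)
  qed
  show "exp (- y) - exp (- z) \<le> z - y" if "0 \<le> y" "y \<le> z"
  proof -
    have "exp (- y) * (1 - exp (- (z - y))) \<le> 1 * (z - y)" using that le by (intro mult_mono) auto
    then show ?thesis using e by simp
  qed
  show "exp (- y) - exp (- z) \<le> (z - y) / y" if "0 < y" "y \<le> z"
  proof -
    have "exp (- y) * (1 - exp (- (z - y))) \<le> (1 / y) * (z - y)" using that le ey by (intro mult_mono) auto
    then show ?thesis using e by simp
  qed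
  show "exp (- y) \<le> 1 / y" if "0 < y" using ey that .
qed auto

text \<open>A target outside of the chain is a reservoir, and what is sent there leaves the system.
  Mass entering from a reservoir is described separately by \<open>injection\<close>.\<close>

definition harmonic_jump :: "nat \<Rightarrow> nat \<Rightarrow> nat \<Rightarrow> real \<Rightarrow> (nat \<Rightarrow> real) \<Rightarrow> nat \<Rightarrow> real" where
  "harmonic_jump N i j u \<zeta> = (if j \<in> {1..N} then \<zeta>(i := \<zeta> i - u * \<zeta> i, j := \<zeta> j + u * \<zeta> i)
     else \<zeta>(i := \<zeta> i - u * \<zeta> i))"

definition injection :: "nat \<Rightarrow> real \<Rightarrow> real \<Rightarrow> (nat \<Rightarrow> real) \<Rightarrow> nat \<Rightarrow> real" where
  "injection i a u \<zeta> = \<zeta>(i := \<zeta> i + u * a)"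

lemma laplace_E: "laplace.E N s x = exp (- (\<Sum>i\<in>{1..N}. s i * x i))"
  unfolding laplace.E_def by (simp add: exp_sum sum_negf[symmetric])

lemma sum_update:
  fixes s x :: "nat \<Rightarrow> real"
  assumes "i \<in> {1..N}"
  shows "(\<Sum>k\<in>{1..N}. s k * (x(i := y)) k) = (\<Sum>k\<in>{1..N}. s k * x k) + s i * (y - x i)"
    "(\<Sum>k\<in>{1..N}. (s(i := r)) k * x k) = (\<Sum>k\<in>{1..N}. s k * x k) + (r - s i) * x i"
proof -
  have "(\<Sum>k\<in>{1..N}. s k * (x(i := y)) k) - (\<Sum>k\<in>{1..N}. s k * x k) = (\<Sum>k\<in>{1..N}. if k = i then s i * (y - x i) else 0)"
    unfolding sum_subtractf[symmetric] by (rule sum.cong) (auto simp: algebra_simps)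
  then show "(\<Sum>k\<in>{1..N}. s k * (x(i := y)) k) = (\<Sum>k\<in>{1..N}. s k * x k) + s i * (y - x i)" using assms by simp
  have "(\<Sum>k\<in>{1..N}. (s(i := r)) k * x k) - (\<Sum>k\<in>{1..N}. s k * x k) = (\<Sum>k\<in>{1..N}. if k = i then (r - s i) * x i else 0)"
    unfolding sum_subtractf[symmetric] by (rule sum.cong) (auto simp: algebra_simps)
  then show "(\<Sum>k\<in>{1..N}. (s(i := r)) k * x k) = (\<Sum>k\<in>{1..N}. s k * x k) + (r - s i) * x i" using assms by simp
qed

text \<open>Moving \<open>u * x i\<close> from \<open>i\<close> to \<open>j\<close> changes the
  pairing of \<open>s\<close> and \<open>x\<close> by \<open>u * (s j - s i) * x i\<close>, exactly
  as moving \<open>s i\<close> towards \<open>s j\<close> does. For a reservoir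
  \<open>s j = 0\<close>, which matches the loss of the mass. The duality thus holds already for
  each single jump, before integration.\<close>

lemma harmonic_jump_duality:
  assumes s: "s \<in> params N" and ij: "(i, j) \<in> bonds N"
  shows "laplace.E N s (harmonic_jump N i j u x) = laplace.E N (move s i j u) x"
proof -
  note i = bonds_cases(1)[OF ij]
  have "(\<Sum>k\<in>{1..N}. s k * harmonic_jump N i j u x k) = (\<Sum>k\<in>{1..N}. s k * x k) + u * (s j - s i) * x i"
  proof (cases "j \<in> {1..N}")
    case True
    have "(\<Sum>k\<in>{1..N}. s k * harmonic_jump N i j u x k)
       = (\<Sum>k\<in>{1..N}. s k * x k) + s i * ((x i - u * x i) - x i) + s j * ((x j + u * x i) - (x(i := x i - u * x i)) j)"
      unfolding harmonic_jump_def if_P[OF True] sum_update(1)[OF True] sum_update(1)[OF i] ..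
    then show ?thesis using bonds_cases(2)[OF ij] by (simp add: algebra_simps)
  next
    case False
    then have "s j = 0" using s by (simp add: params_def)
    then show ?thesis
      unfolding harmonic_jump_def if_not_P[OF False] sum_update(1)[OF i] by (simp add: algebra_simps)
  qed
  then show ?thesis unfolding laplace_E move_def sum_update(2)[OF i] by (simp add: algebra_simps)
qed

text \<open>By duality the estimate linear in \<open>u\<close> is that of \<open>E_move_diff\<close>
  for the moved parameter.\<close>

lemma harmonic_jump_E:
  assumes s: "s \<in> params N" and ij: "(i, j) \<in> bonds N"
  shows "jump N (laplace.E N s) {0<..<1} (\<lambda>u. 1 / u) (harmonic_jump N i j) (\<lambda>u. 1 - u) (2 + 2 * \<bar>s j - s i\<bar> / s i)"
proof
  note i = bonds_cases(1)[OF ij]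
  have y0: "0 \<le> x i - u * x i" "(1 - u) * x i \<le> x i - u * x i" "0 \<le> u * x i"
    if "x \<in> orthant N" "u \<in> {0<..<1}" for x u
    using config_nonneg[OF that(1) i] that(2) by (auto simp: algebra_simps mult_left_le_one_le)
  show "seq_C0 N (laplace.E N s)" by (rule laplace.E_seq_C0[OF s])
  show "0 \<le> laplace.E N s x" if "x \<in> orthant N" for x by (rule laplace.E_params(1)[OF that s])
  show "(\<lambda>u::real. 1 / u) \<in> borel_measurable borel" "set_integrable lborel {0<..<1} (\<lambda>u::real. u * (1 / u))"
    by (rule unit_weight)+
  show "0 \<le> 1 / u" if "u \<in> {0<..<1}" for u :: real by (rule unit_weight(2)[OF that])
  show "harmonic_jump N i j u x \<in> orthant N" if u: "u \<in> {0<..<1}" and x: "x \<in> orthant N" for u x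
  proof -
    have 1: "x(i := x i - u * x i) \<in> orthant N" by (rule config_update[OF x i y0(1)[OF x u]])
    show ?thesis
    proof (cases "j \<in> {1..N}")
      case True
      have "0 \<le> x j + u * x i" using config_nonneg[OF x True] y0(3)[OF x u] by simp
      then show ?thesis unfolding harmonic_jump_def if_P[OF True] by (rule config_update[OF 1 True])
    next
      case False
      show ?thesis unfolding harmonic_jump_def if_not_P[OF False] by (rule 1)
    qed
  qed
  show "(1 - u) * x k \<le> harmonic_jump N i j u x k"
    if u: "u \<in> {0<..<1}" and x: "x \<in> orthant N" and k: "k \<in> {1..N}" for u x k
  proof -
    have "(1 - u) * x k \<le> x k" "(1 - u) * x k \<le> x k + u * x i"
      using config_nonneg[OF x k] y0(3)[OF x u] u by (auto simp: mult_left_le_one_le intro: add_increasing2)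
    then show ?thesis using y0(2)[OF x u] bonds_cases(2)[OF ij] unfolding harmonic_jump_def fun_upd_apply
      by (auto split: if_splits)
  qed
  show "(\<lambda>n. harmonic_jump N i j u (X n) k) \<longlonglongrightarrow> harmonic_jump N i j u x k"
    if "u \<in> {0<..<1}" "converges N X x" "k \<in> {1..N}" for u X x k
  proof -
    have l: "(\<lambda>n. X n k) \<longlonglongrightarrow> x k" if "k \<in> {1..N}" for k using \<open>converges N X x\<close> that by (simp add: converges_def)
    show ?thesis
    proof (cases "j \<in> {1..N}")
      case True
      then show ?thesis
        unfolding harmonic_jump_def if_P[OF True] fun_upd_apply
        by (cases "k = j"; cases "k = i") (auto intro!: tendsto_intros l i that(3))
    next
      case False
      then show ?thesis
        unfolding harmonic_jump_def if_not_P[OF False] fun_upd_apply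
        by (cases "k = i") (auto intro!: tendsto_intros l i that(3))
    qed
  qed
  show "(\<lambda>u. laplace.E N s (harmonic_jump N i j u x)) \<in> borel_measurable borel" for x
    unfolding harmonic_jump_duality[OF s ij] move_def laplace.E_update(2)[OF i]
    by (intro borel_measurable_times borel_measurable_const measurable_compose[OF _ laplace.q_measurable]) simp
  show "\<bar>laplace.E N s (harmonic_jump N i j u x) - laplace.E N s x\<bar> \<le> (2 + 2 * \<bar>s j - s i\<bar> / s i) * u"
    if "u \<in> {0<..<1}" "x \<in> orthant N" for u x
    unfolding harmonic_jump_duality[OF s ij] by (rule laplace.E_move_diff[OF s i that(2)]) (use that(1) in auto)
qed auto

section \<open>Injection of mass by the reservoirs\<close>

lemma exp_weight:
  "(\<lambda>u::real. exp (- u) / u) \<in> borel_measurable borel"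
  "u \<in> {0<..} \<Longrightarrow> 0 \<le> exp (- u) / (u::real)"
  "set_integrable lborel {0<..} (\<lambda>u::real. u * (exp (- u) / u))"
proof -
  have "set_integrable lborel (einterval (ereal 0) \<infinity>) (\<lambda>u::real. exp (- u))"
  proof (rule interval_integral_FTC_nonneg(1)[where F="\<lambda>u. - exp (- u)" and A="- exp (- 0)" and B=0])
    show "DERIV (\<lambda>u. - exp (- u)) x :> exp (- x)" for x :: real by (auto intro!: derivative_eq_intros)
    show "(((\<lambda>u. - exp (- u)) \<circ> real_of_ereal) \<longlongrightarrow> - exp (- 0)) (at_right (ereal 0))"
      by (simp add: ereal_tendsto_simps) (rule tendsto_eq_intros refl | simp)+
    have "((\<lambda>u. exp (- u)) \<longlongrightarrow> (0::real)) at_top"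
      by (rule filterlim_compose[OF exp_at_bot filterlim_uminus_at_bot_at_top])
    then have "((\<lambda>u. - exp (- u)) \<longlongrightarrow> (- 0::real)) at_top" by (rule tendsto_minus)
    then show "(((\<lambda>u. - exp (- u)) \<circ> real_of_ereal) \<longlongrightarrow> 0) (at_left \<infinity>)"
      by (simp add: ereal_tendsto_simps)
  qed auto
  moreover have "einterval (ereal 0) \<infinity> = {0<..}" by (auto simp: einterval_def)
  ultimately have "set_integrable lborel {0<..} (\<lambda>u::real. exp (- u))" by simp
  then show "set_integrable lborel {0<..} (\<lambda>u::real. u * (exp (- u) / u))"
    by (rule set_integrable_cong[THEN iffD1, rotated 3]) auto
qed auto

lemma injection_E:
  assumes s: "s \<in> params N" and i: "i \<in> {1..N}" and a: "0 \<le> a"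
  shows "jump N (laplace.E N s) {0<..} (\<lambda>u. exp (- u) / u) (injection i a) (\<lambda>u. 1) (s i * a)"
proof
  show "seq_C0 N (laplace.E N s)" by (rule laplace.E_seq_C0[OF s])
  show "0 \<le> laplace.E N s x" if "x \<in> orthant N" for x by (rule laplace.E_params(1)[OF that s])
  show "(\<lambda>u::real. exp (- u) / u) \<in> borel_measurable borel" "set_integrable lborel {0<..} (\<lambda>u::real. u * (exp (- u) / u))"
    by (rule exp_weight)+
  show "0 \<le> exp (- u) / u" if "u \<in> {0<..}" for u :: real by (rule exp_weight(2)[OF that])
  show "injection i a u x \<in> orthant N" if "u \<in> {0<..}" "x \<in> orthant N" for u x
    unfolding injection_def using config_nonneg[OF that(2) i] that a by (intro config_update i) auto
  show "1 * x k \<le> injection i a u x k" if "u \<in> {0<..}" "x \<in> orthant N" "k \<in> {1..N}" for u x k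
    using that a by (simp add: injection_def)
  show "(\<lambda>n. injection i a u (X n) k) \<longlonglongrightarrow> injection i a u x k"
    if "u \<in> {0<..}" "converges N X x" "k \<in> {1..N}" for u X x k
  proof -
    have "(\<lambda>n. X n k) \<longlonglongrightarrow> x k" using that by (simp add: converges_def)
    then show ?thesis unfolding injection_def fun_upd_apply by (cases "k = i") (auto intro!: tendsto_intros)
  qed
  show "(\<lambda>u. laplace.E N s (injection i a u x)) \<in> borel_measurable borel" for x
    unfolding injection_def laplace.E_update(1)[OF i]
    by (intro borel_measurable_times borel_measurable_const measurable_compose[OF _ laplace.q_measurable]) simp
  show "\<bar>laplace.E N s (injection i a u x) - laplace.E N s x\<bar> \<le> s i * a * u"
    if u: "u \<in> {0<..}" and x: "x \<in> orthant N" for u x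
  proof -
    define R where "R = (\<Prod>k\<in>{1..N} - {i}. exp (- (s k * x k)))"
    have R: "0 \<le> R" "R \<le> 1" unfolding R_def by (rule laplace.rest_bounds[OF s x])+
    have si: "0 < s i" by (rule params_pos[OF s i])
    have xi: "0 \<le> x i" by (rule config_nonneg[OF x i])
    have "\<bar>exp (- (s i * (x i + u * a))) - exp (- (s i * x i))\<bar> \<le> \<bar>s i * (x i + u * a) - s i * x i\<bar>"
      using si xi u a by (intro laplace.q_abs_diff) auto
    also have "\<dots> = s i * a * u" using si u a by (simp add: algebra_simps)
    finally have "\<bar>exp (- (s i * (x i + u * a))) - exp (- (s i * x i))\<bar> * R \<le> (s i * a * u) * 1"
      using R si u a by (intro mult_mono) auto
    moreover have "laplace.E N s (injection i a u x) - laplace.E N s x = (exp (- (s i * (x i + u * a))) - exp (- (s i * x i))) * R"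
      unfolding injection_def laplace.E_update(1)[OF i] laplace.E_update(3)[OF i, of s x] R_def by (simp only: left_diff_distrib)
    ultimately show ?thesis using R(1) by (simp only: abs_mult abs_of_nonneg mult_1_right)
  qed
qed auto

text \<open>Frullani's integral, by writing \<open>(1 - exp (- u b)) / u\<close> as the integral of \<open>exp (- u r)\<close> over \<open>r\<close> in \<open>[0, b]\<close>.\<close>

lemma frullani_log:
  fixes b :: real
  assumes b: "0 \<le> b"
  shows "(LBINT u:{0<..}. exp (- u) / u * (exp (- (u * b)) - 1)) = - ln (1 + b)"
proof -
  define k where "k u r = ennreal (exp (- (u * (1 + r)))) * indicator {0<..} u * indicator {0..b} r" for u r :: real
  have km: "(\<lambda>(u, r). k u r) \<in> borel_measurable (lborel \<Otimes>\<^sub>M lborel)" unfolding k_def case_prod_unfold by measurable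
  have inner: "(\<integral>\<^sup>+r. k u r \<partial>lborel) = ennreal (exp (- u) / u * (1 - exp (- (u * b)))) * indicator {0<..} u" for u
  proof (cases "0 < u")
    case True
    have "(\<integral>\<^sup>+r. ennreal (exp (- (u * (1 + r)))) * indicator {0..b} r \<partial>lborel)
       = ennreal (- exp (- (u * (1 + b))) / u - - exp (- (u * (1 + 0))) / u)"
      by (rule nn_integral_FTC_Icc[OF _ _ _ b]) (use True in \<open>auto intro!: derivative_eq_intros\<close>)
    also have "- exp (- (u * (1 + b))) / u - - exp (- (u * (1 + 0))) / u = exp (- u) / u * (1 - exp (- (u * b)))"
    proof -
      define X Y where "X = exp (- u)" and "Y = exp (- (u * b))"
      have XY: "exp (- (u * (1 + b))) = X * Y" "exp (- (u * (1 + 0))) = X"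
        by (simp_all add: X_def Y_def exp_add[symmetric] algebra_simps)
      show ?thesis
        unfolding XY X_def[symmetric] Y_def[symmetric] using True by (simp add: field_simps)
    qed
    finally show ?thesis using True by (simp add: k_def)
  qed (simp add: k_def)
  have outer: "(\<integral>\<^sup>+u. k u r \<partial>lborel) = ennreal (1 / (1 + r)) * indicator {0..b} r" for r
  proof (cases "r \<in> {0..b}")
    case True
    then have r: "0 < 1 + r" by auto
    have "((\<lambda>u. exp (- (u * (1 + r)))) \<longlongrightarrow> 0) at_top"
      by (rule filterlim_compose[OF exp_at_bot])
        (use r in \<open>auto simp: filterlim_uminus_at_bot intro!: filterlim_at_top_mult_tendsto_pos[OF tendsto_const] filterlim_ident\<close>)
    then have lim: "((\<lambda>u. - exp (- (u * (1 + r))) / (1 + r)) \<longlongrightarrow> 0) at_top"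
      using tendsto_divide[OF tendsto_minus tendsto_const, of _ "0::real" at_top "1 + r"] r by simp
    have "(\<integral>\<^sup>+u. ennreal (exp (- (u * (1 + r)))) * indicator {0<..} u \<partial>lborel)
      = (\<integral>\<^sup>+u. ennreal (exp (- (u * (1 + r)))) * indicator {0..} u \<partial>lborel)"
    proof (rule nn_integral_cong_AE)
      have "AE u in lborel. u \<noteq> (0::real)" by (rule AE_lborel_singleton)
      then show "AE u in lborel. ennreal (exp (- (u * (1 + r)))) * indicator {0<..} u = ennreal (exp (- (u * (1 + r)))) * indicator {0..} u"
        by eventually_elim (auto simp: indicator_def)
    qed
    also have "\<dots> = ennreal (0 - - exp (- (0 * (1 + r))) / (1 + r))"
    proof (rule nn_integral_FTC_atLeast[OF _ _ _ lim])
      have d: "((\<lambda>u. - exp (- (u * c)) / c) has_real_derivative exp (- (x * c))) (at x)" if "0 < c" for c x :: real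
        using that by (auto intro!: derivative_eq_intros)
      show "((\<lambda>u. - exp (- (u * (1 + r))) / (1 + r)) has_real_derivative exp (- (x * (1 + r)))) (at x)" for x
        by (rule d[OF r])
    qed simp_all
    finally show ?thesis using True by (simp add: k_def)
  qed (simp add: k_def)
  have "(\<integral>\<^sup>+u. \<integral>\<^sup>+r. k u r \<partial>lborel \<partial>lborel) = (\<integral>\<^sup>+r. \<integral>\<^sup>+u. k u r \<partial>lborel \<partial>lborel)"
    using lborel_pair.Fubini'[OF km] by simp
  also have "\<dots> = (\<integral>\<^sup>+r. ennreal (1 / (1 + r)) * indicator {0..b} r \<partial>lborel)" by (simp only: outer)
  also have "\<dots> = ennreal (ln (1 + b) - ln (1 + 0))"
    by (rule nn_integral_FTC_Icc[OF _ _ _ b]) (auto intro!: derivative_eq_intros)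
  finally have nn: "(\<integral>\<^sup>+u. ennreal (exp (- u) / u * (1 - exp (- (u * b)))) * indicator {0<..} u \<partial>lborel) = ennreal (ln (1 + b))"
    by (simp add: inner)
  have "(LBINT u:{0<..}. exp (- u) / u * (1 - exp (- (u * b)))) = enn2real (\<integral>\<^sup>+u. ennreal (indicator {0<..} u *\<^sub>R (exp (- u) / u * (1 - exp (- (u * b))))) \<partial>lborel)"
    unfolding set_lebesgue_integral_def
    by (rule integral_eq_nn_integral) (use b in \<open>auto intro!: AE_I2 simp: indicator_def\<close>)
  also have "(\<integral>\<^sup>+u. ennreal (indicator {0<..} u *\<^sub>R (exp (- u) / u * (1 - exp (- (u * b))))) \<partial>lborel) = ennreal (ln (1 + b))"
    unfolding nn[symmetric] by (rule nn_integral_cong) (auto simp: indicator_def)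
  finally have I: "(LBINT u:{0<..}. exp (- u) / u * (1 - exp (- (u * b)))) = ln (1 + b)" using b by simp
  have "(LBINT u:{0<..}. exp (- u) / u * (exp (- (u * b)) - 1)) = (LBINT u:{0<..}. - 1 * (exp (- u) / u * (1 - exp (- (u * b)))))"
    by (rule set_lebesgue_integral_cong) (simp_all add: algebra_simps diff_divide_distrib)
  also have "\<dots> = - 1 * ln (1 + b)" by (simp only: set_integral_mult_right I)
  finally show ?thesis by simp
qed

text \<open>An injection of \<open>u * a\<close> multiplies the exponential by
  \<open>exp (- (u * (a * s i)))\<close>, so the product function is an eigenfunction, with the
  eigenvalue given by Frullani's integral. The two injections together produce the
  potential.\<close>

lemma injection_term:
  assumes s: "s \<in> params N" and i: "i \<in> {1..N}" and a: "0 \<le> a"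
  shows "jump_term {0<..} (\<lambda>u. exp (- u) / u) (injection i a) (laplace.E N s) x = - ln (1 + a * s i) * laplace.E N s x"
proof -
  have b: "0 \<le> a * s i" using a params_nonneg[OF s] by simp
  have "exp (- u) / u * (laplace.E N s (injection i a u x) - laplace.E N s x)
    = laplace.E N s x * (exp (- u) / u * (exp (- (u * (a * s i))) - 1))" for u
  proof -
    have "laplace.E N s (injection i a u x) = laplace.E N s x * exp (- (u * (a * s i)))"
      unfolding laplace_E injection_def sum_update(1)[OF i] by (simp add: exp_add[symmetric] algebra_simps)
    then show ?thesis by (simp only: algebra_simps)
  qed
  then have "jump_term {0<..} (\<lambda>u. exp (- u) / u) (injection i a) (laplace.E N s) x = laplace.E N s x * - ln (1 + a * s i)"
    unfolding jump_term_def by (simp only: set_integral_mult_right frullani_log[OF b])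
  then show ?thesis by (simp only: mult.commute)
qed

section \<open>Assembling the harmonic generator from its jumps\<close>

lemma harmonic_generator_eq:
  assumes N: "N \<ge> 1" and s: "s \<in> params N" and x: "x \<in> orthant N"
  shows "harmonic_generator N a b (cutoff (laplace.E N s) n) x
    = (\<Sum>(i, j)\<in>bonds N. jump_term {0<..<1} (\<lambda>u. 1 / u) (harmonic_jump N i j) (cutoff (laplace.E N s) n) x)
      + jump_term {0<..} (\<lambda>u. exp (- u) / u) (injection 1 a) (cutoff (laplace.E N s) n) x
      + jump_term {0<..} (\<lambda>u. exp (- u) / u) (injection N b) (cutoff (laplace.E N s) n) x"
proof -
  define f where "f = cutoff (laplace.E N s) n"
  define T where "T i j = jump_term {0<..<1} (\<lambda>u. 1 / u) (harmonic_jump N i j) f x" for i j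
  define K where "K i a = jump_term {0<..} (\<lambda>u. exp (- u) / u) (injection i a) f x" for i a
  have int: "set_integrable lborel {0<..<1} (\<lambda>u. 1 / u * (f (harmonic_jump N i j u x) - f x))"
    if "(i, j) \<in> bonds N" for i j
    unfolding f_def by (rule jump.cutoff_integrable(1)[OF harmonic_jump_E[OF s that] x])
  have b1: "harmonic_boundary 1 a f x = T 1 0 + K 1 a"
    unfolding harmonic_boundary_def T_def K_def jump_term_def harmonic_jump_def injection_def by simp
  have b2: "harmonic_boundary N b f x = T N (N + 1) + K N b"
    unfolding harmonic_boundary_def T_def K_def jump_term_def harmonic_jump_def injection_def by simp
  have bb: "harmonic_bond i f x = T i (i + 1) + T (i + 1) i" if i: "i \<in> {1..<N}" for i
  proof -
    have m: "(i, i + 1) \<in> bonds N" "(i + 1, i) \<in> bonds N" using i by (auto simp: bonds_def)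
    have v: "harmonic_jump N i (i + 1) u x = x(i := x i - u * x i, i + 1 := x (i + 1) + u * x i)"
      "harmonic_jump N (i + 1) i u x = x(i + 1 := x (i + 1) - u * x (i + 1), i := x i + u * x (i + 1))" for u
      using i by (auto simp: harmonic_jump_def)
    have "T i (i + 1) + T (i + 1) i = (LBINT u:{0<..<1}. 1 / u * (f (harmonic_jump N i (i + 1) u x) - f x)
       + 1 / u * (f (harmonic_jump N (i + 1) i u x) - f x))"
      unfolding T_def jump_term_def by (rule set_integral_add(2)[OF int[OF m(1)] int[OF m(2)], symmetric])
    also have "\<dots> = harmonic_bond i f x"
      unfolding harmonic_bond_def v
      by (rule set_lebesgue_integral_cong) (simp_all add: add_divide_distrib diff_divide_distrib)
    finally show ?thesis by simp
  qed
  have "harmonic_generator N a b f x = (T 1 0 + T N (N + 1) + (\<Sum>i\<in>{1..<N}. T i (i + 1) + T (i + 1) i)) + K 1 a + K N b"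
    unfolding harmonic_generator_def b1 b2 using bb by simp
  also have "T 1 0 + T N (N + 1) + (\<Sum>i\<in>{1..<N}. T i (i + 1) + T (i + 1) i) = (\<Sum>i\<in>{1..N}. T i (i - 1) + T i (i + 1))"
    by (rule sum_neighbours[OF N, symmetric])
  also have "\<dots> = (\<Sum>(i, j)\<in>bonds N. T i j)" by (rule sum_bonds[symmetric])
  finally show ?thesis by (simp only: f_def T_def K_def)
qed

lemma harmonic_generator_graph:
  assumes N: "N \<ge> 1" and s: "s \<in> params N" and ab: "0 \<le> a" "0 \<le> b"
    and P: "markov_semigroup_with_generator (config_space N) (test_functions N) (harmonic_generator N a b) P"
  shows "generator_graph (config_space N) P (laplace.E N s)
    (\<lambda>x. dual_op N (\<lambda>s. laplace.E N s x) s - potential N a b s * laplace.E N s x)"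
proof -
  have N1: "1 \<in> {1..N}" "N \<in> {1..N}" using N by auto
  \<comment> \<open>The pairs \<open>(0, 0)\<close> and \<open>(0, 1)\<close> encode the left and
    the right injection. They cannot collide with \<open>bonds N\<close>, whose first components are
    sites of the chain.\<close>
  define J where "J = {(0::nat, 0::nat), (0, 1)} \<union> bonds N"
  define I where "I p = (if fst p = 0 then {0<..} else {0<..<1::real})" for p :: "nat \<times> nat"
  define w where "w p u = (if fst p = 0 then exp (- u) / u else 1 / u)" for p :: "nat \<times> nat" and u :: real
  define \<tau> where "\<tau> p = (if p = (0, 0) then injection 1 a else if p = (0, 1) then injection N b else harmonic_jump N (fst p) (snd p))" for p
  define c where "c p u = (if fst p = 0 then 1 else 1 - u)" for p :: "nat \<times> nat" and u :: real
  define C where "C p = (if p = (0, 0) then s 1 * a else if p = (0, 1) then s N * b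
    else 2 + 2 * \<bar>s (snd p) - s (fst p)\<bar> / s (fst p))" for p
  have i0: "fst p \<noteq> 0" if "p \<in> bonds N" for p using bonds_cases(1)[of "fst p" "snd p" N] that by auto
  have split: "(\<Sum>p\<in>J. jump_term (I p) (w p) (\<tau> p) f x)
     = (\<Sum>(i, j)\<in>bonds N. jump_term {0<..<1} (\<lambda>u. 1 / u) (harmonic_jump N i j) f x)
      + jump_term {0<..} (\<lambda>u. exp (- u) / u) (injection 1 a) f x
      + jump_term {0<..} (\<lambda>u. exp (- u) / u) (injection N b) f x" for f x
  proof -
    have "(\<Sum>p\<in>J. jump_term (I p) (w p) (\<tau> p) f x) = (\<Sum>p\<in>{(0, 0), (0, 1)}. jump_term (I p) (w p) (\<tau> p) f x)
      + (\<Sum>p\<in>bonds N. jump_term (I p) (w p) (\<tau> p) f x)"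
      unfolding J_def by (rule sum.union_disjoint) (use i0 in fastforce)+
    also have "(\<Sum>p\<in>bonds N. jump_term (I p) (w p) (\<tau> p) f x)
      = (\<Sum>(i, j)\<in>bonds N. jump_term {0<..<1} (\<lambda>u. 1 / u) (harmonic_jump N i j) f x)"
    proof (rule sum.cong[OF refl])
      fix p assume p: "p \<in> bonds N"
      then have p0: "fst p \<noteq> 0" by (rule i0)
      then have "p \<noteq> (0, 0)" "p \<noteq> (0, 1)" by auto
      then show "jump_term (I p) (w p) (\<tau> p) f x = (case p of (i, j) \<Rightarrow> jump_term {0<..<1} (\<lambda>u. 1 / u) (harmonic_jump N i j) f x)"
        using p0 unfolding I_def w_def[abs_def] \<tau>_def by (simp add: case_prod_unfold)
    qed
    finally show ?thesis unfolding I_def w_def[abs_def] \<tau>_def by (simp add: add_ac)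
  qed
  show ?thesis
  proof (rule generator_graph_of_jumps[OF P _ laplace.E_seq_C0[OF s] laplace.E_params(1)[OF _ s] laplace.cutoff_E_test_function[OF s],
        where J=J and I=I and w=w and \<tau>=\<tau> and c=c and C=C])
    show "finite J" by (simp add: J_def)
    show "jump N (laplace.E N s) (I p) (w p) (\<tau> p) (c p) (C p)" if pJ: "p \<in> J" for p
    proof -
      consider "p = (0, 0)" | "p = (0, 1)" | "p \<in> bonds N" using pJ unfolding J_def by blast
      then show ?thesis
      proof cases
        case 1
        then show ?thesis using injection_E[OF s N1(1) ab(1)]
          by (simp add: I_def w_def[abs_def] \<tau>_def c_def[abs_def] C_def)
      next
        case 2
        then show ?thesis using injection_E[OF s N1(2) ab(2)]
          by (simp add: I_def w_def[abs_def] \<tau>_def c_def[abs_def] C_def)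
      next
        case 3
        then have p0: "fst p \<noteq> 0" by (rule i0)
        then have "p \<noteq> (0, 0)" "p \<noteq> (0, 1)" by auto
        then show ?thesis using harmonic_jump_E[OF s, of "fst p" "snd p"] p0 3
          by (simp add: I_def w_def[abs_def] \<tau>_def c_def[abs_def] C_def)
      qed
    qed
    show "harmonic_generator N a b (cutoff (laplace.E N s) n) x = (\<Sum>p\<in>J. jump_term (I p) (w p) (\<tau> p) (cutoff (laplace.E N s) n) x)"
      if "x \<in> orthant N" for n x
      unfolding split by (rule harmonic_generator_eq[OF N s that])
    show "(\<Sum>p\<in>J. jump_term (I p) (w p) (\<tau> p) (laplace.E N s) x)
      = dual_op N (\<lambda>s. laplace.E N s x) s - potential N a b s * laplace.E N s x" for x
    proof -
      have "jump_term {0<..<1} (\<lambda>u. 1 / u) (harmonic_jump N i j) (laplace.E N s) x = dual_term (\<lambda>s. laplace.E N s x) s i j"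
        if "(i, j) \<in> bonds N" for i j
        unfolding jump_term_def dual_term_def harmonic_jump_duality[OF s that] by simp
      then have "(\<Sum>(i, j)\<in>bonds N. jump_term {0<..<1} (\<lambda>u. 1 / u) (harmonic_jump N i j) (laplace.E N s) x)
        = (\<Sum>(i, j)\<in>bonds N. dual_term (\<lambda>s. laplace.E N s x) s i j)"
        by (intro sum.cong) auto
      also have "\<dots> = dual_op N (\<lambda>s. laplace.E N s x) s" unfolding dual_op_def by (rule sum_bonds)
      finally show ?thesis
        unfolding split injection_term[OF s N1(1) ab(1)] injection_term[OF s N1(2) ab(2)] potential_def
        by (simp add: algebra_simps)
    qed
  qed
qed

section \<open>Mixtures of exponential laws\<close>

lemma sets_exponential_law [measurable_cong]: "sets (exponential_law m) = sets nonneg_borel"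
  by (simp add: exponential_law_def nonneg_borel_def sets_restrict_space)

lemma nn_integral_nonneg_lborel:
  assumes "f \<in> borel_measurable borel"
  shows "(\<integral>\<^sup>+x. f x \<partial>restrict_space lborel {0..}) = (\<integral>\<^sup>+x. f x * indicator {0..} x \<partial>(lborel :: real measure))"
  by (rule nn_integral_restrict_space) simp

lemma exponential_law_nn_integral:
  assumes m: "0 < m" and f: "f \<in> borel_measurable borel"
  shows "(\<integral>\<^sup>+x. f x \<partial>exponential_law m)
    = (\<integral>\<^sup>+x. ennreal (exponential_density (1 / m) x) * f x * indicator {0..} x \<partial>lborel)"
proof -
  have meas: "(\<lambda>x. ennreal (exponential_density (1 / m) x)) \<in> borel_measurable borel" by simp
  have r: "g \<in> borel_measurable (restrict_space lborel {0..})" if "g \<in> borel_measurable borel" for g :: "real \<Rightarrow> ennreal"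
    by (rule measurable_restrict_space1) (use that in simp)
  have "(\<integral>\<^sup>+x. f x \<partial>exponential_law m) = (\<integral>\<^sup>+x. ennreal (exponential_density (1 / m) x) * f x \<partial>restrict_space lborel {0..})"
    unfolding exponential_law_def using m by (simp add: nn_integral_density[OF r[OF meas] r[OF f]])
  also have "\<dots> = (\<integral>\<^sup>+x. ennreal (exponential_density (1 / m) x) * f x * indicator {0..} x \<partial>lborel)"
    by (rule nn_integral_nonneg_lborel) (intro borel_measurable_times_ennreal meas f)
  finally show ?thesis .
qed

lemma exponential_law_laplace:
  assumes m: "0 \<le> m" and s: "0 \<le> s"
  shows "(\<integral>\<^sup>+x. ennreal (exp (- (s * x))) \<partial>exponential_law m) = ennreal (1 / (1 + s * m))"
proof (cases "m = 0")
  case True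
  have "(\<lambda>x. ennreal (exp (- (s * x)))) \<in> borel_measurable nonneg_borel"
    by (rule measurable_nonneg_borelD[OF refl]) measurable
  then show ?thesis using True
    by (simp add: exponential_law_def nn_integral_return space_nonneg_borel)
next
  case False
  then have m0: "0 < m" using m by simp
  define c where "c = 1 / m + s"
  have c: "0 < c" using m0 s by (simp add: c_def add_pos_nonneg)
  have "(\<integral>\<^sup>+x. ennreal (exp (- (s * x))) \<partial>exponential_law m)
    = (\<integral>\<^sup>+x. ennreal (exponential_density (1 / m) x) * ennreal (exp (- (s * x))) * indicator {0..} x \<partial>lborel)"
    by (rule exponential_law_nn_integral[OF m0]) measurable
  also have "\<dots> = (\<integral>\<^sup>+x. ennreal (1 / m * exp (- (x * c))) * indicator {0..} x \<partial>lborel)"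
  proof (rule nn_integral_cong)
    fix x :: real
    have "exponential_density (1 / m) x * exp (- (s * x)) = 1 / m * exp (- (x * c))" if "0 \<le> x"
      using that by (simp add: exponential_density_def c_def exp_add[symmetric] algebra_simps)
    then show "ennreal (exponential_density (1 / m) x) * ennreal (exp (- (s * x))) * indicator {0..} x
       = ennreal (1 / m * exp (- (x * c))) * indicator {0..} x"
      using m0 by (auto simp: indicator_def ennreal_mult[symmetric] exponential_density_nonneg)
  qed
  also have "\<dots> = ennreal (0 - 1 / m * (- exp (- (0 * c)) / c))"
  proof (rule nn_integral_FTC_atLeast)
    show "DERIV (\<lambda>x. 1 / m * (- exp (- (x * c)) / c)) x :> 1 / m * exp (- (x * c))" for x
      using c m0 by (auto intro!: derivative_eq_intros)
    have "((\<lambda>x. exp (- (x * c))) \<longlongrightarrow> 0) at_top"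
      by (rule filterlim_compose[OF exp_at_bot])
        (use c in \<open>auto simp: filterlim_uminus_at_bot intro!: filterlim_at_top_mult_tendsto_pos[OF tendsto_const] filterlim_ident\<close>)
    then have "((\<lambda>x. 1 / m * (- exp (- (x * c)) / c)) \<longlongrightarrow> 1 / m * (- 0 / c)) at_top"
      using c by (intro tendsto_intros) auto
    then show "((\<lambda>x. 1 / m * (- exp (- (x * c)) / c)) \<longlongrightarrow> 0) at_top" by simp
  qed (use m0 in auto)
  also have "0 - 1 / m * (- exp (- (0 * c)) / c) = 1 / (1 + s * m)"
    using m0 c by (simp add: c_def field_simps)
  finally show ?thesis .
qed

lemma prob_space_exponential_law: "0 \<le> m \<Longrightarrow> prob_space (exponential_law m)"
  using exponential_law_laplace[of m 0] by (intro prob_spaceI) simp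

text \<open>The density formula is measurable jointly in the mean and the point, so its integral is
  measurable in the mean. The mean 0, where the law is a point mass, is added as a separate
  case.\<close>

lemma emeasure_exponential_law_measurable:
  assumes B: "B \<in> sets nonneg_borel"
  shows "(\<lambda>m. emeasure (exponential_law m) B) \<in> borel_measurable nonneg_borel"
proof -
  have Bb: "B \<in> sets borel" using B by (auto simp: nonneg_borel_def sets_restrict_space)
  define g where "g m = (if m = 0 then indicator B 0
    else (\<integral>\<^sup>+x. ennreal (exponential_density (1 / m) x) * indicator B x * indicator {0..} x \<partial>(lborel :: real measure)))" for m :: real
  have "(\<lambda>(m, x). ennreal (exponential_density (1 / m) x) * indicator B x * indicator {0..} x) \<in> borel_measurable (borel \<Otimes>\<^sub>M lborel)"
    unfolding exponential_density_def using Bb by measurable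
  from lborel.borel_measurable_nn_integral[OF this]
  have "g \<in> borel_measurable borel" unfolding g_def by measurable
  then have "g \<in> borel_measurable nonneg_borel" by (rule measurable_nonneg_borelD[OF refl])
  moreover have "emeasure (exponential_law m) B = g m" if "m \<in> space nonneg_borel" for m
  proof (cases "m = 0")
    case True
    then show ?thesis using B by (simp add: exponential_law_def g_def)
  next
    case False
    then have m: "0 < m" using that by (simp add: space_nonneg_borel)
    have "emeasure (exponential_law m) B = (\<integral>\<^sup>+x. indicator B x \<partial>exponential_law m)"
      by (rule nn_integral_indicator[symmetric]) (use B in \<open>simp add: sets_exponential_law\<close>)
    also have "\<dots> = g m"
      using False by (subst exponential_law_nn_integral[OF m]) (use Bb in \<open>auto simp: g_def\<close>)
    finally show ?thesis .
  qed
  ultimately show ?thesis by (subst measurable_cong)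
qed

section \<open>The kernel of independent exponential variables\<close>

definition exp_kernel :: "nat \<Rightarrow> (nat \<Rightarrow> real) \<Rightarrow> (nat \<Rightarrow> real) measure" where
  "exp_kernel N \<theta> = (\<Pi>\<^sub>M i\<in>{1..N}. exponential_law (\<theta> i))"

context
  fixes N :: nat and \<theta> :: "nat \<Rightarrow> real"
  assumes \<theta>: "\<theta> \<in> orthant N"
begin

text \<open>Agrees with the factors on the chain; the value 0 elsewhere makes every component a
  probability measure, as product measure theory asks for all indices.\<close>

definition "exp_component i = exponential_law (if i \<in> {1..N} then \<theta> i else 0)"

lemma exp_kernel_alt: "exp_kernel N \<theta> = (\<Pi>\<^sub>M i\<in>{1..N}. exp_component i)"
  unfolding exp_kernel_def by (rule PiM_cong) (auto simp: exp_component_def)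

lemma exp_component_prob: "prob_space (exp_component i)"
  unfolding exp_component_def using config_nonneg[OF \<theta>] by (intro prob_space_exponential_law) auto

lemma exp_kernel_prob: "prob_space (exp_kernel N \<theta>)"
  unfolding exp_kernel_alt by (rule prob_space_PiM) (rule exp_component_prob)

lemma sets_exp_kernel: "sets (exp_kernel N \<theta>) = sets (config_space N)"
  unfolding exp_kernel_alt config_space_def by (rule sets_PiM_cong) (simp_all add: exp_component_def sets_exponential_law)

lemma exp_kernel_product: "product_sigma_finite exp_component"
  by (rule product_prob_space.axioms(1)[OF product_prob_spaceI]) (rule exp_component_prob)

lemma exp_kernel_laplace:
  assumes s: "s \<in> params N"
  shows "(\<integral>x. laplace.E N s x \<partial>exp_kernel N \<theta>) = stieltjes.E N s \<theta>"
proof -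
  interpret product_sigma_finite exp_component by (rule exp_kernel_product)
  have n: "0 \<le> s i * \<theta> i" if "i \<in> {1..N}" for i
    using params_nonneg[OF s, of i] config_nonneg[OF \<theta> that] by simp
  have "(\<integral>\<^sup>+x. ennreal (laplace.E N s x) \<partial>exp_kernel N \<theta>) = (\<integral>\<^sup>+x. (\<Prod>i\<in>{1..N}. ennreal (exp (- (s i * x i)))) \<partial>exp_kernel N \<theta>)"
    unfolding laplace.E_def by (simp add: prod_ennreal)
  also have "\<dots> = (\<Prod>i\<in>{1..N}. \<integral>\<^sup>+y. ennreal (exp (- (s i * y))) \<partial>exp_component i)"
    unfolding exp_kernel_alt
  proof (rule product_nn_integral_prod)
    fix i assume "i \<in> {1..N}"
    show "(\<lambda>y. ennreal (exp (- (s i * y)))) \<in> borel_measurable (exp_component i)"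
      by (rule measurable_nonneg_borelD) (simp_all add: exp_component_def sets_exponential_law)
  qed simp
  also have "\<dots> = (\<Prod>i\<in>{1..N}. ennreal (1 / (1 + s i * \<theta> i)))"
    by (rule prod.cong[OF refl])
      (auto simp: exp_component_def intro!: exponential_law_laplace params_nonneg[OF s] config_nonneg[OF \<theta>])
  also have "\<dots> = ennreal (stieltjes.E N s \<theta>)"
    unfolding stieltjes.E_def using n by (intro prod_ennreal) auto
  finally have nn: "(\<integral>\<^sup>+x. ennreal (laplace.E N s x) \<partial>exp_kernel N \<theta>) = ennreal (stieltjes.E N s \<theta>)" .
  have "(\<integral>x. laplace.E N s x \<partial>exp_kernel N \<theta>) = enn2real (\<integral>\<^sup>+x. ennreal (laplace.E N s x) \<partial>exp_kernel N \<theta>)"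
  proof (rule integral_eq_nn_integral)
    show "laplace.E N s \<in> borel_measurable (exp_kernel N \<theta>)"
      using laplace.E_measurable[of N s] sets_exp_kernel by (simp cong: measurable_cong_sets)
    show "AE x in exp_kernel N \<theta>. 0 \<le> laplace.E N s x" by (rule AE_I2) (simp add: laplace_E)
  qed
  then show ?thesis unfolding nn using stieltjes.E_params(1)[OF \<theta> s] by simp
qed

lemma exp_kernel_box:
  assumes B: "\<And>i. i \<in> {1..N} \<Longrightarrow> B i \<in> sets nonneg_borel"
  shows "emeasure (exp_kernel N \<theta>) (PiE {1..N} B) = (\<Prod>i\<in>{1..N}. emeasure (exponential_law (\<theta> i)) (B i))"
proof -
  interpret product_sigma_finite exp_component by (rule exp_kernel_product)
  show ?thesis
    unfolding exp_kernel_alt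
    by (subst emeasure_PiM) (use B in \<open>auto simp: exp_component_def sets_exponential_law intro!: prod.cong\<close>)
qed

end

text \<open>It suffices to test boxes, which generate the sigma-algebra and are stable under
  intersection. On a box the kernel is a finite product of functions, each of one coordinate of
  \<open>\<theta>\<close>.\<close>

lemma exp_kernel_measurable: "exp_kernel N \<in> config_space N \<rightarrow>\<^sub>M prob_algebra (config_space N)"
proof (rule measurable_prob_algebra_generated)
  show "sets (config_space N) = sigma_sets (\<Pi>\<^sub>E i\<in>{1..N}. space nonneg_borel) (prod_algebra {1..N} (\<lambda>_. nonneg_borel))"
    unfolding config_space_def by (rule sets_PiM)
  show "Int_stable (prod_algebra {1..N} (\<lambda>_. nonneg_borel))" by (rule Int_stable_prod_algebra)
  show "prod_algebra {1..N} (\<lambda>_. nonneg_borel) \<subseteq> Pow (\<Pi>\<^sub>E i\<in>{1..N}. space nonneg_borel)"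
    by (rule prod_algebra_sets_into_space)
  show "prob_space (exp_kernel N \<theta>)" "sets (exp_kernel N \<theta>) = sets (config_space N)"
    if "\<theta> \<in> orthant N" for \<theta>
    by (rule exp_kernel_prob[OF that] sets_exp_kernel[OF that])+
  fix A assume "A \<in> prod_algebra {1..N} (\<lambda>_. nonneg_borel)"
  then obtain B where A: "A = PiE {1..N} B" and B: "B \<in> (\<Pi> i\<in>{1..N}. sets nonneg_borel)"
    unfolding prod_algebra_eq_finite[OF finite_atLeastAtMost] by auto
  have "(\<lambda>\<theta>. \<Prod>i\<in>{1..N}. emeasure (exponential_law (\<theta> i)) (B i)) \<in> borel_measurable (config_space N)"
  proof (rule borel_measurable_prod_ennreal)
    fix i assume i: "i \<in> {1..N}"
    have "(\<lambda>\<theta>. \<theta> i) \<in> config_space N \<rightarrow>\<^sub>M nonneg_borel"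
      unfolding config_space_def using i by (rule measurable_component_singleton)
    then show "(\<lambda>\<theta>. emeasure (exponential_law (\<theta> i)) (B i)) \<in> borel_measurable (config_space N)"
      by (rule measurable_compose) (rule emeasure_exponential_law_measurable, use B i in auto)
  qed
  moreover have "emeasure (exp_kernel N \<theta>) A = (\<Prod>i\<in>{1..N}. emeasure (exponential_law (\<theta> i)) (B i))"
    if "\<theta> \<in> orthant N" for \<theta>
    unfolding A by (rule exp_kernel_box[OF that]) (use B in auto)
  ultimately show "(\<lambda>\<theta>. emeasure (exp_kernel N \<theta>) A) \<in> borel_measurable (config_space N)"
    by (simp cong: measurable_cong)
qed

lemma mixture_prob_algebra:
  assumes "\<mu> \<in> laws N"
  shows "Giry_Monad.bind \<mu> (exp_kernel N) \<in> laws N"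
  using prob_space_bind'[OF assms exp_kernel_measurable] sets_bind'[OF assms exp_kernel_measurable]
  by (simp add: space_prob_algebra)

lemma avg_mixture:
  assumes \<mu>: "\<mu> \<in> laws N" and s: "s \<in> params N"
  shows "laplace.avg N (Giry_Monad.bind \<mu> (exp_kernel N)) s = stieltjes.avg N \<mu> s"
proof -
  have m: "exp_kernel N \<in> \<mu> \<rightarrow>\<^sub>M prob_algebra (config_space N)"
    using exp_kernel_measurable laplace.sets_config_law[OF \<mu>] by (simp cong: measurable_cong_sets)
  have "laplace.avg N (Giry_Monad.bind \<mu> (exp_kernel N)) s = (\<integral>\<theta>. (\<integral>x. laplace.E N s x \<partial>exp_kernel N \<theta>) \<partial>\<mu>)"
    unfolding laplace.avg_def
    by (rule integral_bind_bounded(2)[OF laplace.prob_space_config_law[OF \<mu>] m laplace.E_measurable, where B=1])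
      (use laplace.E_params[OF _ s] in auto)
  also have "\<dots> = stieltjes.avg N \<mu> s"
    unfolding stieltjes.avg_def
    by (rule Bochner_Integration.integral_cong[OF refl]) (use exp_kernel_laplace[OF _ s] laplace.space_config_law[OF \<mu>] in simp)
  finally show "laplace.avg N (Giry_Monad.bind \<mu> (exp_kernel N)) s = stieltjes.avg N \<mu> s" .
qed

lemma dual_op_cong:
  assumes s: "s \<in> params N" and eq: "\<And>s. s \<in> params N \<Longrightarrow> f s = g s"
  shows "dual_op N f s = dual_op N g s"
proof -
  have "dual_term f s i j = dual_term g s i j" if i: "i \<in> {1..N}" for i j
    unfolding dual_term_def
  proof (rule set_lebesgue_integral_cong, simp, intro allI impI)
    fix u :: real assume "u \<in> {0<..<1}"
    then have "move s i j u \<in> params N" by (intro move_params[OF s i]) auto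
    then show "(f (move s i j u) - f s) / u = (g (move s i j u) - g s) / u" by (simp only: eq s)
  qed
  then show ?thesis unfolding dual_op_def by simp
qed

section \<open>Order statistics of uniform variables\<close>

lemma sets_uniform_law [measurable_cong]: "sets (uniform_law a b) = sets nonneg_borel"
  by (simp add: uniform_law_def nonneg_borel_def sets_restrict_space)

lemma sets_uniform_product: "sets (\<Pi>\<^sub>M i\<in>{1..N}. uniform_law a b) = sets (config_space N)"
  unfolding config_space_def by (rule sets_PiM_cong) (simp_all add: sets_uniform_law)

lemma emeasure_restricted_Icc:
  assumes "0 \<le> a" "a \<le> b"
  shows "emeasure (restrict_space lborel {0..}) {a..b} = ennreal (b - a)"
  by (subst emeasure_restrict_space) (use assms in auto)

lemma prob_space_uniform_law:
  assumes "0 \<le> a" "a \<le> b" shows "prob_space (uniform_law a b)"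
proof (cases "a = b")
  case True
  then show ?thesis using assms by (simp add: uniform_law_def prob_space_return space_nonneg_borel)
next
  case False
  then have "prob_space (uniform_measure (restrict_space lborel {0..}) {a..b})"
    using assms by (intro prob_space_uniform_measure) (simp_all add: emeasure_restricted_Icc)
  then show ?thesis using False by (simp add: uniform_law_def)
qed

lemma AE_uniform_law:
  assumes "0 \<le> a" "a \<le> b" shows "AE x in uniform_law a b. x \<in> {a..b}"
proof (cases "a = b")
  case True
  have "Measurable.pred borel (\<lambda>x. x \<in> {a..b})" by simp
  then have "Measurable.pred nonneg_borel (\<lambda>x. x \<in> {a..b})"
    unfolding nonneg_borel_def by (rule measurable_restrict_space1)
  moreover have "a \<in> space nonneg_borel" using assms by (simp add: space_nonneg_borel)
  ultimately have "AE x in return nonneg_borel a. x \<in> {a..b}" using AE_return assms by (metis atLeastAtMost_iff order_refl)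
  then show ?thesis unfolding uniform_law_def if_P[OF True] .
next
  case False
  have "{a..b} \<in> sets (restrict_space lborel {0..})"
    using assms by (subst sets_restrict_space_iff) auto
  then show ?thesis
    unfolding uniform_law_def if_not_P[OF False] by (rule AE_uniform_measureI) simp
qed

lemma integral_uniform_law:
  assumes ab: "0 \<le> a" "a < b" and h: "h \<in> borel_measurable nonneg_borel"
  shows "(\<integral>y. h y \<partial>uniform_law a b) = (LBINT y:{a..b}. h y) / (b - a)"
proof -
  have hm: "h \<in> borel_measurable (restrict_space lborel {0..})"
    using h by (simp add: nonneg_borel_def cong: measurable_cong_sets) 
  have U: "uniform_law a b = density (restrict_space lborel {0..}) (\<lambda>x. ennreal (indicator {a..b} x / (b - a)))"
    unfolding uniform_law_def uniform_measure_def using ab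
    by (auto simp: emeasure_restricted_Icc divide_ennreal[symmetric] indicator_def intro!: arg_cong2[where f=density])
  have "(\<integral>y. h y \<partial>uniform_law a b) = (\<integral>y. (indicator {a..b} y / (b - a)) *\<^sub>R h y \<partial>restrict_space lborel {0..})"
    unfolding U
  proof (rule integral_density[OF hm])
    show "(\<lambda>x. indicator {a..b} x / (b - a)) \<in> borel_measurable (restrict_space lborel {0..})"
      by (rule measurable_restrict_space1) simp
  qed (use ab in auto)
  also have "\<dots> = (\<integral>y. indicator {0..} y *\<^sub>R ((indicator {a..b} y / (b - a)) *\<^sub>R h y) \<partial>lborel)"
    by (rule integral_restrict_space) simp
  also have "\<dots> = (\<integral>y. (indicator {a..b} y *\<^sub>R h y) / (b - a) \<partial>lborel)"
    by (rule Bochner_Integration.integral_cong) (use ab in \<open>auto simp: indicator_def\<close>)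
  finally show ?thesis by (simp add: set_lebesgue_integral_def)
qed

lemma uniform_law_singleton:
  assumes ab: "0 \<le> a" "a < b" shows "emeasure (uniform_law a b) {c} = 0"
proof (cases "0 \<le> c")
  case True
  have "emeasure (uniform_law a b) {c} = emeasure (restrict_space lborel {0..}) ({a..b} \<inter> {c}) / ennreal (b - a)"
    using ab True by (simp add: uniform_law_def emeasure_uniform_measure emeasure_restricted_Icc sets_restrict_space_iff)
  also have "emeasure (restrict_space lborel {0..}) ({a..b} \<inter> {c}) = 0"
  proof -
    have "{a..b} \<inter> {c} = (if c \<in> {a..b} then {c} else {})" by auto
    then show ?thesis using True by (subst emeasure_restrict_space) auto
  qed
  finally show ?thesis by simp
next
  case False
  \<comment> \<open>A point outside of the half-line is not a measurable set here, and the measure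
    of such a set is 0 by convention.\<close>
  then have "{c} \<notin> sets (uniform_law a b)" by (auto simp: sets_uniform_law nonneg_borel_def sets_restrict_space)
  then show ?thesis by (rule emeasure_notin_sets)
qed

text \<open>The reservoir values are attached as \<open>x 0 = a\<close> and \<open>x (N + 1) = b\<close>, see \<^const>\<open>hidden_value\<close>, so that
  all sites have two neighbours.\<close>

definition ordered :: "nat \<Rightarrow> real \<Rightarrow> real \<Rightarrow> (nat \<Rightarrow> real) \<Rightarrow> bool" where
  "ordered N a b x \<longleftrightarrow> (\<forall>k\<le>N. hidden_value N a b x k \<le> hidden_value N a b x (k + 1))"

section \<open>Sorting of configurations\<close>

definition rearrange :: "nat \<Rightarrow> (nat \<Rightarrow> nat) \<Rightarrow> (nat \<Rightarrow> real) \<Rightarrow> nat \<Rightarrow> real" where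
  "rearrange N p x = (\<lambda>i\<in>{1..N}. x (p i))"

lemma ordered_mono:
  assumes "ordered N a b x" "i \<le> j" "j \<le> N + 1"
  shows "hidden_value N a b x i \<le> hidden_value N a b x j"
  using assms(2,3)
proof (induction j rule: dec_induct)
  case (step n)
  then have "hidden_value N a b x n \<le> hidden_value N a b x (n + 1)" using assms(1) by (simp add: ordered_def)
  then show ?case using step by simp
qed simp

text \<open>For values in the interval the comparisons with the two reservoirs hold automatically,
  and the remaining ones chain together.\<close>

lemma ordered_iff:
  assumes N: "N \<ge> 1" and x: "\<And>i. i \<in> {1..N} \<Longrightarrow> x i \<in> {a..b}"
  shows "ordered N a b x \<longleftrightarrow> (\<forall>i\<in>{1..N}. \<forall>j\<in>{1..N}. i \<le> j \<longrightarrow> x i \<le> x j)"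
proof
  assume o: "ordered N a b x"
  show "\<forall>i\<in>{1..N}. \<forall>j\<in>{1..N}. i \<le> j \<longrightarrow> x i \<le> x j"
  proof (intro ballI impI)
    fix i j assume "i \<in> {1..N}" "j \<in> {1..N}" "i \<le> j"
    then show "x i \<le> x j" using ordered_mono[OF o, of i j] by (simp add: hidden_value_def)
  qed
next
  assume m: "\<forall>i\<in>{1..N}. \<forall>j\<in>{1..N}. i \<le> j \<longrightarrow> x i \<le> x j"
  show "ordered N a b x"
    unfolding ordered_def
  proof (intro allI impI)
    fix k assume k: "k \<le> N"
    consider "k = 0" | "k = N" "0 < k" | "0 < k" "k < N" using k by linarith
    then show "hidden_value N a b x k \<le> hidden_value N a b x (k + 1)"
    proof cases
      case 1
      then show ?thesis using x[of 1] N by (simp add: hidden_value_def)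
    next
      case 2
      then show ?thesis using x[of N] N by (simp add: hidden_value_def)
    next
      case 3
      then show ?thesis using m by (simp add: hidden_value_def)
    qed
  qed
qed

lemma sort_rearrange:
  assumes p: "p permutes {1..N}" and m: "\<And>i j. i \<in> {1..N} \<Longrightarrow> j \<in> {1..N} \<Longrightarrow> i \<le> j \<Longrightarrow> x (p i) \<le> x (p j)"
  shows "sort (map x [1..<N + 1]) = map (\<lambda>i. x (p i)) [1..<N + 1]" "order_statistics N x = rearrange N p x"
proof -
  have "mset (map p [1..<N + 1]) = mset [1..<N + 1]"
  proof (rule set_eq_iff_mset_eq_distinct[THEN iffD1])
    show "distinct (map p [1..<N + 1])"
      using permutes_inj[OF p] by (simp add: distinct_map inj_on_subset[OF _ subset_UNIV])
    show "set (map p [1..<N + 1]) = set [1..<N + 1]"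
    proof -
      have e: "set [1..<N + 1] = {1..N}" by auto
      show ?thesis unfolding set_map e by (rule permutes_image[OF p])
    qed
  qed simp
  then have "mset (map x (map p [1..<N + 1])) = mset (map x [1..<N + 1])" by (simp only: mset_map)
  moreover have "sorted (map (\<lambda>i. x (p i)) [1..<N + 1])"
    unfolding sorted_iff_nth_mono by (auto intro!: m simp del: upt_Suc)
  ultimately show s: "sort (map x [1..<N + 1]) = map (\<lambda>i. x (p i)) [1..<N + 1]"
    by (intro properties_for_sort) (simp_all add: o_def del: upt_Suc)
  show "order_statistics N x = rearrange N p x"
    unfolding order_statistics_def rearrange_def s by (rule restrict_ext) (auto simp del: upt_Suc)
qed

text \<open>Sorting the indices by their values, rather than the values themselves, yields a
  permutation even when there are ties.\<close>

lemma sorting_permutation: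
  fixes x :: "nat \<Rightarrow> real"
  shows "\<exists>p. p permutes {1..N} \<and> (\<forall>i\<in>{1..N}. \<forall>j\<in>{1..N}. i \<le> j \<longrightarrow> x (p i) \<le> x (p j))"
proof -
  define ks where "ks = sort_key x [1..<N + 1]"
  have ks: "set ks = {1..N}" "distinct ks" "length ks = N" "sorted (map x ks)"
    by (auto simp: ks_def)
  define p where "p i = (if i \<in> {1..N} then ks ! (i - 1) else i)" for i
  have "bij_betw p {1..N} {1..N}"
  proof (rule bij_betwI')
    show "p i = p j \<longleftrightarrow> i = j" if "i \<in> {1..N}" "j \<in> {1..N}" for i j
    proof -
      have "i - 1 < length ks" "j - 1 < length ks" using that ks(3) by auto
      from nth_eq_iff_index_eq[OF ks(2) this] that show ?thesis by (auto simp: p_def)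
    qed
    show "p i \<in> {1..N}" if "i \<in> {1..N}" for i
      using that nth_mem[of "i - 1" ks] unfolding ks(1,3) by (auto simp: p_def)
    show "\<exists>i\<in>{1..N}. j = p i" if "j \<in> {1..N}" for j
    proof -
      have "j \<in> set ks" unfolding ks(1) by (rule that)
      then obtain k where "k < length ks" "ks ! k = j" by (auto simp: in_set_conv_nth)
      then show ?thesis using ks(3) by (intro bexI[of _ "k + 1"]) (auto simp: p_def)
    qed
  qed
  then have "p permutes {1..N}" by (rule bij_imp_permutes) (auto simp: p_def)
  moreover have "x (p i) \<le> x (p j)" if "i \<in> {1..N}" "j \<in> {1..N}" "i \<le> j" for i j
    using sorted_nth_mono[OF ks(4), of "i - 1" "j - 1"] that ks(3) by (auto simp: p_def)
  ultimately show ?thesis by blast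
qed

lemma rearrange_measurable:
  assumes p: "p permutes {1..N}"
  shows "rearrange N p \<in> config_space N \<rightarrow>\<^sub>M config_space N"
  unfolding rearrange_def config_space_def
proof (rule measurable_restrict)
  fix i assume "i \<in> {1..N}"
  then have "p i \<in> {1..N}" using permutes_in_image[OF p] by simp
  then show "(\<lambda>x. x (p i)) \<in> Pi\<^sub>M {1..N} (\<lambda>_. nonneg_borel) \<rightarrow>\<^sub>M nonneg_borel"
    by (rule measurable_component_singleton)
qed

text \<open>The finitely many regions where a given permutation sorts the configuration cover the
  orthant. They may overlap at ties. On each of them the order statistics are a mere rearrangement
  of coordinates.\<close>

lemma order_statistics_measurable: "order_statistics N \<in> config_space N \<rightarrow>\<^sub>M config_space N"
proof (rule measurable_piecewise_restrict)
  let ?A = "\<lambda>p. {x :: nat \<Rightarrow> real. \<forall>i\<in>{1..N}. \<forall>j\<in>{1..N}. i \<le> j \<longrightarrow> x (p i) \<le> x (p j)}"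
  show "countable (?A ` {p. p permutes {1..N}})"
    by (intro countable_image countable_finite finite_permutations) simp
  show "orthant N \<subseteq> \<Union>(?A ` {p. p permutes {1..N}})" using sorting_permutation by blast
  fix \<Omega> assume "\<Omega> \<in> ?A ` {p. p permutes {1..N}}"
  then obtain p where p: "p permutes {1..N}" and \<Omega>: "\<Omega> = ?A p" by auto
  have c: "(\<lambda>x. x (p i)) \<in> borel_measurable (config_space N)" if "i \<in> {1..N}" for i
    using measurable_coordinate[of "p i" N] permutes_in_image[OF p] that by simp
  have "?A p \<inter> orthant N = {x \<in> orthant N. \<forall>i\<in>{1..N}. \<forall>j\<in>{1..N}. i \<le> j \<longrightarrow> x (p i) \<le> x (p j)}" by auto
  also have "\<dots> \<in> sets (config_space N)"
    by (intro sets.sets_Collect_finite_All sets.sets_Collect_imp borel_measurable_le c sets.sets_Collect_const finite_atLeastAtMost)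
  finally show "\<Omega> \<inter> orthant N \<in> sets (config_space N)" unfolding \<Omega> .
  show "order_statistics N \<in> restrict_space (config_space N) \<Omega> \<rightarrow>\<^sub>M config_space N"
  proof (rule measurable_cong[where f="order_statistics N" and g="rearrange N p", THEN iffD2])
    show "order_statistics N x = rearrange N p x" if "x \<in> space (restrict_space (config_space N) \<Omega>)" for x
      using that by (intro sort_rearrange(2)[OF p]) (auto simp: \<Omega> space_restrict_space)
    show "rearrange N p \<in> restrict_space (config_space N) \<Omega> \<rightarrow>\<^sub>M config_space N"
      by (rule measurable_restrict_space1[OF rearrange_measurable[OF p]])
  qed
qed

section \<open>Exchangeability of independent uniform variables\<close>

context
  fixes N :: nat and a b :: real
  assumes N: "N \<ge> 1" and ab: "0 \<le> a" "a \<le> b"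
begin

abbreviation product_law :: "(nat \<Rightarrow> real) measure" where
  "product_law \<equiv> \<Pi>\<^sub>M i\<in>{1..N}. uniform_law a b"

lemma product_law_prob: "prob_space product_law"
  by (rule prob_space_PiM) (rule prob_space_uniform_law[OF ab])

lemma product_law_sets: "sets product_law = sets (config_space N)" "space product_law = orthant N"
  by (rule sets_uniform_product, rule sets_eq_imp_space_eq[OF sets_uniform_product])

lemma product_law_measurable: "f \<in> config_space N \<rightarrow>\<^sub>M L \<Longrightarrow> f \<in> product_law \<rightarrow>\<^sub>M L"
  by (simp only: measurable_cong_sets[OF product_law_sets(1) refl])

lemma order_law_prob: "uniform_order_statistics_law N a b \<in> laws N"
  unfolding uniform_order_statistics_law_def space_prob_algebra
  using prob_space.prob_space_distr[OF product_law_prob product_law_measurable[OF order_statistics_measurable]]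
  by simp

lemma integral_order_law:
  fixes G :: "(nat \<Rightarrow> real) \<Rightarrow> real"
  assumes "G \<in> borel_measurable (config_space N)"
  shows "(\<integral>x. G x \<partial>uniform_order_statistics_law N a b) = (\<integral>x. G (order_statistics N x) \<partial>product_law)"
  unfolding uniform_order_statistics_law_def
  by (rule integral_distr[OF product_law_measurable[OF order_statistics_measurable] assms])

lemma product_law_bounds: "AE x in product_law. \<forall>i\<in>{1..N}. x i \<in> {a..b}"
proof (rule AE_finite_allI)
  fix i assume "i \<in> {1..N}"
  then show "AE x in product_law. x i \<in> {a..b}"
    by (rule AE_PiM_component[OF prob_space_uniform_law[OF ab] _ AE_uniform_law[OF ab]])
qed simp

text \<open>Integrating out coordinate \<open>i\<close> first leaves the mass of the single point
  \<open>x j\<close>, which is 0 for a nondegenerate interval.\<close>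

lemma product_law_distinct:
  assumes "a < b"
  shows "AE x in product_law. inj_on x {1..N}"
proof -
  have "AE x in product_law. x i \<noteq> x j" if ij: "i \<in> {1..N}" "j \<in> {1..N}" "i \<noteq> j" for i j
  proof -
    let ?I = "{1..N} - {i}"
    let ?U = "\<lambda>_ :: nat. uniform_law a b"
    interpret product_prob_space ?U by (rule product_prob_spaceI) (rule prob_space_uniform_law[OF ab])
    have ins: "insert i ?I = {1..N}" using ij by auto
    have S: "{x \<in> space product_law. x i = x j} \<in> sets product_law"
      by (intro borel_measurable_eq product_law_measurable measurable_coordinate ij)
    have m: "indicator {x \<in> space product_law. x i = x j} \<in> borel_measurable (Pi\<^sub>M (insert i ?I) ?U)"
      unfolding ins by (rule borel_measurable_indicator[OF S])
    have "emeasure product_law {x \<in> space product_law. x i = x j}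
       = integral\<^sup>N (Pi\<^sub>M (insert i ?I) ?U) (indicator {x \<in> space product_law. x i = x j})"
      unfolding ins using S by simp
    also have "\<dots> = (\<integral>\<^sup>+x. (\<integral>\<^sup>+y. indicator {x \<in> space product_law. x i = x j} (x(i := y)) \<partial>uniform_law a b) \<partial>Pi\<^sub>M ?I ?U)"
      by (rule product_nn_integral_insert[OF _ _ m]) auto
    also have "\<dots> \<le> (\<integral>\<^sup>+x. 0 \<partial>Pi\<^sub>M ?I ?U)"
    proof (rule nn_integral_mono)
      fix x
      have "(\<integral>\<^sup>+y. indicator {x \<in> space product_law. x i = x j} (x(i := y)) \<partial>uniform_law a b)
        \<le> (\<integral>\<^sup>+y. indicator {x j} y \<partial>uniform_law a b)"
        by (rule nn_integral_mono) (use ij in \<open>auto simp: indicator_def\<close>)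
      also have "\<dots> \<le> 0"
      proof (cases "{x j} \<in> sets (uniform_law a b)")
        case True
        then show ?thesis using uniform_law_singleton[OF ab(1) assms] by simp
      next
        case False
        then have "x j \<notin> space (uniform_law a b)"
          using sets_eq_imp_space_eq[OF sets_uniform_law[of a b]]
          by (auto simp: sets_uniform_law nonneg_borel_def sets_restrict_space space_restrict_space)
        then have "(\<integral>\<^sup>+y. indicator {x j} y \<partial>uniform_law a b) = (\<integral>\<^sup>+y. 0 \<partial>uniform_law a b)"
          by (intro nn_integral_cong) (auto simp: indicator_def)
        then show ?thesis by simp
      qed
      finally show "(\<integral>\<^sup>+y. indicator {x \<in> space product_law. x i = x j} (x(i := y)) \<partial>uniform_law a b) \<le> 0" .
    qed
    finally have "emeasure product_law {x \<in> space product_law. x i = x j} = 0" by simp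
    then show ?thesis using S by (intro AE_I[of _ _ "{x \<in> space product_law. x i = x j}"]) auto
  qed
  then have "AE x in product_law. \<forall>i\<in>{1..N}. \<forall>j\<in>{1..N}. i \<noteq> j \<longrightarrow> x i \<noteq> x j"
    by (intro AE_finite_allI) auto
  then show ?thesis by eventually_elim (auto simp: inj_on_def)
qed

lemma rearrange_law:
  assumes p: "p permutes {1..N}"
  shows "distr product_law product_law (rearrange N p) = product_law"
  unfolding rearrange_def
  by (rule distr_PiM_reindex[of "{1..N}" "\<lambda>_. uniform_law a b" p "{1..N}"])
    (use prob_space_uniform_law[OF ab] permutes_inj_on[OF p] permutes_in_image[OF p] in auto)

lemma hidden_value_measurable: "(\<lambda>x. hidden_value N a b x k) \<in> borel_measurable (config_space N)"
  if k: "k \<le> N + 1" for k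
proof -
  have "k = 0 \<or> k = N + 1 \<or> k \<in> {1..N}" using k by auto
  then consider "k = 0" | "k = N + 1" | "k \<in> {1..N}" by blast
  then show ?thesis
    by cases (simp_all add: hidden_value_def measurable_coordinate[of k N, unfolded One_nat_def] cong: if_cong)
qed

lemma ordered_measurable: "{x \<in> orthant N. ordered N a b x} \<in> sets (config_space N)"
proof -
  have "{x \<in> orthant N. \<forall>k\<in>{..N}. hidden_value N a b x k \<le> hidden_value N a b x (k + 1)} \<in> sets (config_space N)"
  proof (rule sets.sets_Collect_finite_All)
    fix k assume "k \<in> {..N}"
    then have k: "k \<le> N + 1" "k + 1 \<le> N + 1" by auto
    show "{x \<in> orthant N. hidden_value N a b x k \<le> hidden_value N a b x (k + 1)} \<in> sets (config_space N)"
      by (rule borel_measurable_le[OF hidden_value_measurable[OF k(1)] hidden_value_measurable[OF k(2)]])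
  qed simp
  then show ?thesis by (simp only: ordered_def atMost_iff Ball_def)
qed

text \<open>Almost surely exactly one permutation sorts the sample, so \<open>G\<close> at the order
  statistics is the sum over all permutations of \<open>H\<close> at the rearranged sample, where
  \<open>H\<close> is \<open>G\<close> restricted to ordered configurations. Since the product law
  is invariant under permutations, every summand has the same integral as \<open>H\<close>, which is
  0. Thus the law of the order statistics is never computed as a density.\<close>

lemma integral_order_law_zero:
  fixes G :: "(nat \<Rightarrow> real) \<Rightarrow> real"
  assumes lt: "a < b" and G: "G \<in> borel_measurable (config_space N)"
    and B: "\<And>x. x \<in> orthant N \<Longrightarrow> ordered N a b x \<Longrightarrow> \<bar>G x\<bar> \<le> B"
    and zero: "(\<integral>x. indicator {x. ordered N a b x} x * G x \<partial>product_law) = 0"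
  shows "(\<integral>x. G x \<partial>uniform_order_statistics_law N a b) = 0"
proof -
  interpret prob_space product_law by (rule product_law_prob)
  define H where "H x = indicator {x. ordered N a b x} x * G x" for x
  have Hm: "H \<in> borel_measurable (config_space N)"
  proof -
    have "(\<lambda>x. indicator {x \<in> orthant N. ordered N a b x} x * G x) \<in> borel_measurable (config_space N)"
      by (intro borel_measurable_times borel_measurable_indicator ordered_measurable G)
    then show ?thesis by (rule measurable_cong[THEN iffD1, rotated]) (simp add: H_def indicator_def)
  qed
  note R = product_law_measurable[OF rearrange_measurable]
  have HR: "(\<lambda>x. H (rearrange N p x)) \<in> borel_measurable product_law" if "p permutes {1..N}" for p
    by (rule measurable_compose[OF R[OF that] Hm])
  have B0: "\<bar>H x\<bar> \<le> \<bar>B\<bar>" if "x \<in> orthant N" for x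
    using B[OF that] by (auto simp: H_def indicator_def)
  have int: "integrable product_law (\<lambda>x. H (rearrange N p x))" if p: "p permutes {1..N}" for p
    by (rule integrable_const_bound[where B="\<bar>B\<bar>", OF _ HR[OF p]])
      (auto intro!: AE_I2 B0 measurable_space[OF R[OF p]])
  have HI: "(\<integral>x. H (rearrange N p x) \<partial>product_law) = 0" if p: "p permutes {1..N}" for p
  proof -
    have "(\<integral>x. H x \<partial>product_law) = (\<integral>x. H x \<partial>distr product_law product_law (rearrange N p))"
      by (simp only: rearrange_law[OF p])
    also have "\<dots> = (\<integral>x. H (rearrange N p x) \<partial>product_law)"
      by (rule integral_distr) (use R[OF p] Hm product_law_sets in \<open>simp_all cong: measurable_cong_sets\<close>)
    finally show ?thesis using zero by (simp add: H_def)
  qed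
  have "(\<integral>x. G x \<partial>uniform_order_statistics_law N a b) = (\<integral>x. G (order_statistics N x) \<partial>product_law)"
    by (rule integral_order_law[OF G])
  also have "\<dots> = (\<integral>x. (\<Sum>p\<in>{p. p permutes {1..N}}. H (rearrange N p x)) \<partial>product_law)"
  proof (rule integral_cong_AE)
    show "(\<lambda>x. G (order_statistics N x)) \<in> borel_measurable product_law"
      by (rule measurable_compose[OF product_law_measurable[OF order_statistics_measurable] G])
    show "(\<lambda>x. \<Sum>p\<in>{p. p permutes {1..N}}. H (rearrange N p x)) \<in> borel_measurable product_law"
      by (rule borel_measurable_sum) (use HR in auto)
    show "AE x in product_law. G (order_statistics N x) = (\<Sum>p\<in>{p. p permutes {1..N}}. H (rearrange N p x))"
      using product_law_bounds product_law_distinct[OF lt]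
    proof eventually_elim
      case (elim x)
      have o: "ordered N a b (rearrange N p x) \<longleftrightarrow> (\<forall>i\<in>{1..N}. \<forall>j\<in>{1..N}. i \<le> j \<longrightarrow> x (p i) \<le> x (p j))"
        if p: "p permutes {1..N}" for p
      proof -
        have "rearrange N p x i \<in> {a..b}" if "i \<in> {1..N}" for i
          using that elim(1) permutes_in_image[OF p, of i] by (simp add: rearrange_def)
        then show ?thesis by (subst ordered_iff[OF N]) (auto simp: rearrange_def)
      qed
      obtain p0 where p0: "p0 permutes {1..N}" and m0: "\<forall>i\<in>{1..N}. \<forall>j\<in>{1..N}. i \<le> j \<longrightarrow> x (p0 i) \<le> x (p0 j)"
        using sorting_permutation[of N x] by blast
      \<comment> \<open>Two sorting permutations give the same sorted configuration; as the values
        are distinct, they agree at each index.\<close>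
      have uniq: "p = p0" if p: "p permutes {1..N}" and m: "\<forall>i\<in>{1..N}. \<forall>j\<in>{1..N}. i \<le> j \<longrightarrow> x (p i) \<le> x (p j)" for p
      proof
        fix i show "p i = p0 i"
        proof (cases "i \<in> {1..N}")
          case True
          have "rearrange N p x = rearrange N p0 x"
            using sort_rearrange(2)[OF p, of x] sort_rearrange(2)[OF p0, of x] m m0 by metis
          then have "x (p i) = x (p0 i)" using True by (simp add: rearrange_def fun_eq_iff restrict_def) metis
          then show ?thesis
            using elim(2) permutes_in_image[OF p, of i] permutes_in_image[OF p0, of i] True by (auto dest: inj_onD)
        next
          case False
          then show ?thesis using p p0 by (simp add: permutes_not_in)
        qed
      qed
      have "(\<Sum>p\<in>{p. p permutes {1..N}}. H (rearrange N p x)) = (\<Sum>p\<in>{p. p permutes {1..N}}. if p = p0 then G (rearrange N p0 x) else 0)"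
      proof (rule sum.cong[OF refl])
        fix p assume "p \<in> {p. p permutes {1..N}}"
        then have p: "p permutes {1..N}" by simp
        show "H (rearrange N p x) = (if p = p0 then G (rearrange N p0 x) else 0)"
        proof (cases "p = p0")
          case True
          have "ordered N a b (rearrange N p x)" unfolding True o[OF p0] by (rule m0)
          then show ?thesis using True by (simp add: H_def)
        next
          case False
          have "\<not> ordered N a b (rearrange N p x)" unfolding o[OF p] using uniq[OF p] False by blast
          then show ?thesis using False by (simp add: H_def)
        qed
      qed
      also have "\<dots> = G (rearrange N p0 x)" using p0 by (simp add: finite_permutations)
      also have "rearrange N p0 x = order_statistics N x"
        by (rule sort_rearrange(2)[OF p0, symmetric]) (use m0 in blast)
      finally show ?case by simp
    qed
  qed
  also have "\<dots> = (\<Sum>p\<in>{p. p permutes {1..N}}. \<integral>x. H (rearrange N p x) \<partial>product_law)"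
    by (rule Bochner_Integration.integral_sum) (use int in auto)
  also have "\<dots> = 0" by (rule sum.neutral) (use HI in auto)
  finally show ?thesis .
qed

end

section \<open>The law of the order statistics solves the dual equation\<close>

text \<open>With \<open>g y = ln (1 + s y)\<close>, the integrand is the derivative of \<open>(g y - g l) (g y - g r) / s\<close>.\<close>

lemma site_integral_zero:
  fixes s l r :: real
  assumes s: "0 < s" and l: "0 \<le> l"
  shows "(LBINT y:{l..r}. (2 * ln (1 + s * y) - ln (1 + s * l) - ln (1 + s * r)) * (1 / (1 + s * y))) = 0"
proof (cases "l \<le> r")
  case True
  define g where "g y = ln (1 + s * y)" for y
  let ?f = "\<lambda>y. (2 * g y - g l - g r) * (1 / (1 + s * y))"
  have pos: "0 < 1 + s * y" if "l \<le> y" for y using s l that by (simp add: add_pos_nonneg)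
  have dg: "(g has_real_derivative s / (1 + s * y)) (at y within A)" if "l \<le> y" for y A
    unfolding g_def using pos[OF that] by (auto intro!: derivative_eq_intros)
  have "(LBINT y:{l..r}. ?f y) = (LBINT y=l..r. ?f y)"
    using True by (simp add: interval_integral_Icc)
  also have "\<dots> = (g r - g l) * (g r - g r) / s - (g l - g l) * (g l - g r) / s"
  proof (rule interval_integral_FTC_finite)
    have "continuous_on {min l r..max l r} g"
      using pos True unfolding g_def by (intro continuous_intros) (auto simp: less_imp_neq[symmetric])
    then show "continuous_on {min l r..max l r} ?f"
      using pos True by (intro continuous_intros) (auto simp: less_imp_neq[symmetric])
    fix y assume "min l r \<le> y" "y \<le> max l r"
    then have y: "l \<le> y" using True by simp
    have "((\<lambda>y. (g y - g l) * (g y - g r) / s) has_real_derivative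
      (s / (1 + s * y) * (g y - g r) + s / (1 + s * y) * (g y - g l)) / s) (at y within {min l r..max l r})"
      by (rule DERIV_cdivide derivative_eq_intros dg[OF y] refl | simp)+
    moreover have "(s / (1 + s * y) * (g y - g r) + s / (1 + s * y) * (g y - g l)) / s = ?f y"
      using s pos[OF y] by (simp add: divide_simps) (simp add: algebra_simps)
    ultimately show "((\<lambda>y. (g y - g l) * (g y - g r) / s) has_vector_derivative ?f y) (at y within {min l r..max l r})"
      by (simp only: has_real_derivative_iff_has_vector_derivative)
  qed
  finally show ?thesis by (simp add: g_def)
qed (simp add: set_lebesgue_integral_def)

lemma hidden_value_update:
  "hidden_value N a b (x(i := y)) k = (if k = i \<and> i \<in> {1..N} then y else hidden_value N a b x k)"
  if "k \<noteq> i \<or> i \<in> {1..N}"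
  using that by (auto simp: hidden_value_def)

text \<open>The two hidden jumps at site \<open>i\<close> together, in the closed form of
  \<open>stieltjes_jump_term\<close>.\<close>

definition site_term :: "nat \<Rightarrow> real \<Rightarrow> real \<Rightarrow> (nat \<Rightarrow> real) \<Rightarrow> nat \<Rightarrow> (nat \<Rightarrow> real) \<Rightarrow> real" where
  "site_term N a b s i x = stieltjes.E N s x *
     (2 * ln (1 + s i * x i) - ln (1 + s i * hidden_value N a b x (i - 1)) - ln (1 + s i * hidden_value N a b x (i + 1)))"

context
  fixes N :: nat and a b :: real and s :: "nat \<Rightarrow> real"
  assumes N: "N \<ge> 1" and ab: "0 \<le> a" "a \<le> b" and s: "s \<in> params N"
begin

lemma site_term_sum:
  assumes x: "x \<in> orthant N"
  shows "dual_op N (\<lambda>s. stieltjes.E N s x) s - potential N a b s * stieltjes.E N s x = (\<Sum>i\<in>{1..N}. site_term N a b s i x)"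
proof -
  have b0: "0 \<le> b" using ab by simp
  have j: "jump_term {0<..<1} (\<lambda>u. 1 / u) (hidden_jump N a b i j) (stieltjes.E N s) x
      = stieltjes.E N s x * (ln (1 + s i * x i) - ln (1 + s i * hidden_value N a b x j))"
    if "(i, j) \<in> bonds N" for i j
    by (rule stieltjes_jump_term[OF s bonds_cases(1)[OF that] x hidden_value_nonneg[OF ab(1) b0 x that]])
  have "dual_op N (\<lambda>s. stieltjes.E N s x) s - potential N a b s * stieltjes.E N s x
     = (\<Sum>(i, j)\<in>bonds N. stieltjes.E N s x * (ln (1 + s i * x i) - ln (1 + s i * hidden_value N a b x j)))"
    unfolding hidden_duality[OF N s x ab(1) b0, symmetric] by (rule sum.cong) (auto simp: j)
  also have "\<dots> = (\<Sum>i\<in>{1..N}. site_term N a b s i x)"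
    unfolding sum_bonds site_term_def by (rule sum.cong[OF refl]) (simp only: algebra_simps)
  finally show ?thesis .
qed

lemma site_term_measurable:
  assumes i: "i \<in> {1..N}"
  shows "site_term N a b s i \<in> borel_measurable (config_space N)"
proof -
  have "i - 1 \<le> N + 1" "i + 1 \<le> N + 1" using i by auto
  then show ?thesis
    unfolding site_term_def
    by (intro borel_measurable_times stieltjes.E_measurable borel_measurable_diff borel_measurable_ln
        borel_measurable_add borel_measurable_const measurable_coordinate[OF i] hidden_value_measurable[OF N ab])
qed

lemma site_term_bound:
  assumes i: "i \<in> {1..N}" and x: "x \<in> orthant N" and o: "ordered N a b x"
  shows "\<bar>site_term N a b s i x\<bar> \<le> 4 * ln (1 + s i * b)"
proof -
  have v: "a \<le> hidden_value N a b x k" "hidden_value N a b x k \<le> b" if "k \<le> N + 1" for k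
    using ordered_mono[OF o, of 0 k] ordered_mono[OF o, of k "N + 1"] that by (simp_all add: hidden_value_def)
  have si: "0 < s i" by (rule params_pos[OF s i])
  have l: "0 \<le> ln (1 + s i * hidden_value N a b x k)" "ln (1 + s i * hidden_value N a b x k) \<le> ln (1 + s i * b)" if "k \<le> N + 1" for k
  proof -
    have "0 \<le> s i * hidden_value N a b x k" "s i * hidden_value N a b x k \<le> s i * b"
      using v[OF that] si ab by auto
    then show "0 \<le> ln (1 + s i * hidden_value N a b x k)" "ln (1 + s i * hidden_value N a b x k) \<le> ln (1 + s i * b)"
      by (auto intro!: ln_ge_zero)
  qed
  have xi: "x i = hidden_value N a b x i" using i by (simp add: hidden_value_def)
  have "\<bar>2 * ln (1 + s i * x i) - ln (1 + s i * hidden_value N a b x (i - 1)) - ln (1 + s i * hidden_value N a b x (i + 1))\<bar>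
    \<le> 4 * ln (1 + s i * b)"
  proof -
    have e: "i \<le> N + 1" "i - 1 \<le> N + 1" "i + 1 \<le> N + 1" using i by auto
    show ?thesis unfolding xi using l[OF e(1)] l[OF e(2)] l[OF e(3)] by linarith
  qed
  then have "\<bar>site_term N a b s i x\<bar> \<le> 1 * (4 * ln (1 + s i * b))"
    unfolding site_term_def abs_mult using stieltjes.E_params[OF x s] by (intro mult_mono) auto
  then show ?thesis by simp
qed

text \<open>With the other coordinates fixed, being ordered means that \<open>y\<close> lies in
  \<open>[l, r]\<close>, provided the comparisons not involving site \<open>i\<close> hold. The
  product function splits into a factor \<open>R\<close> free of \<open>y\<close> and the factor
  \<open>1 / (1 + s i * y)\<close>, which is exactly the weight for which the integral over
  \<open>[l, r]\<close> vanishes.\<close>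

lemma conditional_site_integral:
  assumes lt: "a < b" and i: "i \<in> {1..N}"
  shows "(\<integral>y. indicator {x. ordered N a b x} (x(i := y)) * site_term N a b s i (x(i := y)) \<partial>uniform_law a b) = 0"
proof -
  define v where "v = hidden_value N a b x"
  define l r where "l = v (i - 1)" and "r = v (i + 1)"
  define R where "R = (\<Prod>k\<in>{1..N} - {i}. 1 / (1 + s k * x k))"
  \<comment> \<open>The comparisons in which site \<open>i\<close> does not take part; the excluded
    indices are those of the two pairs containing \<open>i\<close>.\<close>
  define C where "C \<longleftrightarrow> (\<forall>k\<le>N. k \<noteq> i - 1 \<longrightarrow> k \<noteq> i \<longrightarrow> v k \<le> v (k + 1))"
  have si: "0 < s i" by (rule params_pos[OF s i])
  have vu: "hidden_value N a b (x(i := y)) k = (if k = i then y else v k)" for k y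
    using hidden_value_update[of k i N a b x y] i by (simp add: v_def)
  have o: "ordered N a b (x(i := y)) \<longleftrightarrow> C \<and> y \<in> {l..r}" for y
  proof
    assume *: "ordered N a b (x(i := y))"
    then have **: "(if k = i then y else v k) \<le> (if k + 1 = i then y else v (k + 1))" if "k \<le> N" for k
      using that unfolding ordered_def vu by blast
    have e: "i - 1 \<le> N" "i - 1 \<noteq> i" "i - 1 + 1 = i" "i \<le> N" "i + 1 \<noteq> i" using i by auto
    have "l \<le> y" using **[OF e(1)] unfolding e(3) if_not_P[OF e(2)] if_P[OF refl] l_def .
    moreover have "y \<le> r" using **[OF e(4)] unfolding if_not_P[OF e(5)] if_P[OF refl] r_def .
    moreover have "v k \<le> v (k + 1)" if "k \<le> N" "k \<noteq> i - 1" "k \<noteq> i" for k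
      using **[OF that(1)] that i by (auto split: if_splits)
    ultimately show "C \<and> y \<in> {l..r}" by (simp add: C_def)
  next
    assume *: "C \<and> y \<in> {l..r}"
    show "ordered N a b (x(i := y))"
      unfolding ordered_def vu
    proof (intro allI impI)
      fix k assume k: "k \<le> N"
      show "(if k = i then y else v k) \<le> (if k + 1 = i then y else v (k + 1))"
      proof (cases "k = i \<or> k + 1 = i")
        case True
        then show ?thesis using * i by (auto simp: l_def r_def)
      next
        case False
        then have "k \<noteq> i - 1" using i by auto
        then show ?thesis using * k False unfolding C_def by auto
      qed
    qed
  qed
  have st: "site_term N a b s i (x(i := y)) = R * ((2 * ln (1 + s i * y) - ln (1 + s i * l) - ln (1 + s i * r)) * (1 / (1 + s i * y)))" for y
  proof -
    have "i - 1 \<noteq> i" "i + 1 \<noteq> i" using i by auto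
    then show ?thesis
      unfolding site_term_def vu stieltjes.E_update(1)[OF i] R_def[symmetric] l_def r_def by simp
  qed
  show ?thesis
  proof (cases C)
    case True
    \<comment> \<open>The comparisons in \<open>C\<close> lead from the reservoir value
      \<open>a\<close> up to \<open>l\<close> without passing site \<open>i\<close>, and likewise
      from \<open>r\<close> to \<open>b\<close>. Hence \<open>[l, r]\<close> is not truncated by the
      interval on which the uniform law lives.\<close>
    have "v 0 \<le> v k" if "k \<le> i - 1" for k
      using that
    proof (induction k)
      case (Suc k)
      have "v k \<le> v (k + 1)" using True Suc.prems i unfolding C_def by (elim allE[of _ k]) auto
      then show ?case using Suc by simp
    qed simp
    from this[of "i - 1"] have al: "a \<le> l" by (simp add: l_def v_def hidden_value_def)
    have "v k \<le> v (N + 1)" if "i + 1 \<le> k" "k \<le> N + 1" for k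
      using that(2,1)
    proof (induction k rule: inc_induct)
      case (step k)
      have "v k \<le> v (k + 1)" using True step i unfolding C_def by (elim allE[of _ k]) auto
      then show ?case using step by simp
    qed simp
    from this[of "i + 1"] have rb: "r \<le> b" using i by (simp add: r_def v_def hidden_value_def)
    let ?g = "\<lambda>y. (2 * ln (1 + s i * y) - ln (1 + s i * l) - ln (1 + s i * r)) * (1 / (1 + s i * y))"
    have gm: "(\<lambda>y. indicator {l..r} y * (R * ?g y)) \<in> borel_measurable nonneg_borel"
      by (rule measurable_nonneg_borelD[OF refl]) measurable
    have "(\<integral>y. indicator {x. ordered N a b x} (x(i := y)) * site_term N a b s i (x(i := y)) \<partial>uniform_law a b)
      = (\<integral>y. indicator {l..r} y * (R * ?g y) \<partial>uniform_law a b)"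
      unfolding st by (rule Bochner_Integration.integral_cong[OF refl]) (simp add: o True indicator_def)
    also have "\<dots> = (LBINT y:{a..b}. indicator {l..r} y * (R * ?g y)) / (b - a)"
      by (rule integral_uniform_law[OF ab(1) lt gm])
    also have "(LBINT y:{a..b}. indicator {l..r} y * (R * ?g y)) = (LBINT y:{l..r}. R * ?g y)"
      unfolding set_lebesgue_integral_def
      by (rule Bochner_Integration.integral_cong[OF refl]) (use al rb in \<open>auto simp: indicator_def\<close>)
    also have "\<dots> = R * (LBINT y:{l..r}. ?g y)" by (rule set_integral_mult_right)
    also have "(LBINT y:{l..r}. ?g y) = 0" by (rule site_integral_zero[OF si]) (use al ab in simp)
    finally show ?thesis by (simp only: mult_zero_right div_0)
  next
    case False
    then show ?thesis by (simp add: o)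
  qed
qed

lemma site_integral_ordered:
  assumes lt: "a < b" and i: "i \<in> {1..N}"
  shows "integrable (\<Pi>\<^sub>M i\<in>{1..N}. uniform_law a b) (\<lambda>x. indicator {x. ordered N a b x} x * site_term N a b s i x)"
    "(\<integral>x. indicator {x. ordered N a b x} x * site_term N a b s i x \<partial>(\<Pi>\<^sub>M i\<in>{1..N}. uniform_law a b)) = 0"
proof -
  let ?I = "{1..N} - {i}"
  let ?U = "\<lambda>_ :: nat. uniform_law a b"
  interpret product_prob_space ?U by (rule product_prob_spaceI) (rule prob_space_uniform_law[OF ab])
  interpret Q: prob_space "Pi\<^sub>M {1..N} ?U" by (rule product_law_prob[OF N ab])
  have ins: "insert i ?I = {1..N}" using i by auto
  let ?f = "\<lambda>x. indicator {x. ordered N a b x} x * site_term N a b s i x"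
  have "(\<lambda>x. indicator {x \<in> orthant N. ordered N a b x} x * site_term N a b s i x) \<in> borel_measurable (config_space N)"
    by (intro borel_measurable_times borel_measurable_indicator ordered_measurable[OF N ab] site_term_measurable i)
  then have "?f \<in> borel_measurable (config_space N)"
    by (rule measurable_cong[THEN iffD1, rotated]) (simp add: indicator_def)
  then have fm: "?f \<in> borel_measurable (Pi\<^sub>M {1..N} ?U)" by (rule product_law_measurable[OF N ab])
  have bd: "\<bar>?f x\<bar> \<le> \<bar>4 * ln (1 + s i * b)\<bar>" if "x \<in> orthant N" for x
    using site_term_bound[OF i that] by (auto simp: indicator_def)
  show int: "integrable (Pi\<^sub>M {1..N} ?U) ?f"
    by (rule Q.integrable_const_bound[where B="\<bar>4 * ln (1 + s i * b)\<bar>", OF _ fm])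
      (rule AE_I2, use bd product_law_sets(2)[OF N ab] in simp)
  have "integral\<^sup>L (Pi\<^sub>M (insert i ?I) ?U) ?f = (\<integral>x. (\<integral>y. ?f (x(i := y)) \<partial>uniform_law a b) \<partial>Pi\<^sub>M ?I ?U)"
    by (rule product_integral_insert) (use int ins in auto)
  also have "\<dots> = 0" by (simp only: conditional_site_integral[OF lt i] Bochner_Integration.integral_zero)
  finally show "integral\<^sup>L (Pi\<^sub>M {1..N} ?U) ?f = 0" by (simp only: ins)
qed

lemma order_law_site_integral:
  "(\<integral>x. (\<Sum>i\<in>{1..N}. site_term N a b s i x) \<partial>uniform_order_statistics_law N a b) = 0"
proof (cases "a = b")
  case False
  then have lt: "a < b" using ab by simp
  show ?thesis
  proof (rule integral_order_law_zero[OF N ab lt, where B="\<Sum>i\<in>{1..N}. 4 * ln (1 + s i * b)"])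
    show "(\<lambda>x. \<Sum>i\<in>{1..N}. site_term N a b s i x) \<in> borel_measurable (config_space N)"
      by (rule borel_measurable_sum[OF site_term_measurable])
    show "\<bar>\<Sum>i\<in>{1..N}. site_term N a b s i x\<bar> \<le> (\<Sum>i\<in>{1..N}. 4 * ln (1 + s i * b))"
      if "x \<in> orthant N" "ordered N a b x" for x
      by (rule order_trans[OF sum_abs sum_mono]) (rule site_term_bound[OF _ that])
    show "(\<integral>x. indicator {x. ordered N a b x} x * (\<Sum>i\<in>{1..N}. site_term N a b s i x) \<partial>(\<Pi>\<^sub>M i\<in>{1..N}. uniform_law a b)) = 0"
      unfolding sum_distrib_left
    proof (rule trans[OF Bochner_Integration.integral_sum])
      show "integrable (\<Pi>\<^sub>M i\<in>{1..N}. uniform_law a b) (\<lambda>x. indicator {x. ordered N a b x} x * site_term N a b s i x)"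
        if "i \<in> {1..N}" for i by (rule site_integral_ordered(1)[OF lt that])
      show "(\<Sum>i\<in>{1..N}. \<integral>x. indicator {x. ordered N a b x} x * site_term N a b s i x \<partial>(\<Pi>\<^sub>M i\<in>{1..N}. uniform_law a b)) = 0"
        by (rule sum.neutral, rule ballI, rule site_integral_ordered(2)[OF lt])
    qed
  qed
next
  case True
  have G: "(\<lambda>x. \<Sum>i\<in>{1..N}. site_term N a b s i x) \<in> borel_measurable (config_space N)"
    by (rule borel_measurable_sum[OF site_term_measurable])
  \<comment> \<open>In the degenerate case all order statistics and both reservoirs have the value
    \<open>a\<close>, so the logarithms cancel at every site without any integration.\<close>
  have "AE x in (\<Pi>\<^sub>M i\<in>{1..N}. uniform_law a b). (\<Sum>i\<in>{1..N}. site_term N a b s i (order_statistics N x)) = 0"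
    using product_law_bounds[OF N ab]
  proof eventually_elim
    case (elim x)
    obtain p where p: "p permutes {1..N}" "\<forall>i\<in>{1..N}. \<forall>j\<in>{1..N}. i \<le> j \<longrightarrow> x (p i) \<le> x (p j)"
      using sorting_permutation[of N x] by blast
    have os: "order_statistics N x i = a" if "i \<in> {1..N}" for i
    proof -
      have "order_statistics N x = rearrange N p x" by (rule sort_rearrange(2)[OF p(1)]) (use p(2) in blast)
      then have "order_statistics N x i = x (p i)" using that by (simp add: rearrange_def)
      then show ?thesis using elim permutes_in_image[OF p(1), of i] that True by auto
    qed
    have hv: "hidden_value N a b (order_statistics N x) k = a" if "k \<le> N + 1" for k
      using os[of k] that True by (auto simp: hidden_value_def)
    show ?case
    proof (rule sum.neutral, rule ballI)
      fix i assume i: "i \<in> {1..N}"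
      then have "i - 1 \<le> N + 1" "i + 1 \<le> N + 1" by auto
      then show "site_term N a b s i (order_statistics N x) = 0"
        unfolding site_term_def os[OF i] by (simp only: hv) simp
    qed
  qed
  then show ?thesis
    unfolding integral_order_law[OF N ab G] by (rule integral_eq_zero_AE)
qed

lemma order_law_equation:
  "dual_op N (stieltjes.avg N (uniform_order_statistics_law N a b)) s
    = potential N a b s * stieltjes.avg N (uniform_order_statistics_law N a b) s"
proof -
  let ?\<mu> = "uniform_order_statistics_law N a b"
  note \<mu> = order_law_prob[OF N ab]
  have "0 = (\<integral>x. (\<Sum>i\<in>{1..N}. site_term N a b s i x) \<partial>?\<mu>)" by (rule order_law_site_integral[symmetric])
  also have "\<dots> = (\<integral>x. dual_op N (\<lambda>s. stieltjes.E N s x) s - potential N a b s * stieltjes.E N s x \<partial>?\<mu>)"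
    by (rule Bochner_Integration.integral_cong[OF refl]) (use site_term_sum stieltjes.space_config_law[OF \<mu>] in simp)
  also have "\<dots> = dual_op N (stieltjes.avg N ?\<mu>) s - potential N a b s * stieltjes.avg N ?\<mu> s"
    using stieltjes.integral_dual_op[OF \<mu> s] stieltjes.E_integrable[OF \<mu> s] by (simp add: stieltjes.avg_def)
  finally show ?thesis by simp
qed

end

lemma potential_nonneg: "0 \<le> a \<Longrightarrow> 0 \<le> b \<Longrightarrow> s \<in> params N \<Longrightarrow> 0 \<le> potential N a b s"
  using params_nonneg[of s N 1] params_nonneg[of s N N] by (simp add: potential_def)

theorem theorem3p4:
  fixes N :: nat and \<theta>L \<theta>R :: real
  assumes "N \<ge> 1" and "0 \<le> \<theta>L" and "\<theta>L \<le> \<theta>R"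
  shows "(\<forall>P. markov_semigroup_with_generator (config_space N) (test_functions N)
                 (hidden_generator N \<theta>L \<theta>R) P \<longrightarrow>
               (\<forall>\<nu>. invariant_measure (config_space N) P \<nu> \<longleftrightarrow>
                     \<nu> = uniform_order_statistics_law N \<theta>L \<theta>R)) \<and>
         (\<forall>P. markov_semigroup_with_generator (config_space N) (test_functions N)
                 (harmonic_generator N \<theta>L \<theta>R) P \<longrightarrow>
               (\<forall>\<nu>. invariant_measure (config_space N) P \<nu> \<longleftrightarrow>
                     \<nu> = exponential_mixture_law N \<theta>L \<theta>R))"
proof (intro conjI allI impI)
  note N = assms(1)
  have ab: "0 \<le> \<theta>L" "0 \<le> \<theta>R" using assms by auto
  let ?\<mu> = "uniform_order_statistics_law N \<theta>L \<theta>R"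
  note \<mu> = order_law_prob[OF assms]
  note eq = order_law_equation[OF assms]
  show "invariant_measure (config_space N) P \<nu> \<longleftrightarrow> \<nu> = ?\<mu>"
    if P: "markov_semigroup_with_generator (config_space N) (test_functions N) (hidden_generator N \<theta>L \<theta>R) P" for P \<nu>
  proof (rule stieltjes.invariant_measure_iff[OF N _ potential_nonneg[OF ab] hidden_generator_graph[OF N _ ab P] \<mu> eq])
    show "feller_semigroup (config_space N) P" using P by (simp add: markov_semigroup_with_generator_def)
    show "\<nu> = \<nu>'"
      if "\<nu> \<in> laws N" "\<nu>' \<in> laws N"
        "\<And>s. s \<in> params N \<Longrightarrow> stieltjes.avg N \<nu> s = stieltjes.avg N \<nu>' s" for \<nu> \<nu>'
      by (rule stieltjes.avg_determines[OF determines_inverse that])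
  qed
  have mix: "exponential_mixture_law N \<theta>L \<theta>R = Giry_Monad.bind ?\<mu> (exp_kernel N)"
    by (simp only: exponential_mixture_law_def exp_kernel_def[abs_def])
  note avg = avg_mixture[OF \<mu>]
  show "invariant_measure (config_space N) P \<nu> \<longleftrightarrow> \<nu> = exponential_mixture_law N \<theta>L \<theta>R"
    if P: "markov_semigroup_with_generator (config_space N) (test_functions N) (harmonic_generator N \<theta>L \<theta>R) P" for P \<nu>
    unfolding mix
  proof (rule laplace.invariant_measure_iff[OF N _ potential_nonneg[OF ab] harmonic_generator_graph[OF N _ ab P]])
    show "feller_semigroup (config_space N) P" using P by (simp add: markov_semigroup_with_generator_def)
    show "Giry_Monad.bind ?\<mu> (exp_kernel N) \<in> laws N"
      by (rule mixture_prob_algebra[OF \<mu>])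
    show "dual_op N (laplace.avg N (Giry_Monad.bind ?\<mu> (exp_kernel N))) s
      = potential N \<theta>L \<theta>R s * laplace.avg N (Giry_Monad.bind ?\<mu> (exp_kernel N)) s" if s: "s \<in> params N" for s
    proof -
      \<comment> \<open>The mixture inherits the dual equation: its averages agree on
        \<open>params N\<close> with those of the order statistics, and the dual operator evaluates
        them only there, since moves with \<open>u < 1\<close> stay in
        \<open>params N\<close>.\<close>
      have "dual_op N (laplace.avg N (Giry_Monad.bind ?\<mu> (exp_kernel N))) s = dual_op N (stieltjes.avg N ?\<mu>) s"
        by (rule dual_op_cong[OF s avg])
      then show ?thesis unfolding avg[OF s] eq[OF s] .
    qed
    show "\<nu> = \<nu>'"
      if "\<nu> \<in> laws N" "\<nu>' \<in> laws N"
        "\<And>s. s \<in> params N \<Longrightarrow> laplace.avg N \<nu> s = laplace.avg N \<nu>' s" for \<nu> \<nu>'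
      by (rule laplace.avg_determines[OF determines_exp that])
  qed
qed

end
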